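(* Let $n\ge 2$, let $\omega$ be a majorant and let $\alpha>-1$. Then the following statements are equivalent: (i) $\|P_\alpha\|_{\omega\to\omega}<\infty$. (ii) There is a constant $C$ such that $$P_\alpha[\tau_{a,\omega}](x)\le C\,\omega(|x-a|)\quad\text{for all } x\in\mathbb{B}^n \text{ and all } a\in\mathbb{S}^{n-1}.$$
   Context: $\mathbb{B}^n$ and $\mathbb{S}^{n-1}$ are the open unit ball and unit sphere of $\mathbb{R}^n$; $\sigma$ is the normalized surface measure on $\mathbb{S}^{n-1}$. A majorant is a continuous increasing function $\omega:[0,\infty)\to[0,\infty)$ with $\omega(0)=0$ such that $\omega(t)/t$ is non-increasing for $t>0$. For continuous $\varphi:\mathbb{S}^{n-1}\to\mathbb{R}$ and $x\in\mathbb{B}^n$, $$P_\alpha[\varphi](x)=\int_{\mathbb{S}^{n-1}}P_\alpha(x,\zeta)\varphi(\zeta)\,d\sigma(\zeta),\quad P_\alpha(x,\zeta)=C_{n,\alpha}\frac{(1-|x|^2)^{1+\alpha}}{|x-\zeta|^{n+\alpha}},\quad C_{n,\alpha}=\frac{\Gamma(\frac{n+\alpha}{2})\Gamma(1+\frac{\alpha}{2})}{\Gamma(\frac n2)\Gamma(1+\alpha)}.$$ For $\Omega\subset\mathbb{R}^n$, $\Lambda_\omega(\Omega)$ is the set of $f:\Omega\to\mathbb{R}$ for which there is $C>0$ with $|f(x)-f(y)|\le C\omega(|x-y|)$ for all $x,y\in\Omega$, and $$\|f\|_{\Lambda_\omega(\Omega)}=\sup_{x\in\Omega}|f(x)|+\sup_{x,y\in\Omega,\,x\ne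 y}\frac{|f(x)-f(y)|}{\omega(|x-y|)}.$$ The operator norm is $$\|P_\alpha\|_{\omega\to\omega}=\sup\left\{\frac{\|P_\alpha[f]\|_{\Lambda_\omega(\mathbb{B}^n)}}{\|f\|_{\Lambda_\omega(\mathbb{S}^{n-1})}}:\ f\in\Lambda_\omega(\mathbb{S}^{n-1}),\ \|f\|_{\Lambda_\omega(\mathbb{S}^{n-1})}\ne0\right\}\in[0,\infty].$$ For $a\in\mathbb{S}^{n-1}$, the test function $\tau_{a,\omega}$ on $\mathbb{S}^{n-1}$ is $\tau_{a,\omega}(\xi)=\omega(|\xi-a|)$. *)

theory Defs
  imports "HOL-Analysis.Analysis"
begin

text \<open>
  Weakly increasing functions are allowed. Monotonicity together with the monotonicity of
  \<open>\<omega> t / t\<close> forces \<open>\<omega>\<close> to be positive on \<open>{0<..}\<close> or identically zero there; positivity only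
  rules out the zero function, for which the quotients in the norm below are meaningless.
\<close>

definition majorant :: "(real \<Rightarrow> real) \<Rightarrow> bool" where
  "majorant \<omega> \<longleftrightarrow>
     continuous_on {0..} \<omega> \<and> mono_on {0..} \<omega> \<and> \<omega> 0 = 0 \<and>
     (\<forall>t>0. 0 < \<omega> t) \<and> antimono_on {0<..} (\<lambda>t. \<omega> t / t)"

text \<open>
  Normalized surface measure on the unit sphere, as the cone measure: the measure of a Borel set
  \<open>A\<close> is the proportion of the volume of the unit ball lying on the rays through \<open>A\<close>
  (\<open>sgn x = x /\<^sub>R norm x\<close>). The space of the measure is the sphere itself, so that integrals do
  not depend on the values of a function off the sphere.
\<close>

definition sphere_measure :: "(real ^ 'n) measure" where
  "sphere_measure =
     restrict_space (distr (uniform_measure lborel (ball 0 1)) borel sgn) (sphere 0 1)"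

lemma borel_measurable_sgn_vec: "(sgn :: real ^ 'n \<Rightarrow> real ^ 'n) \<in> borel_measurable borel"
  unfolding sgn_div_norm by measurable

lemma space_sphere_measure: "space (sphere_measure :: (real ^ 'n) measure) = sphere 0 1"
  by (simp add: sphere_measure_def space_restrict_space)

lemma emeasure_sphere_measure:
  fixes A :: "(real ^ 'n) set"
  assumes "A \<in> sets borel" "A \<subseteq> sphere 0 1"
  shows "emeasure sphere_measure A =
           emeasure lborel {x \<in> ball 0 1. sgn x \<in> A} / emeasure lborel (ball (0 :: real ^ 'n) 1)"
proof -
  have s: "sgn -` A \<in> sets (borel :: (real ^ 'n) measure)"
    using measurable_sets[OF borel_measurable_sgn_vec assms(1)] by simp
  have "emeasure sphere_measure A =
      emeasure (distr (uniform_measure lborel (ball 0 1)) borel sgn) A"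
    unfolding sphere_measure_def using assms by (intro emeasure_restrict_space) auto
  also have "\<dots> = emeasure (uniform_measure lborel (ball 0 1)) (sgn -` A)"
    using assms borel_measurable_sgn_vec by (subst emeasure_distr) auto
  also have "\<dots> = emeasure lborel (ball 0 1 \<inter> sgn -` A) / emeasure lborel (ball (0 :: real ^ 'n) 1)"
    using s by (subst emeasure_uniform_measure) auto
  also have "ball 0 1 \<inter> sgn -` A = {x \<in> ball 0 1. sgn x \<in> A}"
    by auto
  finally show ?thesis .
qed

lemma emeasure_sphere_measure_UNIV: "emeasure (sphere_measure :: (real ^ 'n) measure) (sphere 0 1) = 1"
proof -
  let ?B = "ball (0 :: real ^ 'n) 1"
  have eq: "{x \<in> ?B. sgn x \<in> sphere 0 1} = ?B - {0}"
    by (auto simp: norm_sgn split: if_splits)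
  have "emeasure lborel (?B - {0}) = emeasure lborel ?B"
    by (rule emeasure_Diff_null_set) auto
  moreover have "emeasure lborel ?B \<noteq> 0"
    using content_ball_pos[of 1 "0::real^'n"]
    by (auto simp: measure_def)
  moreover have "emeasure lborel ?B \<noteq> \<infinity>"
    using emeasure_lborel_ball_finite[of "0::real^'n" 1] by simp
  ultimately show ?thesis
    by (subst emeasure_sphere_measure) (simp_all only: eq ennreal_divide_self less_top infinity_ennreal_def, auto)
qed

definition poisson_const :: "nat \<Rightarrow> real \<Rightarrow> real" where
  "poisson_const n \<alpha> =
     Gamma ((real n + \<alpha>) / 2) * Gamma (1 + \<alpha> / 2) / (Gamma (real n / 2) * Gamma (1 + \<alpha>))"

definition poisson_kernel :: "real \<Rightarrow> real ^ 'n \<Rightarrow> real ^ 'n \<Rightarrow> real" where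
  "poisson_kernel \<alpha> x \<zeta> =
     poisson_const CARD('n) \<alpha> *
     ((1 - (norm x)\<^sup>2) powr (1 + \<alpha>) / norm (x - \<zeta>) powr (real CARD('n) + \<alpha>))"

definition poisson_transform :: "real \<Rightarrow> (real ^ 'n \<Rightarrow> real) \<Rightarrow> real ^ 'n \<Rightarrow> real" where
  "poisson_transform \<alpha> \<phi> x = (\<integral>\<zeta>. poisson_kernel \<alpha> x \<zeta> * \<phi> \<zeta> \<partial>sphere_measure)"

text \<open>
  A function on \<open>\<Omega>\<close> is represented by a function on the whole type; everything below depends
  only on its values on \<open>\<Omega>\<close>. The norm is extended-valued.
\<close>

definition Lambda_space :: "(real \<Rightarrow> real) \<Rightarrow> (real ^ 'n) set \<Rightarrow> (real ^ 'n \<Rightarrow> real) set" where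
  "Lambda_space \<omega> \<Omega> =
     {f. \<exists>C>0. \<forall>x\<in>\<Omega>. \<forall>y\<in>\<Omega>. \<bar>f x - f y\<bar> \<le> C * \<omega> (norm (x - y))}"

definition Lambda_norm ::
    "(real \<Rightarrow> real) \<Rightarrow> (real ^ 'n) set \<Rightarrow> (real ^ 'n \<Rightarrow> real) \<Rightarrow> ennreal" where
  "Lambda_norm \<omega> \<Omega> f =
     (SUP x\<in>\<Omega>. ennreal \<bar>f x\<bar>) +
     (SUP (x, y)\<in>{(x, y). x \<in> \<Omega> \<and> y \<in> \<Omega> \<and> x \<noteq> y}.
        ennreal (\<bar>f x - f y\<bar> / \<omega> (norm (x - y))))"

definition Lambda_op_norm ::
    "(real \<Rightarrow> real) \<Rightarrow> ((real ^ 'n \<Rightarrow> real) \<Rightarrow> real ^ 'n \<Rightarrow> real) \<Rightarrow> ennreal" where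
  "Lambda_op_norm \<omega> T =
     Sup {Lambda_norm \<omega> (ball 0 1) (T f) / Lambda_norm \<omega> (sphere 0 1) f | f.
            f \<in> Lambda_space \<omega> (sphere 0 1) \<and> Lambda_norm \<omega> (sphere 0 1) f \<noteq> 0}"

definition test_fun :: "(real \<Rightarrow> real) \<Rightarrow> real ^ 'n \<Rightarrow> real ^ 'n \<Rightarrow> real" where
  "test_fun \<omega> a \<xi> = \<omega> (norm (\<xi> - a))"

end

theory Submission
  imports Defs
begin

text \<open>
  If \<open>P\<^sub>\<alpha>\<close> is bounded, apply it to \<open>\<tau>\<^sub>a\<close>: its image is \<open>\<omega>\<close>-Lipschitz on the ball and tends to
  \<open>\<tau>\<^sub>a a = 0\<close> along the radius to \<open>a\<close>, which gives (ii).

  Conversely, for points \<open>x, y\<close> with \<open>\<bar>x - y\<bar> \<le> (1 - \<bar>x\<bar>) / 2\<close> the kernel varies by at most a constant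
  times \<open>\<bar>x - y\<bar> / (1 - \<bar>x\<bar>)\<close> times itself, and for all others \<open>P\<^sub>\<alpha>[f] x\<close> is compared with \<open>f a u x\<close>,
  where \<open>a\<close> is the sphere point nearest to \<open>x\<close> and \<open>u = P\<^sub>\<alpha>[1]\<close>. Both errors are controlled by
  \<open>P\<^sub>\<alpha>[\<tau>\<^sub>a] x \<le> C \<omega> (1 - \<bar>x\<bar>)\<close>. What remains is that \<open>u\<close>, which is not constant unless \<open>\<alpha> = 0\<close> or
  \<open>\<alpha> = n - 2\<close>, is itself \<open>\<omega>\<close>-Lipschitz. It is radial, and its radial derivative is
  \<open>O(1 + (1 - r)\<^sup>\<alpha>)\<close>: a recurrence between the integrals of powers of \<open>\<bar>x - \<zeta>\<bar>\<close>, obtained from the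
  divergence theorem on the sphere, cancels the leading singularity. Hence \<open>u\<close> has modulus of
  continuity \<open>O(t + t\<^bsup>1 + \<alpha>\<^esup>)\<close>, and (ii) at \<open>x = (1 - t) a\<close> forces \<open>\<omega> t\<close> to be at least a constant
  times this.
\<close>

section \<open>The normalized surface measure\<close>

text \<open>The obstacle is that \<open>P_\<alpha>[1]\<close> is not 1: freezing the boundary value
  at \<open>a\<close> leaves the error \<open>f a * (u x - u y)\<close>, and the kernel estimate
  alone only gives \<open>u' = O(1 / (1 - r))\<close>, which is not integrable up to the boundary.
  After the recurrence, and up to normalization, \<open>u'\<close> equals
  \<open>(n - 2 - \<alpha>) / (2 * r)\<close> times \<open>D powr \<alpha> * J - u\<close>, where
  \<open>D = 1 - r\<^sup>2\<close> and \<open>J\<close> integrates the power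
  \<open>- (n + \<alpha> - 2)\<close> of the distance. The integral \<open>J\<close> is less
  singular than \<open>u\<close> by two powers of the distance and is compared with its value for
  \<alpha> = 0, which is bounded; \<alpha> > -1 makes \<open>(1 - r) powr \<alpha>\<close>
  integrable. The exponent \<open>1 + \<alpha>\<close> enters twice, for different reasons. For
  \<alpha> < 0 it comes from integrating \<open>(1 - r) powr \<alpha>\<close> in the bound for
  \<open>u'\<close>. It is also the order of the kernel away from its pole, hence of a lower bound
  for \<open>P_\<alpha>[\<tau>_a]\<close>. Because the two agree, (ii) is strong enough to control
  \<open>u\<close>. The linear term costs nothing, since \<open>\<omega> t / t\<close> is
  non-increasing.\<close>

lemma sets_sphere_measure:
  "sets (sphere_measure :: (real ^ 'n) measure) = sets (restrict_space borel (sphere 0 1))"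
  by (simp add: sphere_measure_def sets_restrict_space)

lemma finite_measure_sphere_measure: "finite_measure (sphere_measure :: (real ^ 'n) measure)"
  by (rule finite_measureI)
     (simp add: space_sphere_measure emeasure_sphere_measure_UNIV)

lemma measure_sphere_measure_UNIV: "measure (sphere_measure :: (real ^ 'n) measure) (sphere 0 1) = 1"
  by (simp add: measure_def emeasure_sphere_measure_UNIV)

lemma borel_measurable_sphere_measure_continuous:
  fixes f :: "real ^ 'n \<Rightarrow> real"
  assumes "continuous_on (sphere 0 1) f"
  shows "f \<in> borel_measurable sphere_measure"
  using borel_measurable_continuous_on_restrict[OF assms]
  by (simp cong: measurable_cong_sets add: sets_sphere_measure)

lemma integrable_sphere_measure_bounded:
  fixes f :: "real ^ 'n \<Rightarrow> real"
  assumes "f \<in> borel_measurable sphere_measure" "\<And>\<zeta>. norm \<zeta> = 1 \<Longrightarrow> \<bar>f \<zeta>\<bar> \<le> B"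
  shows "integrable sphere_measure f"
  using assms
  by (intro finite_measure.integrable_const_bound[OF finite_measure_sphere_measure, where B = B])
     (auto simp: space_sphere_measure intro!: AE_I2)

lemma integrable_sphere_measure_continuous:
  fixes f :: "real ^ 'n \<Rightarrow> real"
  assumes "continuous_on (sphere 0 1) f"
  shows "integrable sphere_measure f"
proof -
  have "compact (f ` sphere 0 1)"
    using assms by (intro compact_continuous_image) auto
  then obtain B where "\<forall>y\<in>f ` sphere 0 1. norm y \<le> B"
    using compact_imp_bounded bounded_iff by metis
  then show ?thesis
    using assms by (intro integrable_sphere_measure_bounded[of _ B]
        borel_measurable_sphere_measure_continuous) auto
qed

lemma integral_sphere_measure:
  fixes f :: "real ^ 'n \<Rightarrow> real"
  assumes [measurable]: "f \<in> borel_measurable borel"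
  shows "(\<integral>\<zeta>. f \<zeta> \<partial>sphere_measure) =
           (\<integral>y. indicator (ball 0 1) y * f (sgn y) \<partial>lborel) / measure lborel (ball (0 :: real ^ 'n) 1)"
proof -
  let ?B = "ball (0 :: real ^ 'n) 1"
  note [measurable] = borel_measurable_sgn_vec
  have [measurable]: "sphere 0 1 \<in> sets (borel :: (real ^ 'n) measure)"
    by (rule borel_closed) simp
  have [measurable]: "?B \<in> sets borel"
    by (rule borel_open) simp
  have fin: "emeasure lborel ?B = ennreal (measure lborel ?B)"
    using emeasure_lborel_ball_finite[of "0::real^'n" 1]
    by (simp add: emeasure_eq_ennreal_measure)
  have "(\<integral>\<zeta>. f \<zeta> \<partial>sphere_measure) =
      (\<integral>\<zeta>. indicator (sphere 0 1) \<zeta> * f \<zeta> \<partial>distr (uniform_measure lborel ?B) borel sgn)"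
    unfolding sphere_measure_def by (subst integral_restrict_space) auto
  also have "\<dots> = (\<integral>y. indicator (sphere 0 1) (sgn y) * f (sgn y) \<partial>uniform_measure lborel ?B)"
    by (subst integral_distr) auto
  also have "\<dots> = (\<integral>y. indicator (sphere 0 1) (sgn y) * f (sgn y)
      \<partial>density lborel (\<lambda>x. ennreal (indicator ?B x / measure lborel ?B)))"
    unfolding uniform_measure_def fin
    by (intro arg_cong2[where f = lebesgue_integral] density_cong refl AE_I2)
       (auto simp: divide_ennreal content_ball_pos indicator_def simp flip: ennreal_1)
  also have "\<dots> = (\<integral>y. (indicator ?B y / measure lborel ?B) * (indicator (sphere 0 1) (sgn y) * f (sgn y)) \<partial>lborel)"
    by (subst integral_real_density) auto
  also have "\<dots> = (\<integral>y. (indicator ?B y * f (sgn y)) / measure lborel ?B \<partial>lborel)"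
  proof (rule integral_cong_AE)
    \<comment> \<open>The origin is the only point of the ball that \<open>sgn\<close> does not send
      to the sphere, and it is a null set.\<close>
    show "AE y in lborel. indicator ?B y / measure lborel ?B * (indicator (sphere 0 1) (sgn y) * f (sgn y)) =
        indicator ?B y * f (sgn y) / measure lborel ?B"
      using AE_lborel_singleton[of "0::real^'n"]
      by eventually_elim (auto simp: norm_sgn indicator_def)
  qed auto
  finally show ?thesis by simp
qed

text \<open>
  The library has this only for well-ordered index types. The proof is the uniqueness argument for
  Haar measure: by Tonelli and translation invariance, both sides of the claim become equal after
  multiplication with the volume of the unit ball, which \<open>T\<close> preserves.
\<close>

lemma lborel_distr_orthogonal:
  fixes T :: "'a::euclidean_space \<Rightarrow> 'a"
  assumes T: "orthogonal_transformation T"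
  shows "distr lborel borel T = lborel"
proof (rule measure_eqI)
  have lin: "linear T" using T by (rule orthogonal_transformation_linear)
  have [measurable]: "T \<in> borel_measurable borel"
    using lin by (intro borel_measurable_continuous_onI linear_continuous_on) 
      (simp add: linear_conv_bounded_linear)
  have trans: "(\<integral>\<^sup>+x. g (c + x) \<partial>lborel) = (\<integral>\<^sup>+x. g x \<partial>lborel)"
    if [measurable]: "g \<in> borel_measurable borel" for g :: "'a \<Rightarrow> ennreal" and c
  proof -
    have "(\<integral>\<^sup>+x. g x \<partial>lborel) = (\<integral>\<^sup>+x. g x \<partial>distr lborel borel ((+) c))"
      by (simp only: lborel_distr_plus)
    then show ?thesis by (simp add: nn_integral_distr)
  qed
  have [measurable]: "ball 0 1 \<in> sets (borel :: 'a measure)"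
    by (rule borel_open) simp
  let ?i = "indicator (ball 0 1) :: 'a \<Rightarrow> ennreal"
  let ?V = "emeasure lborel (ball (0::'a) 1)"
  have iT: "?i (T y) = ?i y" for y
    using T by (simp add: indicator_def orthogonal_transformation)
  show "sets (distr lborel borel T) = sets lborel" by simp
  fix A assume "A \<in> sets (distr lborel borel T)"
  then have [measurable]: "A \<in> sets borel" by simp
  define f where "f = (indicator A :: 'a \<Rightarrow> ennreal)"
  have [measurable]: "f \<in> borel_measurable borel"
    by (simp add: f_def)
  have "(\<integral>\<^sup>+x. f x \<partial>lborel) * ?V = (\<integral>\<^sup>+y. (\<integral>\<^sup>+x. f x \<partial>lborel) * ?i y \<partial>lborel)"
    by (subst nn_integral_cmult_indicator) auto
  also have "\<dots> = (\<integral>\<^sup>+y. (\<integral>\<^sup>+x. f (T y + x) * ?i y \<partial>lborel) \<partial>lborel)"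
    by (simp add: nn_integral_multc trans)
  also have "\<dots> = (\<integral>\<^sup>+x. (\<integral>\<^sup>+y. f (T y + x) * ?i y \<partial>lborel) \<partial>lborel)"
    by (rule lborel_pair.Fubini') measurable
  also have "\<dots> = (\<integral>\<^sup>+x. (\<integral>\<^sup>+y. f (T y) * ?i (T y - x) \<partial>lborel) \<partial>lborel)"
  proof (rule nn_integral_cong)
    fix x :: 'a
    \<comment> \<open>Surjectivity turns the translation by \<open>x\<close> outside
      \<open>T\<close> into a translation by \<open>z\<close> inside; the isometry then removes
      \<open>T\<close> from the indicator.\<close>
    obtain z where z: "x = T z"
      using orthogonal_transformation_surj[OF T] by (auto simp: surj_def)
    have "(\<integral>\<^sup>+y. f (T y) * ?i (T y - x) \<partial>lborel) =
        (\<integral>\<^sup>+y. f (T (z + y)) * ?i (T (z + y) - x) \<partial>lborel)"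
      by (rule trans[symmetric]) measurable
    then show "(\<integral>\<^sup>+y. f (T y + x) * ?i y \<partial>lborel) = (\<integral>\<^sup>+y. f (T y) * ?i (T y - x) \<partial>lborel)"
      by (simp add: z linear_add[OF lin] iT add.commute)
  qed
  also have "\<dots> = (\<integral>\<^sup>+y. (\<integral>\<^sup>+x. f (T y) * ?i (T y - x) \<partial>lborel) \<partial>lborel)"
    by (rule lborel_pair.Fubini') measurable
  also have "\<dots> = (\<integral>\<^sup>+y. f (T y) * ?V \<partial>lborel)"
  proof (rule nn_integral_cong)
    fix y :: 'a
    \<comment> \<open>Translating by \<open>T y\<close> leaves the indicator at \<open>- x\<close>,
      and the ball is symmetric about 0.\<close>
    have "(\<integral>\<^sup>+x. ?i (T y - x) \<partial>lborel) = (\<integral>\<^sup>+x. ?i (T y - (T y + x)) \<partial>lborel)"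
      by (rule trans[symmetric]) measurable
    also have "\<dots> = (\<integral>\<^sup>+x. ?i x \<partial>lborel)"
      by (intro nn_integral_cong) (simp add: indicator_def)
    also have "\<dots> = ?V"
      by (subst nn_integral_indicator) auto
    finally show "(\<integral>\<^sup>+x. f (T y) * ?i (T y - x) \<partial>lborel) = f (T y) * ?V"
      by (simp add: nn_integral_cmult)
  qed
  also have "\<dots> = (\<integral>\<^sup>+y. f (T y) \<partial>lborel) * ?V"
    by (simp add: nn_integral_multc)
  finally have "(\<integral>\<^sup>+x. f x \<partial>lborel) = (\<integral>\<^sup>+y. f (T y) \<partial>lborel)"
    using emeasure_lborel_ball_finite[of "0::'a" 1] content_ball_pos[of 1 "0::'a"]
    by (subst (asm) (1 2) mult.commute) (auto simp: ennreal_mult_cancel_left measure_def)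
  also have "\<dots> = (\<integral>\<^sup>+y. f y \<partial>distr lborel borel T)"
    by (simp add: nn_integral_distr)
  finally show "emeasure (distr lborel borel T) A = emeasure lborel A"
    by (simp add: f_def)
qed

text \<open>An orthogonal map commutes with \<open>sgn\<close> and preserves the unit ball, so the
  cone measure inherits the invariance of Lebesgue measure.\<close>

lemma integral_sphere_measure_orthogonal:
  fixes f :: "real ^ 'n \<Rightarrow> real" and T :: "real ^ 'n \<Rightarrow> real ^ 'n"
  assumes [measurable]: "f \<in> borel_measurable borel" and T: "orthogonal_transformation T"
  shows "(\<integral>\<zeta>. f (T \<zeta>) \<partial>sphere_measure) = (\<integral>\<zeta>. f \<zeta> \<partial>sphere_measure)"
proof -
  note [measurable] = borel_measurable_sgn_vec
  have [measurable]: "ball 0 1 \<in> sets (borel :: (real ^ 'n) measure)"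
    by (rule borel_open) simp
  have lin: "linear T" using T by (rule orthogonal_transformation_linear)
  have [measurable]: "T \<in> borel_measurable borel"
    using lin by (intro borel_measurable_continuous_onI linear_continuous_on) 
      (simp add: linear_conv_bounded_linear)
  have sgn: "T (sgn y) = sgn (T y)" for y
    using T lin by (simp add: sgn_div_norm linear_scale orthogonal_transformation)
  have ball: "indicator (ball 0 1) (T y) = (indicator (ball 0 1) y :: real)" for y
    using T by (simp add: indicator_def orthogonal_transformation)
  have "(\<integral>y. indicator (ball 0 1) y * f (sgn y) \<partial>lborel) =
      (\<integral>y. indicator (ball 0 1) y * f (sgn y) \<partial>distr lborel borel T)"
    by (simp add: lborel_distr_orthogonal[OF T])
  also have "\<dots> = (\<integral>y. indicator (ball 0 1) y * f (T (sgn y)) \<partial>lborel)"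
    by (subst integral_distr) (auto simp: sgn ball)
  finally show ?thesis
    by (simp add: integral_sphere_measure)
qed

text \<open>Dominated convergence for the difference quotients along sequences. The Lipschitz bound
  is asked only against the base point \<open>r\<close>, and the derivative only almost everywhere,
  to admit integrands with a kink on a null set such as the cutoff function in
  \<open>sphere_divergence\<close>.\<close>

lemma has_field_derivative_integral_Lipschitz:
  fixes f :: "real \<Rightarrow> 'a \<Rightarrow> real"
  assumes int: "\<And>h. h \<in> S \<Longrightarrow> integrable M (f h)" 
    and S: "open S" "r \<in> S"
    and f': "f' \<in> borel_measurable M"
    and L: "integrable M L"
    and Lip: "\<And>h x. h \<in> S \<Longrightarrow> x \<in> space M \<Longrightarrow> \<bar>f h x - f r x\<bar> \<le> L x * \<bar>h - r\<bar>"
    and deriv: "AE x in M. ((\<lambda>h. f h x) has_real_derivative f' x) (at r)"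
  shows "((\<lambda>h. \<integral>x. f h x \<partial>M) has_real_derivative (\<integral>x. f' x \<partial>M)) (at r)"
  unfolding has_field_derivative_iff
proof (subst tendsto_at_iff_sequentially, intro allI impI)
  fix X :: "nat \<Rightarrow> real"
  assume X: "\<forall>i. X i \<in> UNIV - {r}" "X \<longlonglongrightarrow> r"
  have "eventually (\<lambda>i. X i \<in> S) sequentially"
    using X(2) S by (rule topological_tendstoD)
  then obtain N where N: "\<And>i. i \<ge> N \<Longrightarrow> X i \<in> S"
    by (auto simp: eventually_sequentially)
  \<comment> \<open>Dropping the first \<open>N\<close> terms keeps the whole sequence in
    \<open>S\<close>, so the domination holds for every index.\<close>
  define Y where "Y i = X (i + N)" for i
  have Y: "Y i \<in> S" "Y i \<noteq> r" for i
    using N X(1) by (auto simp: Y_def)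
  have Yl: "Y \<longlonglongrightarrow> r"
    unfolding Y_def using X(2) by (rule LIMSEQ_ignore_initial_segment)
  have "(\<lambda>i. \<integral>x. (f (Y i) x - f r x) / (Y i - r) \<partial>M) \<longlonglongrightarrow> (\<integral>x. f' x \<partial>M)"
  proof (rule integral_dominated_convergence[where w = L])
    show "f' \<in> borel_measurable M" "integrable M L" by fact+
    show "(\<lambda>x. (f (Y i) x - f r x) / (Y i - r)) \<in> borel_measurable M" for i
      using int[OF Y(1), THEN borel_measurable_integrable] int[OF S(2), THEN borel_measurable_integrable]
      by measurable
    show "AE x in M. (\<lambda>i. (f (Y i) x - f r x) / (Y i - r)) \<longlonglongrightarrow> f' x"
      using deriv
    proof eventually_elim
      case (elim x)
      then have "((\<lambda>h. (f h x - f r x) / (h - r)) \<longlongrightarrow> f' x) (at r)"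
        by (simp add: has_field_derivative_iff)
      then show ?case
        using Y(2) Yl unfolding tendsto_at_iff_sequentially o_def by auto
    qed
    show "AE x in M. norm ((f (Y i) x - f r x) / (Y i - r)) \<le> L x" for i
      using Lip[OF Y(1)] Y(2)[of i] by (intro AE_I2) (simp add: field_simps abs_minus_commute)
  qed
  also have "(\<lambda>i. \<integral>x. (f (Y i) x - f r x) / (Y i - r) \<partial>M) =
      (\<lambda>i. ((\<integral>x. f (Y i) x \<partial>M) - (\<integral>x. f r x \<partial>M)) / (Y i - r))"
    using int Y S by (intro ext) (simp add: Bochner_Integration.integral_diff)
  finally show "((\<lambda>h. ((\<integral>x. f h x \<partial>M) - (\<integral>x. f r x \<partial>M)) / (h - r)) \<circ> X) \<longlonglongrightarrow> (\<integral>x. f' x \<partial>M)"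
    unfolding o_def Y_def by (rule LIMSEQ_offset)
qed

section \<open>The divergence theorem on the sphere\<close>

text \<open>A layer-cake argument in place of polar coordinates: \<open>1 - norm y\<close> is the
  length of the set of radii \<open>R\<close> with \<open>norm y < R \<le> 1\<close>. After Fubini
  the ball of radius \<open>R\<close> contributes \<open>R ^ n\<close> times the full integral, and
  \<open>R ^ n\<close> integrates to \<open>1 / (n + 1)\<close> over the unit interval.\<close>

lemma integral_ball_one_minus_norm_mult:
  fixes G :: "real ^ 'n \<Rightarrow> real"
  assumes [measurable]: "G \<in> borel_measurable borel" and G: "\<And>y. \<bar>G (sgn y)\<bar> \<le> K"
  shows "(\<integral>y. indicator (ball 0 1) y * ((1 - norm y) * G (sgn y)) \<partial>lborel) =
           (\<integral>y. indicator (ball 0 1) y * G (sgn y) \<partial>lborel) / (real CARD('n) + 1)"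
proof -
  note [measurable] = borel_measurable_sgn_vec
  let ?n = "CARD('n)"
  define M where "M = (\<integral>y. indicator (ball 0 1) y * G (sgn y) \<partial>lborel)"
  have [measurable]: "ball 0 1 \<in> sets (borel :: (real ^ 'n) measure)"
    by (rule borel_open) simp
  define f where "f = (\<lambda>(y :: real ^ 'n, R). indicator {0..1} R * (if norm y < R then G (sgn y) else 0) :: real)"
  have [measurable]: "f \<in> borel_measurable (borel \<Otimes>\<^sub>M borel)"
    unfolding f_def by measurable
  have "integrable (lborel \<Otimes>\<^sub>M lborel)
      (\<lambda>z. (K * indicator (ball (0 :: real ^ 'n) 1 \<times> {0..1::real}) z) :: real)"
  proof (intro integrable_mult_right integrable_real_indicator)
    show "emeasure (lborel \<Otimes>\<^sub>M lborel) (ball (0 :: real ^ 'n) 1 \<times> {0..1::real}) < \<infinity>"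
      using emeasure_lborel_ball_finite[of "0 :: real ^ 'n" 1]
      by (subst lborel.emeasure_pair_measure_Times) (auto simp: ennreal_mult_less_top)
  qed auto
  then have int: "integrable (lborel \<Otimes>\<^sub>M lborel) f"
  proof (rule Bochner_Integration.integrable_bound)
    show "AE z in lborel \<Otimes>\<^sub>M lborel. norm (f z) \<le> norm (K * indicator (ball (0 :: real ^ 'n) 1 \<times> {0..1::real}) z)"
    proof (rule AE_I2)
      fix z :: "(real ^ 'n) \<times> real"
      show "norm (f z) \<le> norm (K * indicator (ball (0 :: real ^ 'n) 1 \<times> {0..1::real}) z)"
        using G[of "fst z"] by (cases z) (auto simp: f_def indicator_def abs_mult)
    qed
  qed measurable
  have scale: "(\<integral>y. (if norm y < R then G (sgn y) else 0) \<partial>lborel) = R ^ ?n * M"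
    if R: "R > 0" for R :: real
  proof -
    have "(\<integral>y. (if norm y < R then G (sgn y) else 0) \<partial>lborel) =
       (\<integral>y. (if norm y < R then G (sgn y) else 0)
          \<partial>density (distr lborel borel (\<lambda>x :: real ^ 'n. 0 + R *\<^sub>R x)) (\<lambda>_. ennreal (\<bar>R\<bar> ^ DIM(real ^ 'n))))"
      by (subst lborel_affine[of R "0 :: real ^ 'n", symmetric]) (use R in simp_all)
    also have "\<dots> = (\<integral>y. \<bar>R\<bar> ^ ?n * (if norm (R *\<^sub>R y) < R then G (sgn (R *\<^sub>R y)) else 0) \<partial>lborel)"
      by (subst integral_real_density, measurable, simp, subst integral_distr) auto
    also have "\<dots> = (\<integral>y. R ^ ?n * (indicator (ball 0 1) y * G (sgn y)) \<partial>lborel)"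
      using R by (intro Bochner_Integration.integral_cong refl)
        (auto simp: indicator_def sgn_scaleR)
    finally show ?thesis by (simp add: M_def)
  qed
  have "(\<integral>y. indicator (ball 0 1) y * ((1 - norm y) * G (sgn y)) \<partial>lborel) =
      (\<integral>y. (\<integral>R. f (y, R) \<partial>lborel) \<partial>lborel)"
  proof (rule Bochner_Integration.integral_cong[OF refl])
    fix y :: "real ^ 'n"
    have "(\<integral>R. f (y, R) \<partial>lborel) = (\<integral>R. G (sgn y) * indicator {norm y<..1} R \<partial>lborel)"
      by (intro Bochner_Integration.integral_cong refl)
        (use norm_ge_zero[of y] in \<open>auto simp: f_def indicator_def simp del: norm_ge_zero\<close>)
    also have "\<dots> = G (sgn y) * measure lborel {norm y<..1}"
      by simp
    finally show "indicator (ball 0 1) y * ((1 - norm y) * G (sgn y)) = (\<integral>R. f (y, R) \<partial>lborel)"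
      by (simp add: indicator_def measure_def)
  qed
  also have "\<dots> = (\<integral>R. (\<integral>y. f (y, R) \<partial>lborel) \<partial>lborel)"
    using lborel_pair.Fubini_integral[of "\<lambda>y R. f (y, R)"] int by simp
  also have "\<dots> = (\<integral>R. M * (R ^ ?n * indicator {0..1} R) \<partial>lborel)"
  proof (rule Bochner_Integration.integral_cong[OF refl])
    fix R :: real
    show "(\<integral>y. f (y, R) \<partial>lborel) = M * (R ^ ?n * indicator {0..1} R)"
      using scale[of R] by (cases "R > 0") (auto simp: f_def indicator_def power_0_left)
  qed
  also have "\<dots> = M * (1 / (real ?n + 1))"
    by (simp add: integral_power add.commute)
  finally show ?thesis by (simp add: M_def)
qed

text \<open>Stretched by \<open>norm y\<close>, the difference of directions is \<open>y - z\<close>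
  plus a multiple of \<open>sgn z\<close> whose length is the difference of the norms. The factor
  \<open>norm y\<close> compensates for \<open>sgn\<close> not being Lipschitz at the
  origin.\<close>

lemma norm_mult_diff_sgn_le:
  fixes y z :: "'a::real_normed_vector"
  shows "norm y * norm (sgn y - sgn z) \<le> 2 * norm (y - z)"
proof (cases "z = 0 \<or> y = 0")
  case False
  have "norm y *\<^sub>R (sgn y - sgn z) = (y - z) + (norm z - norm y) *\<^sub>R sgn z"
    using False by (simp add: sgn_div_norm algebra_simps)
  then have "norm y * norm (sgn y - sgn z) = norm ((y - z) + (norm z - norm y) *\<^sub>R sgn z)"
    by (metis norm_ge_zero abs_of_nonneg norm_scaleR)
  also have "\<dots> \<le> norm (y - z) + \<bar>norm z - norm y\<bar> * norm (sgn z)"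
    by (metis norm_scaleR norm_triangle_ineq)
  also have "\<dots> \<le> norm (y - z) + norm (y - z)"
    using False norm_triangle_ineq3[of y z] by (simp add: norm_sgn abs_minus_commute)
  finally show ?thesis by simp
qed (auto simp: norm_sgn)

lemma inner_sgn_Icc: "norm e = 1 \<Longrightarrow> e \<bullet> sgn y \<in> {-1..1}"
  for e y :: "'a::real_inner"
  using Cauchy_Schwarz_ineq2[of e "sgn y"] by (auto simp: norm_sgn split: if_splits)

text \<open>
  The divergence theorem on the sphere for the tangential part of the field \<open>g (e \<bullet> \<zeta>) e\<close>. It
  expresses that the integral of \<open>\<psi> \<bar>y\<bar> g (e \<bullet> sgn y)\<close> over the whole space, with the
  cutoff \<open>\<psi> r = max 0 (r - r\<^sup>2)\<close>, does not change under translation in direction \<open>e\<close>.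
\<close>

lemma sphere_divergence:
  fixes e :: "real ^ 'n" and g g' :: "real \<Rightarrow> real"
  assumes e: "norm e = 1"
    and [measurable]: "g \<in> borel_measurable borel" "g' \<in> borel_measurable borel"
    and g: "\<And>t. t \<in> {-1..1} \<Longrightarrow> (g has_real_derivative g' t) (at t)"
    and g': "continuous_on {-1..1} g'"
  shows "(\<integral>\<zeta>. (1 - (e \<bullet> \<zeta>)\<^sup>2) * g' (e \<bullet> \<zeta>) - (real CARD('n) - 1) * (e \<bullet> \<zeta>) * g (e \<bullet> \<zeta>)
            \<partial>sphere_measure) = 0"
proof -
  note [measurable] = borel_measurable_sgn_vec
  have [measurable]: "ball 0 r \<in> sets (borel :: (real ^ 'n) measure)" for r
    by (rule borel_open) simp
  have "continuous_on {-1..1} g"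
    using g by (meson DERIV_continuous continuous_at_imp_continuous_on)
  then have "compact (g ` {-1..1})" "compact (g' ` {-1..1})"
    using g' by (auto intro: compact_continuous_image)
  then obtain K0 K1 where "\<forall>y\<in>g ` {-1..1}. norm y \<le> K0" "\<forall>y\<in>g' ` {-1..1}. norm y \<le> K1"
    using compact_imp_bounded bounded_iff by metis
  then have K0: "\<bar>g t\<bar> \<le> K0" and K1: "\<bar>g' t\<bar> \<le> K1" if "t \<in> {-1..1}" for t
    using that by auto
  have K0p: "K0 \<ge> 0" and K1p: "K1 \<ge> 0"
    using K0[of 0] K1[of 0] by auto
  have gL: "\<bar>g t - g s\<bar> \<le> K1 * \<bar>t - s\<bar>" if "t \<in> {-1..1}" "s \<in> {-1..1}" for t s
    using field_differentiable_bound[of "{-1..1}" g g' K1 t s] g K1 that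
    by (auto intro: DERIV_subset)
  \<comment> \<open>The cutoff vanishes at 0, where the direction is undefined, and at 1, so
    \<open>H\<close> is Lipschitz on the whole space. Being quadratic, it makes both
    \<open>\<psi>' r = 1 - 2 * r\<close> and \<open>\<psi> r / r = 1 - r\<close> affine on the unit
    interval.\<close>
  define \<psi> where "\<psi> r = max 0 (r - r\<^sup>2)" for r :: real
  define H where "H y = \<psi> (norm y) * g (e \<bullet> sgn y)" for y :: "real ^ 'n"
  have [measurable]: "H \<in> borel_measurable borel"
    unfolding H_def \<psi>_def by measurable
  have psi_le: "\<psi> r \<le> r" if "r \<ge> 0" for r
    using that by (auto simp: \<psi>_def)
  have psiL: "\<bar>\<psi> a - \<psi> b\<bar> \<le> \<bar>a - b\<bar>" if "a \<ge> 0" "b \<ge> 0" for a b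
  proof -
    have *: "\<bar>\<psi> a - \<psi> b\<bar> \<le> b - a" if ab: "0 \<le> a" "a \<le> b" for a b :: real
    proof -
      have 1: "a\<^sup>2 \<le> b\<^sup>2" using ab by (simp add: power_mono)
      have 2: "(a - a\<^sup>2) - (b - b\<^sup>2) \<le> b - a" if "b \<le> 1"
      proof -
        have "(b - a) * (b + a) \<le> (b - a) * 2"
          using ab that by (intro mult_left_mono) auto
        then show ?thesis by (simp add: algebra_simps power2_eq_square)
      qed
      have 3: "b - b\<^sup>2 \<le> 0" if "b > 1"
        using that by (simp add: power2_eq_square)
      have 4: "a - a\<^sup>2 \<le> 1 - a"
        using zero_le_power2[of "a - 1"] by (simp add: power2_eq_square algebra_simps)
      show ?thesis
      proof (cases "b \<le> 1")
        case True
        have "b - b\<^sup>2 \<ge> 0" "a - a\<^sup>2 \<ge> 0"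
          using True ab by (auto simp: power2_eq_square mult_left_le)
        then show ?thesis using 1 2 True by (simp add: \<psi>_def)
      next
        case False
        then show ?thesis using 3 4 ab by (auto simp: \<psi>_def)
      qed
    qed
    show ?thesis using *[of a b] *[of b a] that by (cases "a \<le> b") auto
  qed
  define L where "L = K0 + 2 * K1"
  have HL: "\<bar>H y - H z\<bar> \<le> L * norm (y - z)" for y z
  proof -
    have "H y - H z = (\<psi> (norm y) - \<psi> (norm z)) * g (e \<bullet> sgn z) +
        \<psi> (norm y) * (g (e \<bullet> sgn y) - g (e \<bullet> sgn z))"
      by (simp add: H_def algebra_simps)
    then have "\<bar>H y - H z\<bar> \<le> \<bar>\<psi> (norm y) - \<psi> (norm z)\<bar> * \<bar>g (e \<bullet> sgn z)\<bar> +
        \<bar>\<psi> (norm y)\<bar> * \<bar>g (e \<bullet> sgn y) - g (e \<bullet> sgn z)\<bar>"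
      by (metis abs_mult abs_triangle_ineq)
    also have "\<dots> \<le> norm (y - z) * K0 + norm y * (K1 * norm (sgn y - sgn z))"
    proof (intro add_mono mult_mono)
      show "\<bar>\<psi> (norm y) - \<psi> (norm z)\<bar> \<le> norm (y - z)"
        using psiL[of "norm y" "norm z"] norm_triangle_ineq3[of y z] by simp
      show "\<bar>g (e \<bullet> sgn z)\<bar> \<le> K0" using K0 inner_sgn_Icc[OF e] by blast
      show "\<bar>\<psi> (norm y)\<bar> \<le> norm y" using psi_le[of "norm y"] by (simp add: \<psi>_def)
      have "\<bar>e \<bullet> sgn y - e \<bullet> sgn z\<bar> \<le> norm (sgn y - sgn z)"
        using Cauchy_Schwarz_ineq2[of e "sgn y - sgn z"] e by (simp add: inner_diff_right)
      then show "\<bar>g (e \<bullet> sgn y) - g (e \<bullet> sgn z)\<bar> \<le> K1 * norm (sgn y - sgn z)"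
        using gL[OF inner_sgn_Icc[OF e] inner_sgn_Icc[OF e], of y z] K1p
        by (meson mult_left_mono order_trans)
    qed auto
    also have "norm y * (K1 * norm (sgn y - sgn z)) = K1 * (norm y * norm (sgn y - sgn z))"
      by simp
    also have "\<dots> \<le> K1 * (2 * norm (y - z))"
      by (rule mult_left_mono[OF norm_mult_diff_sgn_le K1p])
    finally show ?thesis by (simp add: L_def algebra_simps)
  qed
  have H0: "H y = 0" if "norm y \<ge> 1" for y
    using that self_le_power[of "norm y" 2] by (simp add: H_def \<psi>_def)
  define G1 where "G1 \<zeta> = (e \<bullet> \<zeta>) * g (e \<bullet> \<zeta>)" for \<zeta>
  define G2 where "G2 \<zeta> = (1 - (e \<bullet> \<zeta>)\<^sup>2) * g' (e \<bullet> \<zeta>)" for \<zeta>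
  have [measurable]: "G1 \<in> borel_measurable borel" "G2 \<in> borel_measurable borel"
    unfolding G1_def G2_def by measurable
  have G1b: "\<bar>G1 (sgn y)\<bar> \<le> 1 * K0" for y
    unfolding G1_def abs_mult using inner_sgn_Icc[OF e, of y] K0[of "e \<bullet> sgn y"]
    by (intro mult_mono) auto
  have G2b: "\<bar>G2 (sgn y)\<bar> \<le> 1 * K1" for y
  proof -
    have "(e \<bullet> sgn y)\<^sup>2 \<le> 1"
      using inner_sgn_Icc[OF e, of y] by (simp add: abs_square_le_1 abs_le_iff)
    then show ?thesis
      unfolding G2_def abs_mult using inner_sgn_Icc[OF e, of y] K1[of "e \<bullet> sgn y"]
      by (intro mult_mono) auto
  qed
  \<comment> \<open>The derivative of \<open>H\<close> in direction \<open>e\<close>. With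
    \<open>t = e \<bullet> sgn y\<close>, the norm has derivative \<open>t\<close> and
    \<open>t\<close> has derivative \<open>(1 - t\<^sup>2) / norm y\<close>; the quotient
    \<open>\<psi> / norm y\<close> becomes \<open>1 - norm y\<close>.\<close>
  define F' where "F' y = indicator (ball 0 1) y *
      ((1 - 2 * norm y) * G1 (sgn y) + (1 - norm y) * G2 (sgn y))" for y :: "real ^ 'n"
  have [measurable]: "F' \<in> borel_measurable borel"
    unfolding F'_def by measurable
  \<comment> \<open>For all shifts shorter than 1 the integrands live in one ball of radius 2, which
    yields an integrable dominating function.\<close>
  have supp: "H (y + h *\<^sub>R e) = 0" if "\<bar>h\<bar> < 1" "norm y \<ge> 2" for y h
    using that norm_diff_ineq[of y "h *\<^sub>R e"] e by (intro H0) simp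
  have bint: "integrable lborel (\<lambda>y. c * indicator (ball (0 :: real ^ 'n) r) y)" for c r :: real
    using emeasure_lborel_ball_finite[of "0 :: real ^ 'n" r]
    by (intro integrable_mult_right integrable_real_indicator) auto
  have deriv: "((\<lambda>h. \<integral>y. H (y + h *\<^sub>R e) \<partial>lborel) has_real_derivative (\<integral>y. F' y \<partial>lborel)) (at 0)"
  proof (rule has_field_derivative_integral_Lipschitz[where S = "{-1<..<1}"])
    show "integrable lborel (\<lambda>y. H (y + h *\<^sub>R e))" if h: "h \<in> {-1<..<1}" for h
    proof (rule Bochner_Integration.integrable_bound[OF bint[of K0 2]])
      show "AE y in lborel. norm (H (y + h *\<^sub>R e)) \<le> norm (K0 * indicator (ball 0 2) y)"
      proof (rule AE_I2)
        fix y
        have "\<psi> r \<le> 1" for r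
          using zero_le_power2[of "r - 1/2"] by (auto simp: \<psi>_def power2_eq_square algebra_simps)
        then have "\<bar>H (y + h *\<^sub>R e)\<bar> \<le> 1 * K0"
          unfolding H_def abs_mult using inner_sgn_Icc[OF e]
          by (intro mult_mono K0) (auto simp: \<psi>_def)
        then show "norm (H (y + h *\<^sub>R e)) \<le> norm (K0 * indicator (ball 0 2) y)"
          using supp[of h y] h by (auto simp: indicator_def)
      qed
    qed measurable
    show "integrable lborel (\<lambda>y. L * indicator (ball (0 :: real ^ 'n) 2) y)" by (rule bint)
    show "\<bar>H (y + h *\<^sub>R e) - H (y + 0 *\<^sub>R e)\<bar> \<le> L * indicator (ball 0 2) y * \<bar>h - 0\<bar>"
      if h: "h \<in> {-1<..<1}" for h y
    proof (cases "norm y < 2")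
      case True
      then show ?thesis using HL[of "y + h *\<^sub>R e" y] e by (simp add: indicator_def)
    next
      case False
      then show ?thesis using supp[of h y] supp[of 0 y] h by (simp add: indicator_def abs_less_iff)
    qed
    \<comment> \<open>The derivative formula is claimed off the unit sphere, where the cutoff has
      its kink, and off the origin.\<close>
    have sph: "AE y in lborel. norm (y :: real ^ 'n) \<noteq> 1"
    proof -
      have "sphere (0 :: real ^ 'n) 1 \<in> null_sets lborel"
        using negligible_sphere[of "0 :: real ^ 'n" 1] borel_closed[of "sphere (0 :: real ^ 'n) 1"]
        by (simp add: negligible_iff_null_sets null_sets_completion_iff)
      from AE_not_in[OF this] show ?thesis by simp
    qed
    show "AE y in lborel. ((\<lambda>h. H (y + h *\<^sub>R e)) has_real_derivative F' y) (at 0)"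
      using sph AE_lborel_singleton[of "0 :: real ^ 'n"]
    proof eventually_elim
      case (elim y)
      show ?case
      proof (cases "norm y < 1")
        case False
        then have y: "norm y > 1" using elim by simp
        have "((\<lambda>h. H (y + h *\<^sub>R e)) has_real_derivative F' y) (at 0) \<longleftrightarrow>
            ((\<lambda>h. 0) has_real_derivative F' y) (at (0 :: real))"
        proof (rule DERIV_cong_ev[OF refl _ refl])
          have "open {h :: real. norm (y + h *\<^sub>R e) > 1}"
            by (intro open_Collect_less continuous_intros)
          then have "eventually (\<lambda>h. norm (y + h *\<^sub>R e) > 1) (nhds (0 :: real))"
            using y eventually_nhds_in_open[of "{h. norm (y + h *\<^sub>R e) > 1}" 0] by simp
          then show "eventually (\<lambda>h. H (y + h *\<^sub>R e) = 0) (nhds (0 :: real))"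
            by eventually_elim (simp add: H0)
        qed
        then show ?thesis using False by (simp add: F'_def)
      next
        case True
        define N where "N h = norm (y + h *\<^sub>R e)" for h :: real
        define t where "t = e \<bullet> sgn y"
        have ey: "e \<bullet> y = t * norm y"
          using elim by (simp add: t_def sgn_div_norm)
        have N0: "N 0 = norm y" by (simp add: N_def)
        have ee: "e \<bullet> e = 1" using e by (simp add: dot_square_norm)
        have "(N h)\<^sup>2 = (norm y)\<^sup>2 + 2 * h * (e \<bullet> y) + h\<^sup>2" for h
          unfolding N_def power2_norm_eq_inner
          by (simp add: inner_add_left inner_add_right inner_commute ee power2_eq_square)
        then have Neq: "N h = sqrt ((norm y)\<^sup>2 + 2 * h * (e \<bullet> y) + h\<^sup>2)" for h
          by (metis N_def norm_ge_zero real_sqrt_unique)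
        have dN: "(N has_real_derivative t) (at 0)"
          unfolding Neq[abs_def] using elim
          by (auto intro!: derivative_eq_intros simp: ey divide_simps)
        have dT: "((\<lambda>h. (e \<bullet> y + h) / N h) has_real_derivative (1 - t\<^sup>2) / norm y) (at 0)"
          using elim by (auto intro!: derivative_eq_intros dN 
              simp: N0 ey field_simps power2_eq_square)
        have T0: "(e \<bullet> y + 0) / N 0 = t"
          using elim by (simp add: N0 ey)
        have tI: "t \<in> {-1..1}" unfolding t_def by (rule inner_sgn_Icc[OF e])
        have dg: "((\<lambda>h. g ((e \<bullet> y + h) / N h)) has_real_derivative g' t * ((1 - t\<^sup>2) / norm y)) (at 0)"
          by (rule DERIV_chain2[OF _ dT]) (use g[OF tI] T0 in simp)
        have dH: "((\<lambda>h. (N h - (N h)\<^sup>2) * g ((e \<bullet> y + h) / N h)) has_real_derivative F' y) (at 0)"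
          by (rule DERIV_cong[OF DERIV_mult[OF DERIV_diff[OF dN DERIV_power[OF dN, of 2]] dg]],
              unfold T0) (use True elim in \<open>simp add: F'_def N0 G1_def G2_def t_def[symmetric]
                field_simps power2_eq_square\<close>)
        have "((\<lambda>h. H (y + h *\<^sub>R e)) has_real_derivative F' y) (at 0) \<longleftrightarrow>
            ((\<lambda>h. (N h - (N h)\<^sup>2) * g ((e \<bullet> y + h) / N h)) has_real_derivative F' y) (at 0)"
        proof (rule DERIV_cong_ev[OF refl _ refl])
          have "open {h :: real. norm (y + h *\<^sub>R e) < 1}"
            by (intro open_Collect_less continuous_intros)
          then have "eventually (\<lambda>h. norm (y + h *\<^sub>R e) < 1) (nhds (0 :: real))"
            using True eventually_nhds_in_open[of "{h. norm (y + h *\<^sub>R e) < 1}" 0] by simp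
          then show "eventually (\<lambda>h. H (y + h *\<^sub>R e) = (N h - (N h)\<^sup>2) * g ((e \<bullet> y + h) / N h)) (nhds (0 :: real))"
          proof eventually_elim
            case (elim h)
            have "N h - (N h)\<^sup>2 \<ge> 0"
              using elim by (simp add: N_def power2_eq_square mult_left_le)
            moreover have "e \<bullet> sgn (y + h *\<^sub>R e) = (e \<bullet> y + h) / N h"
              using e by (simp add: sgn_div_norm N_def inner_add_right dot_square_norm divide_inverse mult.commute)
            ultimately show ?case by (simp add: H_def \<psi>_def N_def)
          qed
        qed
        then show ?thesis using dH by simp
      qed
    qed
  qed auto
  have const: "(\<integral>y. H (y + h *\<^sub>R e) \<partial>lborel) = (\<integral>y. H y \<partial>lborel)" for h
  proof -
    have "(\<integral>y. H y \<partial>lborel) = (\<integral>y. H y \<partial>distr lborel borel ((+) (h *\<^sub>R e)))"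
      by (simp only: lborel_distr_plus)
    then show ?thesis by (simp add: integral_distr add.commute)
  qed
  have "(\<integral>y. F' y \<partial>lborel) = 0"
    using DERIV_unique[OF deriv] by (simp add: const)
  define A where "A G = (\<integral>y. indicator (ball 0 1) y * G (sgn y) \<partial>lborel)" for G :: "real ^ 'n \<Rightarrow> real"
  define B where "B G = (\<integral>y. indicator (ball 0 1) y * ((1 - norm y) * G (sgn y)) \<partial>lborel)" for G :: "real ^ 'n \<Rightarrow> real"
  have iA: "integrable lborel (\<lambda>y. indicator (ball 0 1) y * G (sgn y))" (is ?iA)
    and iB: "integrable lborel (\<lambda>y. indicator (ball 0 1) y * ((1 - norm y) * G (sgn y)))" (is ?iB)
    if [measurable]: "G \<in> borel_measurable borel" and K: "\<And>y. \<bar>G (sgn y)\<bar> \<le> K"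
    for G :: "real ^ 'n \<Rightarrow> real" and K
  proof -
    show ?iA
      by (rule Bochner_Integration.integrable_bound[OF bint[of K 1]])
        (use K in \<open>auto intro!: AE_I2 simp: indicator_def\<close>, smt (verit) K)
    then show ?iB
      by (rule Bochner_Integration.integrable_bound)
        (auto intro!: AE_I2 simp: indicator_def abs_mult mult_left_le_one_le)
  qed
  note i = iA[of G1, OF _ G1b, simplified] iB[of G1, OF _ G1b, simplified]
    iA[of G2, OF _ G2b, simplified] iB[of G2, OF _ G2b, simplified]
  \<comment> \<open>Writing \<open>1 - 2 * r\<close> as \<open>2 * (1 - r) - 1\<close> leaves only
    the weights 1 and \<open>1 - r\<close>.\<close>
  have "(\<integral>y. F' y \<partial>lborel) = (\<integral>y. 2 * (indicator (ball 0 1) y * ((1 - norm y) * G1 (sgn y)))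
     - indicator (ball 0 1) y * G1 (sgn y)
     + indicator (ball 0 1) y * ((1 - norm y) * G2 (sgn y)) \<partial>lborel)"
    by (intro Bochner_Integration.integral_cong refl) (simp add: F'_def algebra_simps)
  also have "\<dots> = 2 * B G1 - A G1 + B G2"
    unfolding A_def B_def using i by simp
  also have "B G1 = A G1 / (real CARD('n) + 1)"
    unfolding A_def B_def by (rule integral_ball_one_minus_norm_mult[of G1, OF _ G1b]) measurable
  also have "B G2 = A G2 / (real CARD('n) + 1)"
    unfolding A_def B_def by (rule integral_ball_one_minus_norm_mult[of G2, OF _ G2b]) measurable
  \<comment> \<open>The factor \<open>n - 1\<close> of the divergence identity arises here, from
    \<open>1 - 2 / (n + 1) = (n - 1) / (n + 1)\<close>.\<close>
  finally have "2 * (A G1 / (real CARD('n) + 1)) - A G1 + A G2 / (real CARD('n) + 1) = 0"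
    using \<open>(\<integral>y. F' y \<partial>lborel) = 0\<close> by simp
  then have "(2 * A G1 + A G2) / (real CARD('n) + 1) = A G1"
    by (simp add: add_divide_distrib)
  then have "2 * A G1 + A G2 = A G1 * (real CARD('n) + 1)"
    by (subst (asm) nonzero_divide_eq_eq) auto
  then have AA: "A G2 - (real CARD('n) - 1) * A G1 = 0"
    by (simp add: algebra_simps)
  have "(\<integral>\<zeta>. G2 \<zeta> - (real CARD('n) - 1) * G1 \<zeta> \<partial>sphere_measure) =
     (A G2 - (real CARD('n) - 1) * A G1) / measure lborel (ball (0 :: real ^ 'n) 1)"
  proof -
    have "(\<integral>y. indicator (ball 0 1) y * (G2 (sgn y) - (real CARD('n) - 1) * G1 (sgn y)) \<partial>lborel) =
        (\<integral>y. indicator (ball 0 1) y * G2 (sgn y)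
          - (real CARD('n) - 1) * (indicator (ball 0 1) y * G1 (sgn y)) \<partial>lborel)"
      by (intro Bochner_Integration.integral_cong refl) (simp add: right_diff_distrib mult.left_commute)
    also have "\<dots> = A G2 - (real CARD('n) - 1) * A G1"
      unfolding A_def using i by simp
    finally show ?thesis
      by (subst integral_sphere_measure) simp_all
  qed
  then show ?thesis
    by (simp add: AA G1_def G2_def mult.assoc)
qed

section \<open>Zonal integrals\<close>

text \<open>For unit vectors \<open>e\<close> and \<zeta> the base is the squared distance from
  \<open>r *\<^sub>R e\<close> to \<zeta>, so this is the integral of the power
  \<open>- 2 * q\<close> of the distance. Squared distances are kept because they are affine in
  \<open>e \<bullet> \<zeta>\<close>.\<close>

definition zonal_integral :: "real ^ 'n \<Rightarrow> real \<Rightarrow> real \<Rightarrow> real" where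
  "zonal_integral e q r = (\<integral>\<zeta>. (1 + r\<^sup>2 - 2 * r * (e \<bullet> \<zeta>)) powr (- q) \<partial>sphere_measure)"

text \<open>A power is monotone in one direction or the other; adding both endpoint values saves a
  distinction by the sign of \<open>p\<close>.\<close>

lemma powr_le_add_endpoints:
  fixes x :: real
  assumes "0 < a" "a \<le> x" "x \<le> b"
  shows "x powr p \<le> a powr p + b powr p"
proof (cases "p \<ge> 0")
  case True
  then have "x powr p \<le> b powr p" using assms by (intro powr_mono2) auto
  then show ?thesis by (simp add: add_increasing)
next
  case False
  then have "x powr p \<le> a powr p" using assms by (intro powr_mono2') auto
  then show ?thesis by (simp add: add_increasing2)
qed

section \<open>Range of the squared distance and comparison of exponents\<close>

lemma zonal_bounds:
  fixes r t :: real
  assumes "0 \<le> r" "r < 1" "t \<in> {-1..1}"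
  shows "(1 - r)\<^sup>2 \<le> 1 + r\<^sup>2 - 2 * r * t" "1 + r\<^sup>2 - 2 * r * t \<le> 4" "0 < 1 + r\<^sup>2 - 2 * r * t"
proof -
  have 1: "r * t \<le> r" "- r \<le> r * t"
    using mult_left_mono[of t 1 r] mult_left_mono[of "- 1" t r] assms by auto
  then show "(1 - r)\<^sup>2 \<le> 1 + r\<^sup>2 - 2 * r * t"
    by (simp add: power2_eq_square algebra_simps)
  moreover have "(1 - r)\<^sup>2 > 0" using assms by simp
  ultimately show "0 < 1 + r\<^sup>2 - 2 * r * t" by linarith
  have "r\<^sup>2 \<le> 1" using assms by (simp add: power_le_one)
  then show "1 + r\<^sup>2 - 2 * r * t \<le> 4" using 1 assms by simp
qed

lemma inner_sphere_Icc:
  fixes e \<zeta> :: "'a::real_inner"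
  assumes "norm e = 1" "norm \<zeta> = 1"
  shows "e \<bullet> \<zeta> \<in> {-1..1}"
  using Cauchy_Schwarz_ineq2[of e \<zeta>] assms by auto

lemma continuous_on_zonal:
  fixes e :: "real ^ 'n"
  assumes "norm e = 1" "0 \<le> r" "r < 1"
  shows "continuous_on (sphere 0 1) (\<lambda>\<zeta>. (1 + r\<^sup>2 - 2 * r * (e \<bullet> \<zeta>)) powr p)"
  using assms zonal_bounds(3)[OF assms(2,3) inner_sphere_Icc[OF assms(1)]]
  by (intro continuous_intros ballI) (force simp: less_le)

lemma integrable_zonal:
  fixes e :: "real ^ 'n"
  assumes "norm e = 1" "0 \<le> r" "r < 1"
  shows "integrable sphere_measure (\<lambda>\<zeta>. (1 + r\<^sup>2 - 2 * r * (e \<bullet> \<zeta>)) powr p)"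
  by (rule integrable_sphere_measure_continuous[OF continuous_on_zonal[OF assms]])

lemma zonal_integral_nonneg: "zonal_integral e q r \<ge> 0"
  by (simp add: zonal_integral_def)

text \<open>Reduces every comparison between two exponents to an inequality in one real variable
  \<open>x\<close>, the squared distance.\<close>

lemma zonal_integral_mono_factor:
  fixes e :: "real ^ 'n"
  assumes e: "norm e = 1" and r: "0 \<le> r" "r < 1"
    and le: "\<And>x. \<lbrakk>(1 - r)\<^sup>2 \<le> x; x \<le> 4; 0 < x\<rbrakk> \<Longrightarrow> c * x powr (- q) \<le> d * x powr (- p)"
  shows "c * zonal_integral e q r \<le> d * zonal_integral e p r"
proof -
  have "(\<integral>\<zeta>. c * (1 + r\<^sup>2 - 2 * r * (e \<bullet> \<zeta>)) powr (- q) \<partial>sphere_measure) \<le>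
      (\<integral>\<zeta>. d * (1 + r\<^sup>2 - 2 * r * (e \<bullet> \<zeta>)) powr (- p) \<partial>sphere_measure)"
  proof (rule integral_mono)
    fix \<zeta> :: "real ^ 'n" assume "\<zeta> \<in> space sphere_measure"
    then have "e \<bullet> \<zeta> \<in> {-1..1}"
      using e by (intro inner_sphere_Icc) (auto simp: space_sphere_measure)
    from zonal_bounds[OF r this] 
    show "c * (1 + r\<^sup>2 - 2 * r * (e \<bullet> \<zeta>)) powr (- q) \<le> d * (1 + r\<^sup>2 - 2 * r * (e \<bullet> \<zeta>)) powr (- p)"
      by (intro le)
  qed (use integrable_zonal[OF e r] in auto)
  then show ?thesis by (simp add: zonal_integral_def)
qed

text \<open>Since \<open>0 powr 0\<close> is 0, the integrand is at most 1 without any condition on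
  \<open>e\<close> and \<open>r\<close>.\<close>

lemma zonal_integral_0: "zonal_integral (e :: real ^ 'n) 0 r \<le> 1"
proof -
  have "zonal_integral e 0 r \<le> (\<integral>\<zeta>. 1 \<partial>(sphere_measure :: (real ^ 'n) measure))"
    unfolding zonal_integral_def
    by (rule integral_mono') (auto simp: powr_def intro!: integrable_sphere_measure_continuous)
  then show ?thesis
    by (simp add: space_sphere_measure measure_sphere_measure_UNIV)
qed

text \<open>The divergence identity for \<open>g t = Q t powr (- q)\<close>. As
  \<open>2 * r * t = 1 + r\<^sup>2 - Q t\<close>, one gets \<open>4 * r\<^sup>2 * (1 - t\<^sup>2) =
  - (1 - r\<^sup>2)\<^sup>2 + 2 * (1 + r\<^sup>2) * Q t - (Q t)\<^sup>2\<close>. After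
  multiplication by \<open>2 * r\<close> the integrand is therefore a quadratic polynomial in
  \<open>Q t\<close> times \<open>Q t powr (- (q + 1))\<close>: three consecutive exponents.\<close>

lemma zonal_integral_recurrence:
  fixes e :: "real ^ 'n"
  assumes e: "norm e = 1" and r: "0 < r" "r < 1"
  shows "q * (1 - r\<^sup>2)\<^sup>2 * zonal_integral e (q + 1) r =
    (2 * q - real CARD('n) + 1) * (1 + r\<^sup>2) * zonal_integral e q r +
    (real CARD('n) - 1 - q) * zonal_integral e (q - 1) r"
proof -
  let ?n = "real CARD('n)"
  define Q where "Q t = 1 + r\<^sup>2 - 2 * r * t" for t
  have Qp: "Q t > 0" if "t \<in> {-1..1}" for t
    unfolding Q_def using zonal_bounds(3)[OF _ r(2) that] r by simp
  define g where "g t = Q t powr (- q)" for t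
  define g' where "g' t = 2 * r * q * Q t powr (- (q + 1))" for t
  have d: "(g has_real_derivative g' t) (at t)" if "t \<in> {-1..1}" for t
  proof -
    have "(Q has_real_derivative - (2 * r)) (at t)"
      unfolding Q_def[abs_def] by (auto intro!: derivative_eq_intros)
    from DERIV_chain2[OF has_real_derivative_powr[OF Qp[OF that], of "- q"] this] show ?thesis
      by (simp add: g_def[abs_def] g'_def mult_ac minus_add_distrib)
  qed
  have c: "continuous_on {-1..1} g'"
    unfolding g'_def Q_def[abs_def] using Qp
    by (intro continuous_intros ballI) (force simp: Q_def less_le)
  have [measurable]: "g \<in> borel_measurable borel" "g' \<in> borel_measurable borel"
    unfolding g_def[abs_def] g'_def[abs_def] Q_def[abs_def] by measurable
  have int: "integrable sphere_measure (\<lambda>\<zeta>. Q (e \<bullet> \<zeta>) powr p)" for p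
    unfolding Q_def using integrable_zonal[OF e _ r(2)] r by simp
  have "0 = 2 * r * (\<integral>\<zeta>. (1 - (e \<bullet> \<zeta>)\<^sup>2) * g' (e \<bullet> \<zeta>) - (?n - 1) * (e \<bullet> \<zeta>) * g (e \<bullet> \<zeta>)
            \<partial>sphere_measure)"
    using sphere_divergence[OF e _ _ d c] by simp
  also have "\<dots> = (\<integral>\<zeta>. 2 * r * ((1 - (e \<bullet> \<zeta>)\<^sup>2) * g' (e \<bullet> \<zeta>) - (?n - 1) * (e \<bullet> \<zeta>) * g (e \<bullet> \<zeta>))
            \<partial>sphere_measure)"
    by simp
  also have "\<dots> = (\<integral>\<zeta>. (2 * q - ?n + 1) * (1 + r\<^sup>2) * Q (e \<bullet> \<zeta>) powr (- q) +
      (?n - 1 - q) * Q (e \<bullet> \<zeta>) powr (- (q - 1)) - q * (1 - r\<^sup>2)\<^sup>2 * Q (e \<bullet> \<zeta>) powr (- (q + 1))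
      \<partial>sphere_measure)"
  proof (rule Bochner_Integration.integral_cong[OF refl])
    fix \<zeta> :: "real ^ 'n" assume "\<zeta> \<in> space sphere_measure"
    then have t: "e \<bullet> \<zeta> \<in> {-1..1}"
      using e by (intro inner_sphere_Icc) (auto simp: space_sphere_measure)
    define t P where "t = e \<bullet> \<zeta>" and "P = Q t powr (- (q + 1))"
    have Q: "Q t > 0" using t Qp by (simp add: t_def)
    have 1: "Q t powr (- q) = Q t * P" "Q t powr (- (q - 1)) = (Q t)\<^sup>2 * P"
      using Q powr_add[of "Q t" 1 "- (q + 1)"] powr_add[of "Q t" 2 "- (q + 1)"]
      by (auto simp: P_def powr_numeral)
    have "2 * r * ((1 - t\<^sup>2) * (2 * r * q) - (?n - 1) * t * Q t) =
        (2 * q - ?n + 1) * (1 + r\<^sup>2) * Q t + (?n - 1 - q) * (Q t)\<^sup>2 - q * (1 - r\<^sup>2)\<^sup>2"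
      unfolding Q_def by algebra
    then have "2 * r * ((1 - t\<^sup>2) * (2 * r * q) - (?n - 1) * t * Q t) * P =
        ((2 * q - ?n + 1) * (1 + r\<^sup>2) * Q t + (?n - 1 - q) * (Q t)\<^sup>2 - q * (1 - r\<^sup>2)\<^sup>2) * P"
      by simp
    then show "2 * r * ((1 - (e \<bullet> \<zeta>)\<^sup>2) * g' (e \<bullet> \<zeta>) - (?n - 1) * (e \<bullet> \<zeta>) * g (e \<bullet> \<zeta>)) =
      (2 * q - ?n + 1) * (1 + r\<^sup>2) * Q (e \<bullet> \<zeta>) powr (- q) +
      (?n - 1 - q) * Q (e \<bullet> \<zeta>) powr (- (q - 1)) - q * (1 - r\<^sup>2)\<^sup>2 * Q (e \<bullet> \<zeta>) powr (- (q + 1))"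
      unfolding t_def[symmetric] g_def g'_def 1 P_def[symmetric] by (simp add: algebra_simps)
  qed
  also have "\<dots> = (2 * q - ?n + 1) * (1 + r\<^sup>2) * zonal_integral e q r +
    (?n - 1 - q) * zonal_integral e (q - 1) r - q * (1 - r\<^sup>2)\<^sup>2 * zonal_integral e (q + 1) r"
    unfolding zonal_integral_def Q_def[symmetric] using int by simp
  finally show ?thesis by simp
qed

text \<open>The inner derivative \<open>2 * r - 2 * t\<close> times \<open>r\<close> equals
  \<open>Q - (1 - r\<^sup>2)\<close>, so the derivative is again a combination of zonal
  integrals.\<close>

lemma has_derivative_zonal_integral:
  fixes e :: "real ^ 'n"
  assumes e: "norm e = 1" and r: "0 < r" "r < 1"
  shows "(zonal_integral e q has_real_derivative
      - q / r * (zonal_integral e q r - (1 - r\<^sup>2) * zonal_integral e (q + 1) r)) (at r)"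
proof -
  define Q where "Q h t = 1 + h\<^sup>2 - 2 * h * t" for h t :: real
  \<comment> \<open>Ending halfway between \<open>r\<close> and 1 keeps the squared distances above
    \<open>(1 - r)\<^sup>2 / 4\<close>, uniformly in \<open>h\<close>.\<close>
  define S where "S = {0<..<(1 + r) / 2}"
  \<comment> \<open>The factor 4 bounds \<open>\<bar>2 * h - 2 * t\<bar>\<close>; the two powers are
    taken at the ends of the range of \<open>Q\<close>.\<close>
  define K where "K = \<bar>q\<bar> * 4 * (((1 - r)\<^sup>2 / 4) powr (- (q + 1)) + 4 powr (- (q + 1)))"
  have S: "0 \<le> h" "h < 1" "(1 - r)\<^sup>2 / 4 \<le> (1 - h)\<^sup>2" if "h \<in> S" for h
  proof -
    show "0 \<le> h" "h < 1" using that r by (auto simp: S_def)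
    have "((1 - r) / 2)\<^sup>2 \<le> (1 - h)\<^sup>2"
      using that r by (intro power_mono) (auto simp: S_def)
    then show "(1 - r)\<^sup>2 / 4 \<le> (1 - h)\<^sup>2" by (simp add: power_divide)
  qed
  have rS: "r \<in> S" using r by (simp add: S_def)
  have Qp: "Q h t > 0" if "h \<in> S" "t \<in> {-1..1}" for h t
    unfolding Q_def using zonal_bounds(3)[OF S(1,2) that(2)] that by simp
  have d: "((\<lambda>h. Q h t powr (- q)) has_real_derivative - q * Q h t powr (- (q + 1)) * (2 * h - 2 * t)) (at h)"
    if "h \<in> S" "t \<in> {-1..1}" for h t
  proof -
    have "((\<lambda>h. Q h t) has_real_derivative 2 * h - 2 * t) (at h)"
      unfolding Q_def by (auto intro!: derivative_eq_intros)
    from DERIV_chain2[OF has_real_derivative_powr[OF Qp[OF that], of "- q"] this] show ?thesis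
      by (simp add: minus_add_distrib)
  qed
  have K: "\<bar>- q * Q h t powr (- (q + 1)) * (2 * h - 2 * t)\<bar> \<le> K" if "h \<in> S" "t \<in> {-1..1}" for h t
  proof -
    have "(1 - r)\<^sup>2 / 4 \<le> Q h t" "Q h t \<le> 4"
      using S[OF that(1)] zonal_bounds[OF _ _ that(2), of h] by (auto simp: Q_def)
    then have "Q h t powr (- (q + 1)) \<le> ((1 - r)\<^sup>2 / 4) powr (- (q + 1)) + 4 powr (- (q + 1))"
      using r by (intro powr_le_add_endpoints) auto
    moreover have "\<bar>2 * h - 2 * t\<bar> \<le> 4" using S[OF that(1)] that by auto
    ultimately have "\<bar>q\<bar> * Q h t powr (- (q + 1)) * \<bar>2 * h - 2 * t\<bar> \<le>
       \<bar>q\<bar> * (((1 - r)\<^sup>2 / 4) powr (- (q + 1)) + 4 powr (- (q + 1))) * 4"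
      by (intro mult_mono) auto
    then show ?thesis by (simp add: K_def abs_mult mult_ac)
  qed
  have "((\<lambda>h. \<integral>\<zeta>. Q h (e \<bullet> \<zeta>) powr (- q) \<partial>sphere_measure) has_real_derivative
      (\<integral>\<zeta>. - q * Q r (e \<bullet> \<zeta>) powr (- (q + 1)) * (2 * r - 2 * (e \<bullet> \<zeta>)) \<partial>sphere_measure)) (at r)"
  proof (rule has_field_derivative_integral_Lipschitz[where L = "\<lambda>_. K" and S = S])
    show "integrable sphere_measure (\<lambda>\<zeta>. Q h (e \<bullet> \<zeta>) powr (- q))" if "h \<in> S" for h
      unfolding Q_def using integrable_zonal[OF e] S[OF that] by simp
    show "open S" by (simp add: S_def)
    show "(\<lambda>\<zeta>. - q * Q r (e \<bullet> \<zeta>) powr (- (q + 1)) * (2 * r - 2 * (e \<bullet> \<zeta>)))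
        \<in> borel_measurable sphere_measure"
      unfolding Q_def using r e
      by (intro borel_measurable_sphere_measure_continuous continuous_intros continuous_on_zonal) auto
    show "integrable (sphere_measure :: (real ^ 'n) measure) (\<lambda>_. K)"
      by (intro integrable_sphere_measure_continuous) auto
    fix h and \<zeta> :: "real ^ 'n" assume h: "h \<in> S" and "\<zeta> \<in> space sphere_measure"
    then have t: "e \<bullet> \<zeta> \<in> {-1..1}"
      using e by (intro inner_sphere_Icc) (auto simp: space_sphere_measure)
    have "norm (Q h (e \<bullet> \<zeta>) powr (- q) - Q r (e \<bullet> \<zeta>) powr (- q)) \<le> K * norm (h - r)"
    proof (rule field_differentiable_bound[where S = S])
      show "convex S" by (simp add: S_def)
    qed (use t d K h rS in \<open>auto intro: has_field_derivative_at_within\<close>)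
    then show "\<bar>Q h (e \<bullet> \<zeta>) powr (- q) - Q r (e \<bullet> \<zeta>) powr (- q)\<bar> \<le> K * \<bar>h - r\<bar>"
      by simp
  qed (use rS d[OF rS] inner_sphere_Icc[OF e] in \<open>auto simp: space_sphere_measure intro!: AE_I2\<close>)
  also have "(\<lambda>h. \<integral>\<zeta>. Q h (e \<bullet> \<zeta>) powr (- q) \<partial>sphere_measure) = zonal_integral e q"
    by (simp add: fun_eq_iff zonal_integral_def Q_def)
  also have "(\<integral>\<zeta>. - q * Q r (e \<bullet> \<zeta>) powr (- (q + 1)) * (2 * r - 2 * (e \<bullet> \<zeta>)) \<partial>sphere_measure) =
      (\<integral>\<zeta>. - q / r * (Q r (e \<bullet> \<zeta>) powr (- q) - (1 - r\<^sup>2) * Q r (e \<bullet> \<zeta>) powr (- (q + 1))) \<partial>sphere_measure)"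
  proof (rule Bochner_Integration.integral_cong[OF refl])
    fix \<zeta> :: "real ^ 'n" assume "\<zeta> \<in> space sphere_measure"
    then have t: "e \<bullet> \<zeta> \<in> {-1..1}"
      using e by (intro inner_sphere_Icc) (auto simp: space_sphere_measure)
    define t P where "t = e \<bullet> \<zeta>" and "P = Q r t powr (- (q + 1))"
    have Q: "Q r t > 0" using t Qp[OF rS] by (simp add: t_def)
    have 1: "Q r t powr (- q) = Q r t * P"
      using Q powr_add[of "Q r t" 1 "- (q + 1)"] by (auto simp: P_def)
    have 2: "r * (2 * r - 2 * t) = Q r t - (1 - r\<^sup>2)"
      by (simp add: Q_def power2_eq_square algebra_simps)
    have "- q * P * (r * (2 * r - 2 * t)) / r = - q / r * (Q r t * P - (1 - r\<^sup>2) * P)"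
      unfolding 2 by (simp add: right_diff_distrib[symmetric] mult_ac)
    then show "- q * Q r (e \<bullet> \<zeta>) powr (- (q + 1)) * (2 * r - 2 * (e \<bullet> \<zeta>)) =
       - q / r * (Q r (e \<bullet> \<zeta>) powr (- q) - (1 - r\<^sup>2) * Q r (e \<bullet> \<zeta>) powr (- (q + 1)))"
      unfolding t_def[symmetric] 1 P_def[symmetric] using r by simp
  qed
  also have "\<dots> = - q / r * (zonal_integral e q r - (1 - r\<^sup>2) * zonal_integral e (q + 1) r)"
    unfolding zonal_integral_def Q_def using integrable_zonal[OF e _ r(2)] r by simp
  finally show ?thesis .
qed

section \<open>The radial profile of the Poisson transform of 1\<close>

text \<open>Up to the factor \<open>poisson_const\<close> this is \<open>P_\<alpha>[1]\<close> at
  every point of norm \<open>r\<close>, for any unit vector \<open>e\<close>; see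
  \<open>poisson_transform_1\<close>. The exponent is halved because the zonal integral is based on
  squared distances.\<close>

definition radial_poisson :: "real ^ 'n \<Rightarrow> real \<Rightarrow> real \<Rightarrow> real" where
  "radial_poisson e \<alpha> r = (1 - r\<^sup>2) powr (1 + \<alpha>) * zonal_integral e ((real CARD('n) + \<alpha>) / 2) r"

lemma radial_poisson_nonneg: "radial_poisson e \<alpha> r \<ge> 0"
  by (simp add: radial_poisson_def zonal_integral_nonneg)

text \<open>Differentiation produces \<open>zonal_integral e (s + 1)\<close>, which the recurrence
  at \<open>q = s\<close> eliminates. Because \<open>2 * s - n + 1 = 1 + \<alpha>\<close>, its term
  \<open>(1 + \<alpha>) * (1 + r\<^sup>2)\<close> meets
  \<open>- 2 * r\<^sup>2 * (1 + \<alpha>)\<close> from the weight, and the sum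
  \<open>(1 + \<alpha>) * D\<close> gains a full power of \<open>D\<close>. The two remaining
  coefficients are opposite numbers, \<open>\<plusminus> (n - 2 - \<alpha>) / 2\<close>.\<close>

lemma has_derivative_radial_poisson:
  fixes e :: "real ^ 'n" and \<alpha> :: real
  assumes e: "norm e = 1" and r: "0 < r" "r < 1"
  defines "s \<equiv> (real CARD('n) + \<alpha>) / 2"
  shows "(radial_poisson e \<alpha> has_real_derivative
    ((1 + \<alpha> - s) * radial_poisson e \<alpha> r +
     (real CARD('n) - 1 - s) * ((1 - r\<^sup>2) powr \<alpha> * zonal_integral e (s - 1) r)) / r) (at r)"
proof -
  let ?n = "real CARD('n)"
  define D I J I' where "D = 1 - r\<^sup>2" and "I = zonal_integral e s r" 
    and "J = zonal_integral e (s - 1) r" and "I' = zonal_integral e (s + 1) r"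
  have D: "D > 0" using r by (simp add: D_def power_less_one_iff)
  have n: "2 * s - ?n + 1 = 1 + \<alpha>" by (simp add: s_def field_simps)
  have "((\<lambda>r. 1 - r\<^sup>2) has_real_derivative - (2 * r)) (at r)"
    by (auto intro!: derivative_eq_intros)
  from DERIV_chain2[OF has_real_derivative_powr this, of "1 + \<alpha>"] D
  have "((\<lambda>r. (1 - r\<^sup>2) powr (1 + \<alpha>)) has_real_derivative (1 + \<alpha>) * D powr \<alpha> * - (2 * r)) (at r)"
    by (simp add: D_def)
  from DERIV_mult[OF this has_derivative_zonal_integral[OF e r, of s]]
  have *: "(radial_poisson e \<alpha> has_real_derivative
     (1 + \<alpha>) * D powr \<alpha> * - (2 * r) * I + (- s / r * (I - D * I')) * D powr (1 + \<alpha>)) (at r)"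
    by (simp add: radial_poisson_def[abs_def] D_def I_def I'_def s_def)
  have rec: "s * D\<^sup>2 * I' = (1 + \<alpha>) * (1 + r\<^sup>2) * I + (?n - 1 - s) * J"
    using zonal_integral_recurrence[OF e r, of s] unfolding n
    by (simp add: D_def I_def I'_def J_def)
  have p: "D powr (1 + \<alpha>) = D * D powr \<alpha>"
    using D by (simp add: powr_add)
  have "((1 + \<alpha>) * D powr \<alpha> * - (2 * r) * I + (- s / r * (I - D * I')) * D powr (1 + \<alpha>)) * r
    = D powr \<alpha> * (- (2 * r\<^sup>2) * (1 + \<alpha>) * I - s * D * I + s * D\<^sup>2 * I')"
    using r by (simp add: p power2_eq_square field_simps)
  also have "\<dots> = D powr \<alpha> * ((1 + \<alpha> - s) * D * I + (?n - 1 - s) * J)"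
    unfolding rec by (simp add: D_def algebra_simps)
  also have "\<dots> = (1 + \<alpha> - s) * (D powr (1 + \<alpha>) * I) + (?n - 1 - s) * (D powr \<alpha> * J)"
    by (simp add: p algebra_simps)
  finally have "(1 + \<alpha>) * D powr \<alpha> * - (2 * r) * I + (- s / r * (I - D * I')) * D powr (1 + \<alpha>) =
     ((1 + \<alpha> - s) * (D powr (1 + \<alpha>) * I) + (?n - 1 - s) * (D powr \<alpha> * J)) / r"
    using r by (simp only: eq_divide_eq) simp
  with * show ?thesis
    unfolding radial_poisson_def D_def I_def J_def s_def by (simp only:)
qed

text \<open>
  For \<open>\<alpha> = 0\<close> the two integrals satisfy a linear system under which their sum is constant; as
  both are nonnegative, this bounds them up to the boundary.
\<close>

lemma zonal_integral_bounded:
  fixes e :: "real ^ 'n"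
  assumes e: "norm e = 1"
  obtains M where "M \<ge> 0"
    "\<And>r. \<lbrakk>0 < r; r < 1\<rbrakk> \<Longrightarrow> zonal_integral e (real CARD('n) / 2 - 1) r \<le> M"
    "\<And>r. \<lbrakk>0 < r; r < 1\<rbrakk> \<Longrightarrow> (1 - r\<^sup>2) * zonal_integral e (real CARD('n) / 2) r \<le> M"
proof -
  let ?n = "real CARD('n)"
  define f where "f r = zonal_integral e (?n / 2 - 1) r + radial_poisson e 0 r" for r
  have D: "1 - r\<^sup>2 > 0" if "0 < r" "r < 1" for r :: real
    using that by (simp add: power_less_one_iff)
  have rp: "radial_poisson e 0 r = (1 - r\<^sup>2) * zonal_integral e (?n / 2) r" if "0 < r" "r < 1" for r
    using D[OF that] by (simp add: radial_poisson_def)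
  \<comment> \<open>The first summand has derivative \<open>(n / 2 - 1) / r\<close> times the
    difference of the second summand and the first; the second has the negative of this.\<close>
  have "(f has_real_derivative 0) (at r)" if r: "r \<in> {0<..<1}" for r
  proof -
    have r': "0 < r" "r < 1" using r by auto
    show ?thesis
      unfolding f_def[abs_def]
      by (rule DERIV_cong[OF DERIV_add[OF has_derivative_zonal_integral[OF e r']
            has_derivative_radial_poisson[OF e r']]])
        (use D[OF r'] r' in \<open>simp add: rp field_simps\<close>)
  qed
  then have fc: "f r = f (1 / 2)" if "0 < r" "r < 1" for r
    using that by (intro DERIV_isconst3[of 0 1]) auto
  have "zonal_integral e (?n / 2 - 1) r + (1 - r\<^sup>2) * zonal_integral e (?n / 2) r = f (1 / 2)"
    if "0 < r" "r < 1" for r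
    by (subst fc[OF that, symmetric]) (simp only: f_def rp[OF that])
  moreover have "(1 - r\<^sup>2) * zonal_integral e (?n / 2) r \<ge> 0" if "0 < r" "r < 1" for r
    using D[OF that] by (simp add: zonal_integral_nonneg)
  moreover have "f (1 / 2) \<ge> 0"
    by (simp add: f_def zonal_integral_nonneg radial_poisson_nonneg)
  ultimately show ?thesis
    using zonal_integral_nonneg[of e "?n / 2 - 1"]
    by (intro that[of "f (1 / 2)"]) (metis add_increasing2 add_increasing order_refl)+
qed

text \<open>Used to transfer bounds from exponent \<alpha> = 0 to general \<alpha>, with
  \<open>x\<close> a squared distance. For \<alpha> \<ge> 0 it rests on
  \<open>1 - r \<le> sqrt x\<close>, that is, on the distance to the sphere; for \<alpha> < 0 only
  on \<open>x \<le> 4\<close>, and the weight \<open>(1 - r) powr \<alpha>\<close> remains.\<close>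

lemma poisson_weight_le:
  fixes r x :: real
  assumes r: "0 \<le> r" "r < 1" and x: "(1 - r)\<^sup>2 \<le> x" "x \<le> 4"
  shows "(1 - r\<^sup>2) powr \<alpha> * x powr (- (\<alpha> / 2)) \<le>
    2 powr \<bar>\<alpha>\<bar> * (if \<alpha> \<ge> 0 then 1 else (1 - r) powr \<alpha>)"
proof -
  have x0: "x > 0" using x r by (smt (verit) zero_less_power2)
  have D: "1 - r\<^sup>2 = (1 - r) * (1 + r)" by (simp add: power2_eq_square algebra_simps)
  show ?thesis
  proof (cases "\<alpha> \<ge> 0")
    case True
    have sx: "1 - r \<le> sqrt x" using x r by (simp add: real_le_rsqrt)
    have "1 - r\<^sup>2 \<le> sqrt x * 2"
      unfolding D using r sx x0 by (intro mult_mono) auto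
    then have "(1 - r\<^sup>2) powr \<alpha> \<le> (sqrt x * 2) powr \<alpha>"
      using True r by (intro powr_mono2) (auto simp: power_le_one)
    also have "\<dots> = x powr (\<alpha> / 2) * 2 powr \<alpha>"
      using x0 by (simp add: powr_mult powr_half_sqrt[symmetric] powr_powr less_imp_le)
    finally have "(1 - r\<^sup>2) powr \<alpha> * x powr (- (\<alpha> / 2)) \<le>
        x powr (\<alpha> / 2) * 2 powr \<alpha> * x powr (- (\<alpha> / 2))"
      by (rule mult_right_mono) simp
    also have "\<dots> = 2 powr \<alpha>"
      using x0 by (simp add: powr_minus field_simps)
    finally show ?thesis using True by simp
  next
    case False
    have "(1 - r\<^sup>2) powr \<alpha> \<le> (1 - r) powr \<alpha>"
      unfolding D using r False by (intro powr_mono2') auto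
    moreover have "x powr (- (\<alpha> / 2)) \<le> 4 powr (- (\<alpha> / 2))"
      using x x0 False by (intro powr_mono2) auto
    moreover have "(4 :: real) powr (- (\<alpha> / 2)) = 2 powr \<bar>\<alpha>\<bar>"
      using False powr_powr[of 2 2 "- (\<alpha> / 2)"] by simp
    ultimately show ?thesis
      using False mult_mono[of "(1 - r\<^sup>2) powr \<alpha>" "(1 - r) powr \<alpha>" "x powr (- (\<alpha> / 2))" "2 powr \<bar>\<alpha>\<bar>"]
      by (simp add: mult.commute)
  qed
qed

text \<open>Controls the second term in the derivative of \<open>radial_poisson\<close>. Splitting
  \<open>x powr (- (\<alpha> / 2))\<close> off the integrand leaves the exponent
  \<open>n / 2 - 1\<close> of the case \<alpha> = 0, whose integral is bounded.\<close>

lemma weighted_zonal_integral_bound: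
  fixes e :: "real ^ 'n"
  assumes e: "norm e = 1"
  obtains M where "M \<ge> 0"
    "\<And>r. \<lbrakk>0 < r; r < 1\<rbrakk> \<Longrightarrow>
      (1 - r\<^sup>2) powr \<alpha> * zonal_integral e ((real CARD('n) + \<alpha>) / 2 - 1) r \<le>
      M * (if \<alpha> \<ge> 0 then 1 else (1 - r) powr \<alpha>)"
proof -
  let ?n = "real CARD('n)"
  obtain M where M: "M \<ge> 0" "\<And>r. \<lbrakk>0 < r; r < 1\<rbrakk> \<Longrightarrow> zonal_integral e (?n / 2 - 1) r \<le> M"
    by (rule zonal_integral_bounded[OF e]) blast
  show ?thesis
  proof (rule that[of "2 powr \<bar>\<alpha>\<bar> * M"])
    fix r :: real assume r: "0 < r" "r < 1"
    define w where "w = (if \<alpha> \<ge> 0 then 1 else (1 - r) powr \<alpha>)"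
    have "(1 - r\<^sup>2) powr \<alpha> * zonal_integral e ((?n + \<alpha>) / 2 - 1) r \<le>
      2 powr \<bar>\<alpha>\<bar> * w * zonal_integral e (?n / 2 - 1) r"
    proof (rule zonal_integral_mono_factor[OF e _ r(2)])
      fix x :: real assume x: "(1 - r)\<^sup>2 \<le> x" "x \<le> 4" "0 < x"
      have "- ((?n + \<alpha>) / 2 - 1) = - (\<alpha> / 2) + - (?n / 2 - 1)"
        by (simp add: field_simps)
      then have "x powr (- ((?n + \<alpha>) / 2 - 1)) = x powr (- (\<alpha> / 2)) * x powr (- (?n / 2 - 1))"
        by (simp only: powr_add)
      then show "(1 - r\<^sup>2) powr \<alpha> * x powr (- ((?n + \<alpha>) / 2 - 1)) \<le>
          2 powr \<bar>\<alpha>\<bar> * w * x powr (- (?n / 2 - 1))"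
        using mult_right_mono[OF poisson_weight_le[OF _ r(2) x(1,2), of \<alpha>], of "x powr (- (?n / 2 - 1))"] r
        by (simp add: w_def mult.assoc)
    qed (use r in auto)
    also have "\<dots> \<le> 2 powr \<bar>\<alpha>\<bar> * w * M"
      using M(2)[OF r] by (intro mult_left_mono) (auto simp: w_def)
    finally show "(1 - r\<^sup>2) powr \<alpha> * zonal_integral e ((?n + \<alpha>) / 2 - 1) r \<le> 2 powr \<bar>\<alpha>\<bar> * M * w"
      by (simp add: mult_ac)
  qed (use M in auto)
qed

section \<open>Bounds and modulus of continuity of the radial profile\<close>

lemma has_derivative_powr_one_minus:
  assumes "x < (1 :: real)"
  shows "((\<lambda>x. (1 - x) powr p) has_real_derivative - (p * (1 - x) powr (p - 1))) (at x)"
proof -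
  have "((\<lambda>x. 1 - x) has_real_derivative - 1) (at x)"
    by (auto intro!: derivative_eq_intros)
  from DERIV_chain2[OF has_real_derivative_powr[of "1 - x" p] this] assms show ?thesis
    by simp
qed

text \<open>For \<alpha> \<ge> 0 the comparison with \<alpha> = 0 suffices. For \<alpha> < 0 it
  would lose the unbounded factor \<open>(1 - r) powr \<alpha>\<close>. Instead the derivative is
  bounded from above: the term with the profile itself has a nonpositive coefficient and is dropped,
  which avoids circularity, and the rest is at most a constant times
  \<open>(1 - r) powr \<alpha>\<close>, integrable up to 1.\<close>

lemma radial_poisson_bounded:
  fixes e :: "real ^ 'n"
  assumes e: "norm e = 1" and n: "CARD('n) \<ge> 2" and \<alpha>: "\<alpha> > -1"
  obtains M where "M \<ge> 0" "\<And>r. \<lbrakk>0 \<le> r; r < 1\<rbrakk> \<Longrightarrow> radial_poisson e \<alpha> r \<le> M"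
proof -
  let ?n = "real CARD('n)"
  define s where "s = (?n + \<alpha>) / 2"
  \<comment> \<open>For \<open>r \<le> 1 / 2\<close> all squared distances lie between
    \<open>1 / 4\<close> and 4.\<close>
  define c where "c = (1 / 4 :: real) powr (- s) + 4 powr (- s)"
  have c: "c \<ge> 0" by (simp add: c_def)
  have small: "radial_poisson e \<alpha> r \<le> c" if r: "0 \<le> r" "r \<le> 1 / 2" for r
  proof -
    have "(1 - r\<^sup>2) powr (1 + \<alpha>) * zonal_integral e s r \<le> c * zonal_integral e 0 r"
    proof (rule zonal_integral_mono_factor[OF e])
      fix x :: real assume x: "(1 - r)\<^sup>2 \<le> x" "x \<le> 4" "0 < x"
      have "(1 / 2)\<^sup>2 \<le> (1 - r)\<^sup>2" using r by (intro power_mono) auto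
      then have "1 / 4 \<le> x" using x by (simp add: power2_eq_square)
      then have "x powr (- s) \<le> c" unfolding c_def using x by (intro powr_le_add_endpoints) auto
      moreover have "(1 - r\<^sup>2) powr (1 + \<alpha>) \<le> 1"
        using r \<alpha> by (intro powr_le1) (auto simp: power_le_one)
      ultimately have "(1 - r\<^sup>2) powr (1 + \<alpha>) * x powr (- s) \<le> 1 * c"
        by (intro mult_mono) auto
      then show "(1 - r\<^sup>2) powr (1 + \<alpha>) * x powr (- s) \<le> c * x powr (- 0)"
        using x by simp
    qed (use r in auto)
    also have "\<dots> \<le> c * 1"
      by (rule mult_left_mono[OF zonal_integral_0 c])
    finally show ?thesis by (simp add: radial_poisson_def s_def)
  qed
  show ?thesis
  proof (cases "\<alpha> \<ge> 0")
    case True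
    obtain M where M: "M \<ge> 0" "\<And>r. \<lbrakk>0 < r; r < 1\<rbrakk> \<Longrightarrow> (1 - r\<^sup>2) * zonal_integral e (?n / 2) r \<le> M"
      by (rule zonal_integral_bounded[OF e]) blast
    show ?thesis
    proof (rule that[of "c + 2 powr \<alpha> * M"])
      fix r :: real assume r: "0 \<le> r" "r < 1"
      show "radial_poisson e \<alpha> r \<le> c + 2 powr \<alpha> * M"
      proof (cases "r \<le> 1 / 2")
        case True
        then show ?thesis using small[OF r(1)] M by (simp add: add_increasing2)
      next
        case False
        have D: "1 - r\<^sup>2 > 0" using r by (simp add: power_less_one_iff)
        have "(1 - r\<^sup>2) powr (1 + \<alpha>) * zonal_integral e s r \<le>
           (2 powr \<alpha> * (1 - r\<^sup>2)) * zonal_integral e (?n / 2) r"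
        proof (rule zonal_integral_mono_factor[OF e r])
          fix x :: real assume x: "(1 - r)\<^sup>2 \<le> x" "x \<le> 4" "0 < x"
          have "- s = - (\<alpha> / 2) + - (?n / 2)"
            by (simp add: s_def field_simps)
          then have "x powr (- s) = x powr (- (\<alpha> / 2)) * x powr (- (?n / 2))"
            by (simp only: powr_add)
          then have "(1 - r\<^sup>2) powr (1 + \<alpha>) * x powr (- s) =
             ((1 - r\<^sup>2) powr \<alpha> * x powr (- (\<alpha> / 2))) * ((1 - r\<^sup>2) * x powr (- (?n / 2)))"
            using D by (simp add: powr_add)
          also have "\<dots> \<le> 2 powr \<alpha> * ((1 - r\<^sup>2) * x powr (- (?n / 2)))"
            using poisson_weight_le[OF r x(1,2), of \<alpha>] True D by (intro mult_right_mono) auto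
          finally show "(1 - r\<^sup>2) powr (1 + \<alpha>) * x powr (- s) \<le> 
              2 powr \<alpha> * (1 - r\<^sup>2) * x powr (- (?n / 2))" by (simp add: mult_ac)
        qed
        also have "\<dots> \<le> 2 powr \<alpha> * M"
          using M(2)[of r] False r by (simp add: mult.assoc)
        finally show ?thesis using c by (simp add: radial_poisson_def s_def)
      qed
    qed (use c M in auto)
  next
    case False
    obtain M where M: "M \<ge> 0" "\<And>r. \<lbrakk>0 < r; r < 1\<rbrakk> \<Longrightarrow>
      (1 - r\<^sup>2) powr \<alpha> * zonal_integral e (s - 1) r \<le> M * (if \<alpha> \<ge> 0 then 1 else (1 - r) powr \<alpha>)"
      by (rule weighted_zonal_integral_bound[OF e, of \<alpha>, folded s_def]) blast
    define K where "K = 2 * ((?n - 1 - s) * M)"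
    define w' where "w' r = ((1 + \<alpha> - s) * radial_poisson e \<alpha> r +
       (?n - 1 - s) * ((1 - r\<^sup>2) powr \<alpha> * zonal_integral e (s - 1) r)) / r" for r
    \<comment> \<open>The values are \<open>(2 + \<alpha> - n) / 2\<close> and its negative;
      \<open>n \<ge> 2\<close> and \<alpha> < 0 fix the signs.\<close>
    have coeff: "1 + \<alpha> - s \<le> 0" "?n - 1 - s \<ge> 0"
      using n False by (auto simp: s_def field_simps)
    have K: "K \<ge> 0" using coeff M by (simp add: K_def)
    have w': "w' r \<le> K * (1 - r) powr \<alpha>" if r: "1 / 2 \<le> r" "r < 1" for r
    proof -
      have 1: "(1 + \<alpha> - s) * radial_poisson e \<alpha> r \<le> 0"
        using coeff radial_poisson_nonneg by (intro mult_nonpos_nonneg) auto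
      have 2: "(?n - 1 - s) * ((1 - r\<^sup>2) powr \<alpha> * zonal_integral e (s - 1) r) \<le>
          (?n - 1 - s) * (M * (1 - r) powr \<alpha>)"
        using M(2)[of r] r False coeff by (intro mult_left_mono) auto
      have "w' r \<le> ((?n - 1 - s) * (M * (1 - r) powr \<alpha>)) / r"
        unfolding w'_def using r 1 2 by (intro divide_right_mono) auto
      also have "\<dots> \<le> ((?n - 1 - s) * (M * (1 - r) powr \<alpha>)) / (1 / 2)"
        using r coeff M by (intro divide_left_mono) auto
      finally show ?thesis by (simp add: K_def algebra_simps)
    qed
    show ?thesis
    proof (rule that[of "c + K / (1 + \<alpha>)"])
      fix r :: real assume r: "0 \<le> r" "r < 1"
      show "radial_poisson e \<alpha> r \<le> c + K / (1 + \<alpha>)"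
      proof (cases "r \<le> 1 / 2")
        case True
        then show ?thesis using small[OF r(1)] K \<alpha> by (simp add: add_increasing2)
      next
        case F: False
        \<comment> \<open>An antiderivative of \<open>K * (1 - x) powr \<alpha>\<close> minus the
          profile, hence nondecreasing; being monotone takes the place of integrating the
          bound.\<close>
        define \<Phi> where "\<Phi> x = - (K / (1 + \<alpha>)) * (1 - x) powr (1 + \<alpha>) - radial_poisson e \<alpha> x" for x
        have "\<Phi> (1 / 2) \<le> \<Phi> r"
        proof (rule DERIV_nonneg_imp_nondecreasing[of "1 / 2" r \<Phi>])
          show "1 / 2 \<le> r" using F by simp
          fix x assume x: "1 / 2 \<le> x" "x \<le> r"
          from DERIV_diff[OF DERIV_cmult[OF has_derivative_powr_one_minus[of x "1 + \<alpha>"], of "- (K / (1 + \<alpha>))"]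
              has_derivative_radial_poisson[OF e, of x \<alpha>]] x r \<alpha>
          have "(\<Phi> has_real_derivative K * (1 - x) powr \<alpha> - w' x) (at x)"
            by (simp add: \<Phi>_def[abs_def] w'_def s_def)
          then show "\<exists>y. (\<Phi> has_real_derivative y) (at x) \<and> 0 \<le> y"
            using w'[of x] x r by fastforce
        qed
        then have "radial_poisson e \<alpha> r \<le> radial_poisson e \<alpha> (1 / 2) + 
            (K / (1 + \<alpha>)) * (1 / 2) powr (1 + \<alpha>) - (K / (1 + \<alpha>)) * (1 - r) powr (1 + \<alpha>)"
          by (simp add: \<Phi>_def)
        also have "\<dots> \<le> c + (K / (1 + \<alpha>)) * 1 - 0"
          using K \<alpha> small[of "1 / 2"] by (intro diff_mono add_mono mult_left_mono powr_le1) auto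
        finally show ?thesis by simp
      qed
    qed (use c K \<alpha> in auto)
  qed
qed

text \<open>Subadditivity of the power: split \<open>a = (a - b) + b\<close> in
  \<open>a * a powr (p - 1)\<close> and use that \<open>t powr (p - 1)\<close> is
  non-increasing.\<close>

lemma powr_diff_le_powr:
  fixes a b p :: real
  assumes "0 \<le> b" "b \<le> a" "0 < p" "p \<le> 1"
  shows "a powr p - b powr p \<le> (a - b) powr p"
proof (cases "b = 0 \<or> a = b")
  case False
  then have ab: "0 < b" "b < a" using assms by auto
  have "a powr p = (a - b) * a powr (p - 1) + b * a powr (p - 1)"
    using ab powr_add[of a 1 "p - 1"] by (simp add: algebra_simps)
  also have "\<dots> \<le> (a - b) * (a - b) powr (p - 1) + b * b powr (p - 1)"
    using ab assms by (intro add_mono mult_left_mono powr_mono2') auto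
  also have "\<dots> = (a - b) powr p + b powr p"
    using ab powr_add[of "a - b" 1 "p - 1"] powr_add[of b 1 "p - 1"] by simp
  finally show ?thesis by simp
qed (use assms in auto)

text \<open>Integrates the derivative bound \<open>K * w\<close>. The radii start at
  \<open>1 / 2\<close> because of the division by \<open>r\<close> in the derivative. In the
  constant, the summand 1 serves \<alpha> \<ge> 0 and \<open>1 / (1 + \<alpha>)\<close> serves
  \<alpha> < 0.\<close>

lemma radial_poisson_Hoelder:
  fixes e :: "real ^ 'n"
  assumes e: "norm e = 1" and n: "CARD('n) \<ge> 2" and \<alpha>: "\<alpha> > -1"
  obtains M where "M \<ge> 0" "\<And>r r'. \<lbrakk>1 / 2 \<le> r; r \<le> r'; r' < 1\<rbrakk> \<Longrightarrow>
    \<bar>radial_poisson e \<alpha> r' - radial_poisson e \<alpha> r\<bar> \<le> M * ((r' - r) + (r' - r) powr (1 + \<alpha>))"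
proof -
  let ?n = "real CARD('n)"
  define s where "s = (?n + \<alpha>) / 2"
  define w where "w r = (if \<alpha> \<ge> 0 then 1 else (1 - r) powr \<alpha>)" for r
  obtain M1 where M1: "M1 \<ge> 0" "\<And>r. \<lbrakk>0 < r; r < 1\<rbrakk> \<Longrightarrow>
    (1 - r\<^sup>2) powr \<alpha> * zonal_integral e (s - 1) r \<le> M1 * w r"
    by (rule weighted_zonal_integral_bound[OF e, of \<alpha>, folded s_def w_def]) blast
  obtain M2 where M2: "M2 \<ge> 0" "\<And>r. \<lbrakk>0 \<le> r; r < 1\<rbrakk> \<Longrightarrow> radial_poisson e \<alpha> r \<le> M2"
    by (rule radial_poisson_bounded[OF e n \<alpha>]) blast
  define K where "K = 2 * (\<bar>1 + \<alpha> - s\<bar> * M2 + \<bar>?n - 1 - s\<bar> * M1)"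
  have K: "K \<ge> 0" using M1 M2 by (simp add: K_def)
  define w' where "w' r = ((1 + \<alpha> - s) * radial_poisson e \<alpha> r +
     (?n - 1 - s) * ((1 - r\<^sup>2) powr \<alpha> * zonal_integral e (s - 1) r)) / r" for r
  have d: "(radial_poisson e \<alpha> has_real_derivative w' r) (at r)" if "1 / 2 \<le> r" "r < 1" for r
    using has_derivative_radial_poisson[OF e, of r \<alpha>] that by (simp add: w'_def s_def)
  have w': "\<bar>w' r\<bar> \<le> K * w r" if r: "1 / 2 \<le> r" "r < 1" for r
  proof -
    \<comment> \<open>Lets the bounded part of the derivative be absorbed into the same
      weight.\<close>
    have w1: "1 \<le> w r"
      using r powr_mono2'[of "- \<alpha>" "1 - r" 1] powr_mono2'[of \<alpha> "1 - r" 1] by (auto simp: w_def)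
    have "\<bar>(1 + \<alpha> - s) * radial_poisson e \<alpha> r\<bar> \<le> \<bar>1 + \<alpha> - s\<bar> * (M2 * w r)"
      unfolding abs_mult using M2(2)[of r] M2(1) w1 r radial_poisson_nonneg[of e \<alpha> r]
      by (intro mult_left_mono) (auto intro: order_trans mult_left_mono[of 1 "w r" M2, simplified])
    moreover have "\<bar>(?n - 1 - s) * ((1 - r\<^sup>2) powr \<alpha> * zonal_integral e (s - 1) r)\<bar> \<le>
        \<bar>?n - 1 - s\<bar> * (M1 * w r)"
      unfolding abs_mult[of "?n - 1 - s"] using M1(2)[of r] r zonal_integral_nonneg[of e "s - 1" r]
      by (intro mult_left_mono) auto
    ultimately have "\<bar>w' r\<bar> \<le> (\<bar>1 + \<alpha> - s\<bar> * (M2 * w r) + \<bar>?n - 1 - s\<bar> * (M1 * w r)) / r"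
      unfolding w'_def abs_divide using r by (intro frac_le) (auto intro: order_trans[OF abs_triangle_ineq])
    also have "\<dots> \<le> (\<bar>1 + \<alpha> - s\<bar> * (M2 * w r) + \<bar>?n - 1 - s\<bar> * (M1 * w r)) / (1 / 2)"
      using r w1 M1 M2 by (intro divide_left_mono) auto
    also have "\<dots> = K * w r" by (simp add: K_def algebra_simps)
    finally show ?thesis .
  qed
  define \<phi> where "\<phi> x = (if \<alpha> \<ge> 0 then x else - (1 / (1 + \<alpha>)) * (1 - x) powr (1 + \<alpha>))" for x
  have d\<phi>: "(\<phi> has_real_derivative w x) (at x)" if x: "x < 1" for x
  proof (cases "\<alpha> \<ge> 0")
    case True
    then show ?thesis by (auto simp: \<phi>_def[abs_def] w_def)
  next
    case False
    from DERIV_cmult[OF has_derivative_powr_one_minus[OF x, of "1 + \<alpha>"], of "- (1 / (1 + \<alpha>))"] \<alpha> show ?thesis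
      using False by (simp add: \<phi>_def[abs_def] w_def)
  qed
  show ?thesis
  proof (rule that[of "K * (1 + 1 / (1 + \<alpha>))"])
    fix r r' :: real assume r: "1 / 2 \<le> r" "r \<le> r'" "r' < 1"
    \<comment> \<open>As \<phi> is an antiderivative of \<open>w\<close>, the cases
      \<open>c = 1\<close> and \<open>c = - 1\<close> together give the two-sided bound by
      \<open>K * (\<phi> r' - \<phi> r)\<close>.\<close>
    have mono: "K * \<phi> r + c * radial_poisson e \<alpha> r \<le> K * \<phi> r' + c * radial_poisson e \<alpha> r'"
      if c: "\<bar>c\<bar> \<le> 1" for c
    proof (rule DERIV_nonneg_imp_nondecreasing[OF r(2),
          of "\<lambda>x. K * \<phi> x + c * radial_poisson e \<alpha> x"])
      fix x assume x: "r \<le> x" "x \<le> r'"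
      have "\<bar>c * w' x\<bar> \<le> 1 * \<bar>w' x\<bar>"
        unfolding abs_mult using c by (intro mult_right_mono) auto
      then have "0 \<le> K * w x + c * w' x"
        using w'[of x] x r by (simp add: abs_le_iff) linarith
      then show "\<exists>y. ((\<lambda>x. K * \<phi> x + c * radial_poisson e \<alpha> x) has_real_derivative y) (at x) \<and> 0 \<le> y"
        using DERIV_add[OF DERIV_cmult[OF d\<phi>] DERIV_cmult[OF d]] x r by (meson order_trans le_less_trans)
    qed
    have "\<bar>radial_poisson e \<alpha> r' - radial_poisson e \<alpha> r\<bar> \<le> K * (\<phi> r' - \<phi> r)"
      using mono[of 1] mono[of "- 1"] by (simp add: abs_le_iff algebra_simps)
    also have "\<phi> r' - \<phi> r \<le> (1 + 1 / (1 + \<alpha>)) * ((r' - r) + (r' - r) powr (1 + \<alpha>))"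
    proof (cases "\<alpha> \<ge> 0")
      case True
      have "r' - r \<le> 1 * ((r' - r) + (r' - r) powr (1 + \<alpha>))" by simp
      also have "\<dots> \<le> (1 + 1 / (1 + \<alpha>)) * ((r' - r) + (r' - r) powr (1 + \<alpha>))"
        using r \<alpha> by (intro mult_right_mono) (auto intro: add_nonneg_nonneg)
      finally show ?thesis using True by (simp add: \<phi>_def)
    next
      case False
      have "\<phi> r' - \<phi> r = (1 / (1 + \<alpha>)) * ((1 - r) powr (1 + \<alpha>) - (1 - r') powr (1 + \<alpha>))"
        using False by (simp add: \<phi>_def algebra_simps)
      also have "\<dots> \<le> (1 / (1 + \<alpha>)) * (r' - r) powr (1 + \<alpha>)"
        using False \<alpha> r powr_diff_le_powr[of "1 - r'" "1 - r" "1 + \<alpha>"]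
        by (intro mult_left_mono) auto
      also have "\<dots> \<le> (1 + 1 / (1 + \<alpha>)) * ((r' - r) + (r' - r) powr (1 + \<alpha>))"
        using r \<alpha> by (intro mult_mono) auto
      finally show ?thesis .
    qed
    finally show "\<bar>radial_poisson e \<alpha> r' - radial_poisson e \<alpha> r\<bar> \<le>
        K * (1 + 1 / (1 + \<alpha>)) * ((r' - r) + (r' - r) powr (1 + \<alpha>))"
      using K by (simp add: mult_left_mono mult.assoc)
  qed (use K \<alpha> in auto)
qed

section \<open>Majorants and the Poisson kernel\<close>

lemma majorantD:
  assumes "majorant \<omega>"
  shows "continuous_on {0..} \<omega>" "\<omega> 0 = 0"
    "\<And>t. t > 0 \<Longrightarrow> \<omega> t > 0" "\<And>t. t \<ge> 0 \<Longrightarrow> \<omega> t \<ge> 0"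
    "\<And>s t. \<lbrakk>0 \<le> s; s \<le> t\<rbrakk> \<Longrightarrow> \<omega> s \<le> \<omega> t"
    "\<And>s t. \<lbrakk>0 < s; s \<le> t\<rbrakk> \<Longrightarrow> s / t * \<omega> t \<le> \<omega> s"
proof -
  show *: "continuous_on {0..} \<omega>" "\<omega> 0 = 0" "\<And>t. t > 0 \<Longrightarrow> \<omega> t > 0"
    using assms by (auto simp: majorant_def)
  show "\<omega> t \<ge> 0" if "t \<ge> 0" for t
    using *(2) *(3)[of t] that by (cases "t = 0") auto
  show "\<omega> s \<le> \<omega> t" if "0 \<le> s" "s \<le> t" for s t
    using assms that by (auto simp: majorant_def monotone_on_def)
  show "s / t * \<omega> t \<le> \<omega> s" if "0 < s" "s \<le> t" for s t
  proof -
    have "\<omega> t / t \<le> \<omega> s / s"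
      using assms that by (auto simp: majorant_def monotone_on_def)
    then show ?thesis using that by (simp add: field_simps)
  qed
qed

lemma majorant_mult_le:
  assumes "majorant \<omega>" "t \<ge> 0" "k \<ge> 1"
  shows "\<omega> (k * t) \<le> k * \<omega> t"
proof (cases "t = 0")
  case False
  then show ?thesis
    using majorantD(6)[OF assms(1), of t "k * t"] assms by (simp add: field_simps)
qed (simp add: majorantD(2)[OF assms(1)])

text \<open>A majorant is subadditive: the fractions \<open>a / b\<close> and
  \<open>(b - a) / b\<close> of \<open>\<omega> b\<close> are at most \<open>\<omega> a\<close> and
  \<open>\<omega> (b - a)\<close>. This makes every \<open>test_fun\<close> Lipschitz with constant
  1 with respect to \<omega>.\<close>

lemma majorant_diff_le:
  assumes "majorant \<omega>" "s \<ge> 0" "t \<ge> 0"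
  shows "\<bar>\<omega> s - \<omega> t\<bar> \<le> \<omega> \<bar>s - t\<bar>"
proof -
  note m = majorantD[OF assms(1)]
  have *: "\<omega> b - \<omega> a \<le> \<omega> (b - a)" if "0 \<le> a" "a \<le> b" for a b
  proof (cases "a = 0 \<or> a = b")
    case False
    then have ab: "0 < a" "a < b" using that by auto
    have "\<omega> b = a / b * \<omega> b + (b - a) / b * \<omega> b"
      using ab by (simp add: field_simps)
    also have "\<dots> \<le> \<omega> a + \<omega> (b - a)"
      using m(6)[of a b] m(6)[of "b - a" b] ab by (intro add_mono) auto
    finally show ?thesis by simp
  qed (use m(2) in auto)
  show ?thesis
    using *[of s t] *[of t s] m(5)[of s t] m(5)[of t s] assms by (cases "s \<le> t") auto
qed

section \<open>Positivity and relative variation of the kernel\<close>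

lemma poisson_const_pos:
  assumes "n \<ge> 1" "\<alpha> > -1"
  shows "poisson_const n \<alpha> > 0"
  unfolding poisson_const_def using assms
  by (intro divide_pos_pos mult_pos_pos Gamma_real_pos) auto

lemma abs_integral_le:
  fixes f g :: "'a \<Rightarrow> real"
  assumes "integrable M f" "integrable M g" "\<And>x. x \<in> space M \<Longrightarrow> \<bar>f x\<bar> \<le> g x"
  shows "\<bar>\<integral>x. f x \<partial>M\<bar> \<le> (\<integral>x. g x \<partial>M)"
proof -
  have "\<bar>\<integral>x. f x \<partial>M\<bar> \<le> (\<integral>x. \<bar>f x\<bar> \<partial>M)"
    by (rule integral_abs_bound)
  also have "\<dots> \<le> (\<integral>x. g x \<partial>M)"
    using assms by (intro integral_mono) auto
  finally show ?thesis .
qed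

text \<open>The mean value estimate on the interval from \<open>1 / 2\<close> to
  \<open>3 / 2\<close>; it turns relative changes of the factors of the kernel into relative changes
  of their powers.\<close>

lemma powr_Lipschitz_near_1:
  fixes p :: real
  shows "\<exists>c\<ge>0. \<forall>x. \<bar>x - 1\<bar> \<le> 1 / 2 \<longrightarrow> \<bar>x powr p - 1\<bar> \<le> c * \<bar>x - 1\<bar>"
proof -
  define c where "c = \<bar>p\<bar> * ((1 / 2) powr (p - 1) + (3 / 2) powr (p - 1))"
  have "\<bar>x powr p - 1\<bar> \<le> c * \<bar>x - 1\<bar>" if x: "\<bar>x - 1\<bar> \<le> 1 / 2" for x
  proof -
    have "1 / 2 \<le> x" "x \<le> 3 / 2" using x by linarith+
    then have I: "x \<in> {1 / 2..3 / 2}" by simp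
    have d: "((\<lambda>z. z powr p) has_real_derivative p * z powr (p - 1)) (at z within {1 / 2..3 / 2})"
      if "z \<in> {1 / 2..3 / 2}" for z
      by (rule has_field_derivative_at_within[OF has_real_derivative_powr]) (use that in simp)
    have b: "norm (p * z powr (p - 1)) \<le> c" if "z \<in> {1 / 2..3 / 2}" for z
    proof -
      have "z powr (p - 1) \<le> (1 / 2) powr (p - 1) + (3 / 2) powr (p - 1)"
        using that by (intro powr_le_add_endpoints) simp_all
      from mult_left_mono[OF this abs_ge_zero[of p]] show ?thesis
        unfolding c_def by (simp only: real_norm_def abs_mult abs_of_nonneg[OF powr_ge_zero])
    qed
    have "norm (x powr p - 1 powr p) \<le> c * norm (x - 1)"
      by (rule field_differentiable_bound[of "{1 / 2..3 / 2}" "\<lambda>z. z powr p", OF _ d b I]) simp_all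
    then show ?thesis by simp
  qed
  moreover have "c \<ge> 0" by (simp add: c_def)
  ultimately show ?thesis by blast
qed

lemma continuous_on_test_fun:
  assumes "majorant \<omega>"
  shows "continuous_on S (test_fun \<omega> a)"
  unfolding test_fun_def
  by (rule continuous_on_compose2[OF majorantD(1)[OF assms], of S "\<lambda>\<xi>. norm (\<xi> - a)"])
    (auto intro!: continuous_intros)

context
  fixes \<alpha> :: real
  assumes \<alpha>: "\<alpha> > -1"
begin

lemma poisson_const_CARD_pos: "poisson_const CARD('n::finite) \<alpha> > 0"
  using zero_less_card_finite[where 'a = 'n] \<alpha> by (intro poisson_const_pos) auto

lemma poisson_kernel_nonneg: "poisson_kernel \<alpha> x \<zeta> \<ge> 0" for x \<zeta> :: "real ^ 'n"
  unfolding poisson_kernel_def using poisson_const_CARD_pos[where 'n = 'n] by simp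

lemma continuous_on_poisson_kernel:
  fixes x :: "real ^ 'n"
  assumes "norm x < 1"
  shows "continuous_on (sphere 0 1) (poisson_kernel \<alpha> x)"
  unfolding poisson_kernel_def
  using assms by (intro continuous_intros ballI) auto

lemma integrable_poisson_kernel_mult:
  fixes x :: "real ^ 'n"
  assumes "norm x < 1" "continuous_on (sphere 0 1) f"
  shows "integrable sphere_measure (\<lambda>\<zeta>. poisson_kernel \<alpha> x \<zeta> * f \<zeta>)"
  using assms
  by (intro integrable_sphere_measure_continuous continuous_intros continuous_on_poisson_kernel)

text \<open>An orthogonal map carries \<open>norm x *\<^sub>R e\<close> to \<open>x\<close>, and the
  surface measure is invariant under it.\<close>

lemma poisson_transform_1:
  fixes e x :: "real ^ 'n"
  assumes e: "norm e = 1" and x: "norm x < 1"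
  shows "poisson_transform \<alpha> (\<lambda>_. 1) x =
           poisson_const CARD('n) \<alpha> * radial_poisson e \<alpha> (norm x)"
proof -
  define r where "r = norm x"
  have [measurable]: "poisson_kernel \<alpha> x \<in> borel_measurable borel"
    unfolding poisson_kernel_def by measurable
  obtain T where T: "orthogonal_transformation T" "T (r *\<^sub>R e) = x"
    by (rule orthogonal_transformation_exists[of "r *\<^sub>R e" x]) (use e in \<open>auto simp: r_def\<close>)
  have "poisson_transform \<alpha> (\<lambda>_. 1) x = (\<integral>\<zeta>. poisson_kernel \<alpha> x (T \<zeta>) \<partial>sphere_measure)"
    unfolding poisson_transform_def
    by (subst integral_sphere_measure_orthogonal[OF _ T(1)]) simp_all
  also have "\<dots> = (\<integral>\<zeta>. poisson_const CARD('n) \<alpha> * ((1 - r\<^sup>2) powr (1 + \<alpha>) *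
      (1 + r\<^sup>2 - 2 * r * (e \<bullet> \<zeta>)) powr (- ((real CARD('n) + \<alpha>) / 2))) \<partial>sphere_measure)"
  proof (rule Bochner_Integration.integral_cong[OF refl])
    fix \<zeta> :: "real ^ 'n" assume "\<zeta> \<in> space sphere_measure"
    then have \<zeta>: "norm \<zeta> = 1" by (simp add: space_sphere_measure)
    have "norm (x - T \<zeta>) = norm (T (r *\<^sub>R e - \<zeta>))"
      using T(2) linear_diff[OF orthogonal_transformation_linear[OF T(1)]] by simp
    also have "\<dots> = norm (r *\<^sub>R e - \<zeta>)"
      using T(1) by (simp add: orthogonal_transformation)
    finally have "norm (x - T \<zeta>) = norm (r *\<^sub>R e - \<zeta>)" .
    moreover have "e \<bullet> e = 1" "\<zeta> \<bullet> \<zeta> = 1"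
      using e \<zeta> by (simp_all add: dot_square_norm)
    then have "(norm (r *\<^sub>R e - \<zeta>))\<^sup>2 = 1 + r\<^sup>2 - 2 * r * (e \<bullet> \<zeta>)"
      unfolding power2_norm_eq_inner
      by (simp add: inner_diff_left inner_diff_right inner_commute power2_eq_square)
    ultimately have n: "norm (x - T \<zeta>) = sqrt (1 + r\<^sup>2 - 2 * r * (e \<bullet> \<zeta>))"
      by (metis norm_ge_zero real_sqrt_unique)
    have pos: "0 < 1 + r\<^sup>2 - 2 * r * (e \<bullet> \<zeta>)"
      using zonal_bounds(3)[OF _ _ inner_sphere_Icc[OF e \<zeta>], of r] x by (simp add: r_def)
    show "poisson_kernel \<alpha> x (T \<zeta>) = poisson_const CARD('n) \<alpha> * ((1 - r\<^sup>2) powr (1 + \<alpha>) *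
      (1 + r\<^sup>2 - 2 * r * (e \<bullet> \<zeta>)) powr (- ((real CARD('n) + \<alpha>) / 2)))"
      unfolding poisson_kernel_def n r_def[symmetric] using pos
      by (simp add: powr_half_sqrt[symmetric] powr_powr powr_minus_divide less_imp_le)
  qed
  also have "\<dots> = poisson_const CARD('n) \<alpha> * radial_poisson e \<alpha> (norm x)"
    by (simp add: radial_poisson_def zonal_integral_def r_def)
  finally show ?thesis .
qed

text \<open>Passing from \<open>x\<close> to \<open>y\<close> changes
  \<open>1 - (norm x)\<^sup>2\<close> and \<open>norm (x - \<zeta>)\<close> by factors
  \<open>A\<close> and \<open>B\<close> that differ from 1 by at most \<rho> \<le> 1/2, and the
  kernel is a product of powers of these two. The bound is relative to the kernel itself, so that it
  can be integrated against a test function.\<close>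

lemma poisson_kernel_Lipschitz:
  "\<exists>c\<ge>0. \<forall>x y \<zeta> :: real ^ 'n. norm x < 1 \<longrightarrow> norm \<zeta> = 1 \<longrightarrow> norm (x - y) \<le> (1 - norm x) / 2 \<longrightarrow>
     \<bar>poisson_kernel \<alpha> x \<zeta> - poisson_kernel \<alpha> y \<zeta>\<bar> \<le>
       c * (norm (x - y) / (1 - norm x)) * poisson_kernel \<alpha> x \<zeta>"
proof -
  let ?p = "1 + \<alpha>" and ?q = "- (real CARD('n) + \<alpha>)"
  obtain c1 where c1: "c1 \<ge> 0" "\<And>x. \<bar>x - 1\<bar> \<le> 1 / 2 \<Longrightarrow> \<bar>x powr ?p - 1\<bar> \<le> c1 * \<bar>x - 1\<bar>"
    using powr_Lipschitz_near_1[of ?p] by blast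
  obtain c2 where c2: "c2 \<ge> 0" "\<And>x. \<bar>x - 1\<bar> \<le> 1 / 2 \<Longrightarrow> \<bar>x powr ?q - 1\<bar> \<le> c2 * \<bar>x - 1\<bar>"
    using powr_Lipschitz_near_1[of ?q] by blast
  \<comment> \<open>From \<open>A powr p * B powr q - 1 = A powr p * (B powr q - 1) + (A powr p -
    1)\<close>, with \<open>A powr p\<close> at most \<open>1 + c1\<close>.\<close>
  define c where "c = (1 + c1) * c2 + c1"
  have c: "c \<ge> 0" using c1 c2 by (simp add: c_def)
  show ?thesis
  proof (intro exI[of _ c] conjI allI impI c)
    fix x y \<zeta> :: "real ^ 'n"
    assume x: "norm x < 1" and \<zeta>: "norm \<zeta> = 1" and h: "norm (x - y) \<le> (1 - norm x) / 2"
    define d \<rho> where "d = 1 - norm x" and "\<rho> = norm (x - y) / d"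
    have d: "d > 0" using x by (simp add: d_def)
    have \<rho>: "0 \<le> \<rho>" "\<rho> \<le> 1 / 2" using h d by (auto simp: \<rho>_def d_def field_simps)
    have nx: "norm x = 1 - d" by (simp add: d_def)
    have hr: "norm (x - y) = \<rho> * d" using d by (simp add: \<rho>_def)
    have nxy: "\<bar>norm y - norm x\<bar> \<le> \<rho> * d"
      using norm_triangle_ineq3[of y x] hr by (simp add: norm_minus_commute)
    have Dx: "1 - (norm x)\<^sup>2 = d * (1 + norm x)"
      by (simp add: d_def power2_eq_square algebra_simps)
    have Dx0: "1 - (norm x)\<^sup>2 > 0" unfolding Dx using d by (simp add: add_pos_nonneg)
    define A where "A = (1 - (norm y)\<^sup>2) / (1 - (norm x)\<^sup>2)"
    have A: "\<bar>A - 1\<bar> \<le> \<rho>"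
    proof -
      have "\<rho> * d \<le> 1 / 2 * d" using \<rho> d by (intro mult_right_mono) auto
      \<comment> \<open>This sum is absorbed by the factor \<open>1 + norm x\<close> of
        \<open>1 - (norm x)\<^sup>2\<close>, leaving only \<open>d\<close> in the
        denominator.\<close>
      then have "norm x + norm y \<le> 1 + norm x"
        using abs_ge_self[of "norm y - norm x"] nxy d nx by linarith
      then have "\<bar>norm y - norm x\<bar> * (norm x + norm y) \<le> (\<rho> * d) * (1 + norm x)"
        using nxy \<rho> d by (intro mult_mono) auto
      moreover have "\<bar>A - 1\<bar> = \<bar>norm y - norm x\<bar> * (norm x + norm y) / (1 - (norm x)\<^sup>2)"
      proof -
        have "A - 1 = ((norm x)\<^sup>2 - (norm y)\<^sup>2) / (1 - (norm x)\<^sup>2)"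
          using Dx0 by (simp add: A_def field_simps)
        also have "(norm x)\<^sup>2 - (norm y)\<^sup>2 = (norm x - norm y) * (norm x + norm y)"
          by (simp add: power2_eq_square algebra_simps)
        finally have "\<bar>A - 1\<bar> = \<bar>norm x - norm y\<bar> * \<bar>norm x + norm y\<bar> / \<bar>1 - (norm x)\<^sup>2\<bar>"
          by (simp only: abs_mult abs_divide)
        then show ?thesis
          using Dx0 by (simp add: abs_minus_commute[of "norm x"])
      qed
      ultimately show ?thesis using Dx0 by (simp add: Dx pos_divide_le_eq mult.assoc)
    qed
    have xz: "d \<le> norm (x - \<zeta>)"
      using norm_triangle_ineq2[of \<zeta> x] \<zeta> by (simp add: d_def norm_minus_commute)
    have xz0: "norm (x - \<zeta>) > 0" using xz d by linarith
    define B where "B = norm (y - \<zeta>) / norm (x - \<zeta>)"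
    have B: "\<bar>B - 1\<bar> \<le> \<rho>"
    proof -
      have "\<bar>B - 1\<bar> = \<bar>norm (y - \<zeta>) - norm (x - \<zeta>)\<bar> / norm (x - \<zeta>)"
      proof -
        have "B - 1 = (norm (y - \<zeta>) - norm (x - \<zeta>)) / norm (x - \<zeta>)"
          using xz0 by (simp add: B_def diff_divide_distrib)
        then show ?thesis by simp
      qed
      also have "\<dots> \<le> (\<rho> * d) / norm (x - \<zeta>)"
        using norm_triangle_ineq3[of "y - \<zeta>" "x - \<zeta>"] hr
        by (intro divide_right_mono) (auto simp: norm_minus_commute)
      also have "\<dots> \<le> (\<rho> * d) / d"
        using xz xz0 d \<rho> by (intro divide_left_mono mult_pos_pos) auto
      finally show ?thesis using d by simp
    qed
    have A0: "A > 0" and B0: "B > 0" using A B \<rho> by auto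
    have Dy: "1 - (norm y)\<^sup>2 = A * (1 - (norm x)\<^sup>2)" using Dx0 by (simp add: A_def)
    have yz: "norm (y - \<zeta>) = B * norm (x - \<zeta>)" using xz0 by (simp add: B_def)
    have q: "B powr ?q = 1 / B powr (real CARD('n) + \<alpha>)" by (rule powr_minus_divide)
    have K: "poisson_kernel \<alpha> y \<zeta> = A powr ?p * B powr ?q * poisson_kernel \<alpha> x \<zeta>"
      unfolding poisson_kernel_def Dy yz q using A0 B0 Dx0
      by (simp add: powr_mult divide_simps)
    have a: "\<bar>A powr ?p - 1\<bar> \<le> c1 * \<rho>"
      by (rule order_trans[OF c1(2) mult_left_mono[OF A c1(1)]]) (use A \<rho> in linarith)
    have b: "\<bar>B powr ?q - 1\<bar> \<le> c2 * \<rho>"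
      by (rule order_trans[OF c2(2) mult_left_mono[OF B c2(1)]]) (use B \<rho> in linarith)
    have a': "\<bar>A powr ?p\<bar> \<le> 1 + c1"
      using a mult_left_mono[of \<rho> 1 c1] c1 \<rho> by (simp add: abs_le_iff)
    have "\<bar>1 - A powr ?p * B powr ?q\<bar> = \<bar>A powr ?p * (B powr ?q - 1) + (A powr ?p - 1)\<bar>"
      by (simp add: algebra_simps abs_minus_commute)
    also have "\<dots> \<le> \<bar>A powr ?p\<bar> * \<bar>B powr ?q - 1\<bar> + \<bar>A powr ?p - 1\<bar>"
      unfolding abs_mult[symmetric] by (rule abs_triangle_ineq)
    also have "\<dots> \<le> (1 + c1) * (c2 * \<rho>) + c1 * \<rho>"
      using a b a' c1 by (intro add_mono mult_mono) auto
    also have "\<dots> = c * \<rho>" by (simp add: c_def algebra_simps)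
    finally have f: "\<bar>1 - A powr ?p * B powr ?q\<bar> \<le> c * \<rho>" .
    have "\<bar>poisson_kernel \<alpha> x \<zeta> - poisson_kernel \<alpha> y \<zeta>\<bar> =
        \<bar>1 - A powr ?p * B powr ?q\<bar> * poisson_kernel \<alpha> x \<zeta>"
    proof -
      have "poisson_kernel \<alpha> x \<zeta> - poisson_kernel \<alpha> y \<zeta> =
          (1 - A powr ?p * B powr ?q) * poisson_kernel \<alpha> x \<zeta>"
        unfolding K by (simp add: algebra_simps)
      then show ?thesis using poisson_kernel_nonneg[of x \<zeta>] by (simp add: abs_mult)
    qed
    also have "\<dots> \<le> c * \<rho> * poisson_kernel \<alpha> x \<zeta>"
      by (rule mult_right_mono[OF f poisson_kernel_nonneg])
    finally show "\<bar>poisson_kernel \<alpha> x \<zeta> - poisson_kernel \<alpha> y \<zeta>\<bar> \<le>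
       c * (norm (x - y) / (1 - norm x)) * poisson_kernel \<alpha> x \<zeta>"
      unfolding \<rho>_def d_def .
  qed
qed

lemma poisson_transform_diff_le:
  fixes x a :: "real ^ 'n"
  assumes x: "norm x < 1" and a: "norm a = 1" and \<omega>: "majorant \<omega>"
    and f: "continuous_on (sphere 0 1) f"
    and B: "\<And>\<zeta>. norm \<zeta> = 1 \<Longrightarrow> \<bar>f \<zeta> - f a\<bar> \<le> B * test_fun \<omega> a \<zeta>"
  shows "\<bar>poisson_transform \<alpha> f x - f a * poisson_transform \<alpha> (\<lambda>_. 1) x\<bar> \<le>
           B * poisson_transform \<alpha> (test_fun \<omega> a) x"
proof -
  have i: "integrable sphere_measure (\<lambda>\<zeta>. poisson_kernel \<alpha> x \<zeta> * f \<zeta>)"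
    "integrable sphere_measure (\<lambda>\<zeta>. f a * (poisson_kernel \<alpha> x \<zeta> * 1))"
    using integrable_poisson_kernel_mult[OF x f] integrable_poisson_kernel_mult[OF x continuous_on_const[of _ 1]]
    by auto
  have "poisson_transform \<alpha> f x - f a * poisson_transform \<alpha> (\<lambda>_. 1) x =
      (\<integral>\<zeta>. poisson_kernel \<alpha> x \<zeta> * f \<zeta> \<partial>sphere_measure) -
      (\<integral>\<zeta>. f a * (poisson_kernel \<alpha> x \<zeta> * 1) \<partial>sphere_measure)"
    by (simp add: poisson_transform_def)
  also have "\<dots> = (\<integral>\<zeta>. poisson_kernel \<alpha> x \<zeta> * f \<zeta> - f a * (poisson_kernel \<alpha> x \<zeta> * 1) \<partial>sphere_measure)"
    by (rule Bochner_Integration.integral_diff[OF i, symmetric])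
  also have "\<bar>\<dots>\<bar> \<le> (\<integral>\<zeta>. B * (poisson_kernel \<alpha> x \<zeta> * test_fun \<omega> a \<zeta>) \<partial>sphere_measure)"
  proof (rule abs_integral_le)
    show "integrable sphere_measure (\<lambda>\<zeta>. B * (poisson_kernel \<alpha> x \<zeta> * test_fun \<omega> a \<zeta>))"
      by (rule integrable_mult_right[OF integrable_poisson_kernel_mult[OF x continuous_on_test_fun[OF \<omega>]]])
    show "integrable sphere_measure (\<lambda>\<zeta>. poisson_kernel \<alpha> x \<zeta> * f \<zeta> - f a * (poisson_kernel \<alpha> x \<zeta> * 1))"
      by (rule Bochner_Integration.integrable_diff[OF i])
    fix \<zeta> :: "real ^ 'n" assume "\<zeta> \<in> space sphere_measure"
    then have \<zeta>: "norm \<zeta> = 1" by (simp add: space_sphere_measure)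
    have "\<bar>poisson_kernel \<alpha> x \<zeta> * f \<zeta> - f a * (poisson_kernel \<alpha> x \<zeta> * 1)\<bar> =
        poisson_kernel \<alpha> x \<zeta> * \<bar>f \<zeta> - f a\<bar>"
      using poisson_kernel_nonneg[of x \<zeta>]
      by (metis abs_mult abs_of_nonneg mult.commute mult.right_neutral right_diff_distrib)
    also have "\<dots> \<le> poisson_kernel \<alpha> x \<zeta> * (B * test_fun \<omega> a \<zeta>)"
      by (rule mult_left_mono[OF B[OF \<zeta>] poisson_kernel_nonneg])
    finally show "\<bar>poisson_kernel \<alpha> x \<zeta> * f \<zeta> - f a * (poisson_kernel \<alpha> x \<zeta> * 1)\<bar> \<le>
        B * (poisson_kernel \<alpha> x \<zeta> * test_fun \<omega> a \<zeta>)" by (simp add: mult_ac)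
  qed
  also have "\<dots> = B * poisson_transform \<alpha> (test_fun \<omega> a) x"
    by (simp add: poisson_transform_def)
  finally show ?thesis .
qed

text \<open>The integrand is the kernel difference times \<open>f \<zeta> - f a\<close>. With the
  first factor bounded by \<open>k\<close> times the kernel at \<open>x\<close>, the transform of
  the test function at the single point \<open>x\<close> controls the increment.\<close>

lemma poisson_transform_increment_le:
  fixes x y a :: "real ^ 'n"
  assumes x: "norm x < 1" "norm y < 1" and a: "norm a = 1" and \<omega>: "majorant \<omega>"
    and f: "continuous_on (sphere 0 1) f"
    and B: "\<And>\<zeta>. norm \<zeta> = 1 \<Longrightarrow> \<bar>f \<zeta> - f a\<bar> \<le> B * test_fun \<omega> a \<zeta>"
    and k: "\<And>\<zeta>. norm \<zeta> = 1 \<Longrightarrow>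
      \<bar>poisson_kernel \<alpha> x \<zeta> - poisson_kernel \<alpha> y \<zeta>\<bar> \<le> k * poisson_kernel \<alpha> x \<zeta>"
  shows "\<bar>poisson_transform \<alpha> f x - poisson_transform \<alpha> f y -
           f a * (poisson_transform \<alpha> (\<lambda>_. 1) x - poisson_transform \<alpha> (\<lambda>_. 1) y)\<bar> \<le>
           k * B * poisson_transform \<alpha> (test_fun \<omega> a) x"
proof -
  let ?P = "poisson_kernel \<alpha>"
  have i: "integrable sphere_measure (\<lambda>\<zeta>. ?P x \<zeta> * f \<zeta>)" "integrable sphere_measure (\<lambda>\<zeta>. ?P y \<zeta> * f \<zeta>)"
    "integrable sphere_measure (?P x)" "integrable sphere_measure (?P y)"
    using x f by (auto intro: integrable_poisson_kernel_mult integrable_sphere_measure_continuous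
        continuous_on_poisson_kernel)
  have "poisson_transform \<alpha> f x - poisson_transform \<alpha> f y -
           f a * (poisson_transform \<alpha> (\<lambda>_. 1) x - poisson_transform \<alpha> (\<lambda>_. 1) y) =
     (\<integral>\<zeta>. ?P x \<zeta> * f \<zeta> - ?P y \<zeta> * f \<zeta> - f a * (?P x \<zeta> - ?P y \<zeta>) \<partial>sphere_measure)"
    unfolding poisson_transform_def using i by simp
  also have "\<bar>\<dots>\<bar> \<le> (\<integral>\<zeta>. k * B * (?P x \<zeta> * test_fun \<omega> a \<zeta>) \<partial>sphere_measure)"
  proof (rule abs_integral_le)
    show "integrable sphere_measure (\<lambda>\<zeta>. k * B * (?P x \<zeta> * test_fun \<omega> a \<zeta>))"
      by (rule integrable_mult_right[OF integrable_poisson_kernel_mult[OF x(1) continuous_on_test_fun[OF \<omega>]]])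
    show "integrable sphere_measure (\<lambda>\<zeta>. ?P x \<zeta> * f \<zeta> - ?P y \<zeta> * f \<zeta> - f a * (?P x \<zeta> - ?P y \<zeta>))"
      using i by simp
    fix \<zeta> :: "real ^ 'n" assume "\<zeta> \<in> space sphere_measure"
    then have \<zeta>: "norm \<zeta> = 1" by (simp add: space_sphere_measure)
    have eq: "?P x \<zeta> * f \<zeta> - ?P y \<zeta> * f \<zeta> - f a * (?P x \<zeta> - ?P y \<zeta>) = (?P x \<zeta> - ?P y \<zeta>) * (f \<zeta> - f a)"
      by (simp add: algebra_simps)
    have "\<bar>?P x \<zeta> * f \<zeta> - ?P y \<zeta> * f \<zeta> - f a * (?P x \<zeta> - ?P y \<zeta>)\<bar> =
        \<bar>?P x \<zeta> - ?P y \<zeta>\<bar> * \<bar>f \<zeta> - f a\<bar>"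
      unfolding eq by (rule abs_mult)
    also have "\<dots> \<le> (k * ?P x \<zeta>) * (B * test_fun \<omega> a \<zeta>)"
      by (rule mult_mono[OF k[OF \<zeta>] B[OF \<zeta>] order_trans[OF abs_ge_zero k[OF \<zeta>]] abs_ge_zero])
    finally show "\<bar>?P x \<zeta> * f \<zeta> - ?P y \<zeta> * f \<zeta> - f a * (?P x \<zeta> - ?P y \<zeta>)\<bar> \<le>
        k * B * (?P x \<zeta> * test_fun \<omega> a \<zeta>)" by (simp add: mult_ac)
  qed
  also have "\<dots> = k * B * poisson_transform \<alpha> (test_fun \<omega> a) x"
    by (simp add: poisson_transform_def)
  finally show ?thesis .
qed

lemma poisson_transform_1_bounded:
  assumes n: "CARD('n::finite) \<ge> 2"
  shows "\<exists>U\<ge>0. \<forall>x :: real ^ 'n. norm x < 1 \<longrightarrow>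
    0 \<le> poisson_transform \<alpha> (\<lambda>_. 1) x \<and> poisson_transform \<alpha> (\<lambda>_. 1) x \<le> U"
proof -
  obtain e :: "real ^ 'n" where e: "norm e = 1" using vector_choose_size[of 1] by auto
  have pc: "poisson_const CARD('n) \<alpha> \<ge> 0" using poisson_const_CARD_pos[where 'n = 'n] by simp
  obtain M where M: "M \<ge> 0" "\<And>r. \<lbrakk>0 \<le> r; r < 1\<rbrakk> \<Longrightarrow> radial_poisson e \<alpha> r \<le> M"
    by (rule radial_poisson_bounded[OF e n \<alpha>]) blast
  show ?thesis
  proof (intro exI[of _ "poisson_const CARD('n) \<alpha> * M"] conjI allI impI)
    fix x :: "real ^ 'n" assume x: "norm x < 1"
    show "0 \<le> poisson_transform \<alpha> (\<lambda>_. 1) x"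
      unfolding poisson_transform_1[OF e x] using pc radial_poisson_nonneg by (intro mult_nonneg_nonneg)
    show "poisson_transform \<alpha> (\<lambda>_. 1) x \<le> poisson_const CARD('n) \<alpha> * M"
      unfolding poisson_transform_1[OF e x] using pc M(2)[of "norm x"] x by (intro mult_left_mono) auto
  qed (use pc M in simp)
qed

end

section \<open>Lipschitz estimates from the test functions\<close>

text \<open>Of two antipodal points one is at distance at least 1 from \<open>a\<close>. Averaging
  over \<zeta> and \<open>- \<zeta>\<close> therefore gives at least \<open>\<omega> 1 / 2\<close>,
  with no need to measure a cap.\<close>

lemma integral_test_fun_pos:
  fixes a :: "real ^ 'n"
  assumes \<omega>: "majorant \<omega>" and a: "norm a = 1"
  shows "0 < (\<integral>\<zeta>. test_fun \<omega> a \<zeta> \<partial>sphere_measure)"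
proof -
  note m = majorantD[OF \<omega>]
  have i: "integrable sphere_measure (test_fun \<omega> a)" "integrable sphere_measure (\<lambda>\<zeta>. test_fun \<omega> a (- \<zeta>))"
  proof -
    show "integrable sphere_measure (test_fun \<omega> a)"
      by (rule integrable_sphere_measure_continuous[OF continuous_on_test_fun[OF \<omega>]])
    have "continuous_on (sphere 0 1) (\<lambda>\<zeta>. test_fun \<omega> a (- \<zeta>))"
      by (rule continuous_on_compose2[OF continuous_on_test_fun[OF \<omega>, of UNIV a], of _ uminus])
        (auto intro!: continuous_intros)
    then show "integrable sphere_measure (\<lambda>\<zeta>. test_fun \<omega> a (- \<zeta>))"
      by (rule integrable_sphere_measure_continuous)
  qed
  have "orthogonal_transformation (uminus :: real ^ 'n \<Rightarrow> real ^ 'n)"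
    by (simp add: orthogonal_transformation linear_uminus)
  from integral_sphere_measure_orthogonal[OF borel_measurable_continuous_onI[OF continuous_on_test_fun[OF \<omega>]] this, of a]
  have "2 * (\<integral>\<zeta>. test_fun \<omega> a \<zeta> \<partial>sphere_measure) =
      (\<integral>\<zeta>. test_fun \<omega> a \<zeta> + test_fun \<omega> a (- \<zeta>) \<partial>sphere_measure)"
    using i by simp
  moreover have "(\<integral>\<zeta>. \<omega> 1 \<partial>(sphere_measure :: (real ^ 'n) measure)) \<le>
      (\<integral>\<zeta>. test_fun \<omega> a \<zeta> + test_fun \<omega> a (- \<zeta>) \<partial>sphere_measure)"
  proof (rule integral_mono)
    show "integrable (sphere_measure :: (real ^ 'n) measure) (\<lambda>_. \<omega> 1)"
      by (rule integrable_sphere_measure_continuous) auto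
    show "integrable sphere_measure (\<lambda>\<zeta>. test_fun \<omega> a \<zeta> + test_fun \<omega> a (- \<zeta>))"
      using i by simp
    fix \<zeta> :: "real ^ 'n" assume "\<zeta> \<in> space sphere_measure"
    then have \<zeta>: "norm \<zeta> = 1" by (simp add: space_sphere_measure)
    have "norm (2 *\<^sub>R \<zeta>) = 2" using \<zeta> by simp
    also have "2 *\<^sub>R \<zeta> = (\<zeta> - a) - (- \<zeta> - a)" by (simp add: scaleR_2)
    finally have "1 \<le> norm (\<zeta> - a) \<or> 1 \<le> norm (- \<zeta> - a)"
      using norm_triangle_ineq4[of "\<zeta> - a" "- \<zeta> - a"] by linarith
    then show "\<omega> 1 \<le> test_fun \<omega> a \<zeta> + test_fun \<omega> a (- \<zeta>)"
      using m(5)[of 1 "norm (\<zeta> - a)"] m(5)[of 1 "norm (- \<zeta> - a)"]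
        m(4)[of "norm (\<zeta> - a)"] m(4)[of "norm (- \<zeta> - a)"]
      by (auto simp: test_fun_def)
  qed
  moreover have "\<omega> 1 > 0" by (rule m(3)) simp
  ultimately show ?thesis
    by (simp add: space_sphere_measure measure_sphere_measure_UNIV)
qed

lemma continuous_on_majorant_Lipschitz:
  fixes f :: "real ^ 'n \<Rightarrow> real"
  assumes \<omega>: "majorant \<omega>"
    and B: "\<And>x y. \<lbrakk>x \<in> S; y \<in> S\<rbrakk> \<Longrightarrow> \<bar>f x - f y\<bar> \<le> B * \<omega> (norm (x - y))"
  shows "continuous_on S f"
  unfolding continuous_on_def
proof
  fix a assume a: "a \<in> S"
  have "(test_fun \<omega> a \<longlongrightarrow> test_fun \<omega> a a) (at a within S)"
    using continuous_on_test_fun[OF \<omega>, of S a] a by (simp add: continuous_on_def)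
  then have "((\<lambda>x. B * test_fun \<omega> a x) \<longlongrightarrow> B * test_fun \<omega> a a) (at a within S)"
    by (rule tendsto_mult_left)
  then have lim: "((\<lambda>x. B * test_fun \<omega> a x) \<longlongrightarrow> 0) (at a within S)"
    by (simp add: test_fun_def majorantD(2)[OF \<omega>])
  have "((\<lambda>x. f x - f a) \<longlongrightarrow> 0) (at a within S)"
  proof (rule Lim_null_comparison[OF _ lim])
    show "\<forall>\<^sub>F x in at a within S. norm (f x - f a) \<le> B * test_fun \<omega> a x"
      using B a by (auto simp: eventually_at_filter test_fun_def)
  qed
  then show "(f \<longlongrightarrow> f a) (at a within S)"
    by (rule LIM_zero_cancel)
qed

lemma nearest_sphere_point:
  fixes x :: "real ^ 'n"
  assumes "norm x < 1"
  obtains a where "norm a = 1" "norm (x - a) = 1 - norm x"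
proof (cases "x = 0")
  case True
  obtain e :: "real ^ 'n" where "norm e = 1" using vector_choose_size[of 1] by auto
  then show ?thesis using True by (intro that[of e]) auto
next
  case False
  have "x - sgn x = (norm x - 1) *\<^sub>R sgn x"
    using False by (simp add: sgn_div_norm algebra_simps)
  then have "norm (x - sgn x) = 1 - norm x"
    using assms False by (simp add: norm_sgn)
  then show ?thesis using False by (intro that[of "sgn x"]) (auto simp: norm_sgn)
qed

section \<open>From the test functions to Lipschitz bounds on the ball\<close>

context
  fixes \<alpha> :: real and \<omega> :: "real \<Rightarrow> real"
  assumes \<alpha>: "\<alpha> > -1" and \<omega>: "majorant \<omega>"
begin

text \<open>At \<open>x = (1 - t) *\<^sub>R a\<close> the kernel is everywhere at least
  \<open>k * t powr (1 + \<alpha>)\<close>, since \<open>1 - (norm x)\<^sup>2 \<ge> t\<close> and no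
  distance exceeds 2; the test function has positive integral \<open>T\<close>. The linear part
  holds for any majorant. The range up to 2 covers all distances in the ball.\<close>

lemma majorant_lower_bound:
  fixes a :: "real ^ 'n"
  assumes a: "norm a = 1"
    and C: "\<And>x. norm x < 1 \<Longrightarrow> poisson_transform \<alpha> (test_fun \<omega> a) x \<le> C * \<omega> (norm (x - a))"
  shows "\<exists>c>0. \<forall>t. 0 < t \<longrightarrow> t \<le> 2 \<longrightarrow> c * (t + t powr (1 + \<alpha>)) \<le> \<omega> t"
proof -
  note m = majorantD[OF \<omega>]
  let ?n = "real CARD('n)"
  have n: "?n \<ge> 1" using zero_less_card_finite[where 'a = 'n] by simp
  have na: "0 \<le> ?n + \<alpha>" using n \<alpha> by linarith
  define T where "T = (\<integral>\<zeta>. test_fun \<omega> a \<zeta> \<partial>sphere_measure)"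
  define k where "k = poisson_const CARD('n) \<alpha> / 2 powr (?n + \<alpha>)"
  have T: "T > 0" unfolding T_def by (rule integral_test_fun_pos[OF \<omega> a])
  have pc: "poisson_const CARD('n) \<alpha> > 0" by (rule poisson_const_CARD_pos[OF \<alpha>])
  have k: "k > 0" using pc by (simp add: k_def)
  have low: "k * T * t powr (1 + \<alpha>) \<le> C * \<omega> t" if t: "0 < t" "t \<le> 1" for t
  proof -
    define x where "x = (1 - t) *\<^sub>R a"
    have x: "norm x = 1 - t" using t a by (simp add: x_def)
    have xa: "norm (x - a) = t"
    proof -
      have "x - a = (- t) *\<^sub>R a" by (simp add: x_def algebra_simps)
      then show ?thesis using a t by simp
    qed
    have x1: "norm x < 1" using x t by simp
    have "k * T * t powr (1 + \<alpha>) = (\<integral>\<zeta>. (k * t powr (1 + \<alpha>)) * test_fun \<omega> a \<zeta> \<partial>sphere_measure)"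
      by (simp add: T_def)
    also have "\<dots> \<le> (\<integral>\<zeta>. poisson_kernel \<alpha> x \<zeta> * test_fun \<omega> a \<zeta> \<partial>sphere_measure)"
    proof (rule integral_mono)
      show "integrable sphere_measure (\<lambda>\<zeta>. (k * t powr (1 + \<alpha>)) * test_fun \<omega> a \<zeta>)"
        by (rule integrable_mult_right[OF integrable_sphere_measure_continuous[OF continuous_on_test_fun[OF \<omega>]]])
      show "integrable sphere_measure (\<lambda>\<zeta>. poisson_kernel \<alpha> x \<zeta> * test_fun \<omega> a \<zeta>)"
        by (rule integrable_poisson_kernel_mult[OF \<alpha> x1 continuous_on_test_fun[OF \<omega>]])
      fix \<zeta> :: "real ^ 'n" assume "\<zeta> \<in> space sphere_measure"
      then have \<zeta>: "norm \<zeta> = 1" by (simp add: space_sphere_measure)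
      have "t * t \<le> t * 1" using t by (intro mult_left_mono) auto
      then have D: "t \<le> 1 - (norm x)\<^sup>2" unfolding x by (simp add: power2_eq_square algebra_simps)
      have z2: "norm (x - \<zeta>) \<le> 2" using norm_triangle_ineq4[of x \<zeta>] \<zeta> x1 by simp
      have z0: "norm (x - \<zeta>) > 0" using \<zeta> x1 by auto
      have "t powr (1 + \<alpha>) / 2 powr (?n + \<alpha>) \<le>
          (1 - (norm x)\<^sup>2) powr (1 + \<alpha>) / norm (x - \<zeta>) powr (?n + \<alpha>)"
        using D z2 z0 t \<alpha> na by (intro frac_le powr_mono2) auto
      from mult_left_mono[OF this less_imp_le[OF pc]]
      have "k * t powr (1 + \<alpha>) \<le> poisson_kernel \<alpha> x \<zeta>"
        by (simp add: poisson_kernel_def k_def)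
      moreover have "test_fun \<omega> a \<zeta> \<ge> 0" unfolding test_fun_def by (rule m(4)) simp
      ultimately show "(k * t powr (1 + \<alpha>)) * test_fun \<omega> a \<zeta> \<le> poisson_kernel \<alpha> x \<zeta> * test_fun \<omega> a \<zeta>"
        by (rule mult_right_mono)
    qed
    also have "\<dots> \<le> C * \<omega> t"
      using C[OF x1] by (simp add: poisson_transform_def xa)
    finally show ?thesis .
  qed
  \<comment> \<open>No sign of \<open>C\<close> is assumed; the bound at the centre of the ball
    forces it to be positive.\<close>
  have "0 < k * T" using k T by simp
  also have "k * T \<le> C * \<omega> 1" using low[of 1] by simp
  finally have C0: "C > 0" using m(3)[of 1] by (simp add: zero_less_mult_iff)
  define c0 where "c0 = k * T / C"
  \<comment> \<open>For \<open>t\<close> between 1 and 2 only monotonicity is used, at the cost of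
    the factor \<open>2 powr (1 + \<alpha>)\<close>.\<close>
  define c1 where "c1 = c0 / 2 powr (1 + \<alpha>)"
  have c0: "c0 > 0" using k T C0 by (simp add: c0_def)
  have c1: "c1 > 0" using c0 by (simp add: c1_def)
  have "(1 :: real) \<le> 2 powr (1 + \<alpha>)" using \<alpha> by (simp add: ge_one_powr_ge_zero)
  then have c10: "c1 \<le> c0" unfolding c1_def using c0 by (simp add: divide_le_eq)
  have low1: "c0 * t powr (1 + \<alpha>) \<le> \<omega> t" if "0 < t" "t \<le> 1" for t
    using low[OF that] C0 by (simp add: c0_def field_simps)
  have low2: "c1 * t powr (1 + \<alpha>) \<le> \<omega> t" if t: "0 < t" "t \<le> 2" for t
  proof (cases "t \<le> 1")
    case True
    have "c1 * t powr (1 + \<alpha>) \<le> c0 * t powr (1 + \<alpha>)" by (rule mult_right_mono[OF c10]) simp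
    then show ?thesis using low1[OF t(1) True] by simp
  next
    case False
    have "c1 * t powr (1 + \<alpha>) \<le> c1 * 2 powr (1 + \<alpha>)"
      using t \<alpha> c1 by (intro mult_left_mono powr_mono2) auto
    also have "\<dots> = c0 * 1 powr (1 + \<alpha>)" by (simp add: c1_def)
    also have "\<dots> \<le> \<omega> 1" by (rule low1) auto
    also have "\<dots> \<le> \<omega> t" using False by (intro m(5)) auto
    finally show ?thesis .
  qed
  \<comment> \<open>The outer factor \<open>1 / 2\<close> lets each of the two terms use up half of
    \<open>\<omega> t\<close>.\<close>
  define c where "c = min c1 (\<omega> 2 / 2) / 2"
  have w2: "\<omega> 2 > 0" by (rule m(3)) simp
  have "c > 0" using c1 w2 by (simp add: c_def)
  moreover have "c * (t + t powr (1 + \<alpha>)) \<le> \<omega> t" if t: "0 < t" "t \<le> 2" for t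
  proof -
    have "c * t \<le> (\<omega> 2 / 2 / 2) * t" unfolding c_def using t by (intro mult_right_mono divide_right_mono) auto
    also have "\<dots> \<le> \<omega> t / 2" using m(6)[OF t] by (simp add: field_simps)
    finally have 1: "c * t \<le> \<omega> t / 2" .
    have "c * t powr (1 + \<alpha>) \<le> (c1 / 2) * t powr (1 + \<alpha>)"
      unfolding c_def by (intro mult_right_mono divide_right_mono) auto
    also have "\<dots> \<le> \<omega> t / 2" using low2[OF t] by simp
    finally show ?thesis using 1 by (simp add: distrib_left)
  qed
  ultimately show ?thesis by blast
qed

text \<open>The lower bound \<open>low\<close> converts the modulus of continuity of the radial
  profile into \<omega>. That modulus is available only from radius \<open>1 / 2\<close> on; further
  inside, the kernel estimate or plain boundedness is enough, and by symmetry \<open>x\<close> is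
  the point of smaller norm.\<close>

lemma poisson_transform_1_Lipschitz:
  assumes n: "CARD('n::finite) \<ge> 2" and c: "c > 0"
    and low: "\<And>t. \<lbrakk>0 < t; t \<le> 2\<rbrakk> \<Longrightarrow> c * (t + t powr (1 + \<alpha>)) \<le> \<omega> t"
  shows "\<exists>M\<ge>0. \<forall>x y :: real ^ 'n. norm x < 1 \<longrightarrow> norm y < 1 \<longrightarrow>
    \<bar>poisson_transform \<alpha> (\<lambda>_. 1) x - poisson_transform \<alpha> (\<lambda>_. 1) y\<bar> \<le> M * \<omega> (norm (x - y))"
proof -
  note m = majorantD[OF \<omega>]
  define u :: "real ^ 'n \<Rightarrow> real" where "u = poisson_transform \<alpha> (\<lambda>_. 1)"
  obtain e :: "real ^ 'n" where e: "norm e = 1" using vector_choose_size[of 1] by auto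
  define k where "k = poisson_const CARD('n) \<alpha>"
  have k: "k > 0" unfolding k_def by (rule poisson_const_CARD_pos[OF \<alpha>])
  obtain U where U: "U \<ge> 0" "\<And>x. norm x < 1 \<Longrightarrow> 0 \<le> u x" "\<And>x. norm x < 1 \<Longrightarrow> u x \<le> U"
    using poisson_transform_1_bounded[OF \<alpha> n] unfolding u_def by blast
  obtain M2 where M2: "M2 \<ge> 0" "\<And>r r'. \<lbrakk>1 / 2 \<le> r; r \<le> r'; r' < 1\<rbrakk> \<Longrightarrow>
    \<bar>radial_poisson e \<alpha> r' - radial_poisson e \<alpha> r\<bar> \<le> M2 * ((r' - r) + (r' - r) powr (1 + \<alpha>))"
    by (rule radial_poisson_Hoelder[OF e n \<alpha>]) blast
  obtain cK where cK: "cK \<ge> 0" "\<And>x y \<zeta> :: real ^ 'n. \<lbrakk>norm x < 1; norm \<zeta> = 1; norm (x - y) \<le> (1 - norm x) / 2\<rbrakk> \<Longrightarrow>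
       \<bar>poisson_kernel \<alpha> x \<zeta> - poisson_kernel \<alpha> y \<zeta>\<bar> \<le> cK * (norm (x - y) / (1 - norm x)) * poisson_kernel \<alpha> x \<zeta>"
    using poisson_kernel_Lipschitz[OF \<alpha>, where 'n = 'n] by blast
  \<comment> \<open>One summand for each case below. The factor 2 bounds
    \<open>1 / (1 - norm x)\<close> for \<open>norm x < 1 / 2\<close>, and \<open>1 / 4\<close> is
    what \<open>(1 - norm x) / 2\<close> exceeds there.\<close>
  define M where "M = k * M2 / c + 2 * cK * U / c + U / \<omega> (1 / 4)"
  have w4: "\<omega> (1 / 4) > 0" by (rule m(3)) simp
  have parts: "0 \<le> k * M2 / c" "0 \<le> 2 * cK * U / c" "0 \<le> U / \<omega> (1 / 4)"
    using k M2 c cK U w4 by auto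
  have low1: "c * t \<le> \<omega> t" if "0 < t" "t \<le> 2" for t
  proof -
    have "c * t \<le> c * (t + t powr (1 + \<alpha>))" using c by (intro mult_left_mono) auto
    then show ?thesis using low[OF that] by simp
  qed
  have main: "\<bar>u x - u y\<bar> \<le> M * \<omega> (norm (x - y))" if xy: "norm x \<le> norm y" "norm y < 1" for x y
  proof (cases "x = y")
    case True
    then show ?thesis using m(2) by simp
  next
    case False
    define h where "h = norm (x - y)"
    have x1: "norm x < 1" using xy by simp
    have h: "0 < h" "h \<le> 2"
      using False norm_triangle_ineq4[of x y] xy by (auto simp: h_def)
    have wh: "\<omega> h \<ge> 0" using m(4) h by simp
    have up: "p * \<omega> h \<le> M * \<omega> h" if "p \<in> {k * M2 / c, 2 * cK * U / c, U / \<omega> (1 / 4)}" for p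
      using that parts by (intro mult_right_mono[OF _ wh]) (auto simp: M_def)
    consider "1 / 2 \<le> norm x" | "norm x < 1 / 2" "h \<le> (1 - norm x) / 2" | "norm x < 1 / 2" "h > (1 - norm x) / 2"
      by linarith
    then show ?thesis
    proof cases
      case 1
      define \<delta> where "\<delta> = norm y - norm x"
      have \<delta>: "0 \<le> \<delta>" "\<delta> \<le> h" "\<delta> \<le> 2"
        using xy h norm_triangle_ineq3[of x y] by (auto simp: \<delta>_def h_def)
      have "\<bar>u x - u y\<bar> = k * \<bar>radial_poisson e \<alpha> (norm y) - radial_poisson e \<alpha> (norm x)\<bar>"
        unfolding u_def poisson_transform_1[OF \<alpha> e x1] poisson_transform_1[OF \<alpha> e xy(2)] k_def[symmetric]
        using k by (simp add: abs_mult abs_minus_commute flip: right_diff_distrib)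
      also have "\<dots> \<le> k * (M2 * (\<delta> + \<delta> powr (1 + \<alpha>)))"
        unfolding \<delta>_def using k by (intro mult_left_mono M2(2) 1 xy) auto
      also have "\<dots> \<le> k * M2 / c * \<omega> h"
      proof (cases "\<delta> = 0")
        case True
        then show ?thesis using mult_nonneg_nonneg[OF parts(1) wh] by simp
      next
        case False
        have "c * (\<delta> + \<delta> powr (1 + \<alpha>)) \<le> \<omega> \<delta>" using False \<delta> by (intro low) auto
        also have "\<dots> \<le> \<omega> h" by (rule m(5)) fact+
        finally have "\<delta> + \<delta> powr (1 + \<alpha>) \<le> \<omega> h / c" using c by (simp add: field_simps)
        from mult_left_mono[OF this, of "k * M2"] show ?thesis using k M2 by (simp add: mult.assoc)
      qed
      also have "\<dots> \<le> M * \<omega> h" by (rule up) simp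
      finally show ?thesis unfolding h_def .
    next
      case 2
      define q where "q = cK * (h / (1 - norm x))"
      have "\<bar>u x - u y\<bar> = \<bar>\<integral>\<zeta>. poisson_kernel \<alpha> x \<zeta> - poisson_kernel \<alpha> y \<zeta> \<partial>sphere_measure\<bar>"
        using integrable_sphere_measure_continuous[OF continuous_on_poisson_kernel[OF \<alpha> x1]]
          integrable_sphere_measure_continuous[OF continuous_on_poisson_kernel[OF \<alpha> xy(2)]]
        by (simp add: u_def poisson_transform_def)
      also have "\<dots> \<le> (\<integral>\<zeta>. q * poisson_kernel \<alpha> x \<zeta> \<partial>sphere_measure)"
      proof (rule abs_integral_le)
        show "integrable sphere_measure (\<lambda>\<zeta>. poisson_kernel \<alpha> x \<zeta> - poisson_kernel \<alpha> y \<zeta>)"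
          "integrable sphere_measure (\<lambda>\<zeta>. q * poisson_kernel \<alpha> x \<zeta>)"
          using integrable_sphere_measure_continuous[OF continuous_on_poisson_kernel[OF \<alpha> x1]]
            integrable_sphere_measure_continuous[OF continuous_on_poisson_kernel[OF \<alpha> xy(2)]] by auto
        show "\<bar>poisson_kernel \<alpha> x \<zeta> - poisson_kernel \<alpha> y \<zeta>\<bar> \<le> q * poisson_kernel \<alpha> x \<zeta>"
          if "\<zeta> \<in> space sphere_measure" for \<zeta> :: "real ^ 'n"
          using cK(2)[OF x1, of \<zeta> y] 2(2) that by (simp add: space_sphere_measure q_def h_def)
      qed
      also have "\<dots> = q * u x" by (simp add: u_def poisson_transform_def)
      also have "\<dots> \<le> (cK * (h / (1 / 2))) * U"
        unfolding q_def using U x1 cK 2(1) h by (intro mult_mono mult_left_mono divide_left_mono) auto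
      also have "\<dots> = (2 * cK * U / c) * (c * h)" using c by simp
      also have "\<dots> \<le> (2 * cK * U / c) * \<omega> h"
        by (rule mult_left_mono[OF low1[OF h] parts(2)])
      also have "\<dots> \<le> M * \<omega> h" by (rule up) simp
      finally show ?thesis unfolding h_def .
    next
      case 3
      have "\<bar>u x - u y\<bar> \<le> U"
        using U(2,3)[OF x1] U(2,3)[OF xy(2)] by linarith
      also have "\<dots> = U / \<omega> (1 / 4) * \<omega> (1 / 4)" using w4 by simp
      also have "\<dots> \<le> U / \<omega> (1 / 4) * \<omega> h"
        using 3 by (intro mult_left_mono[OF m(5) parts(3)]) auto
      also have "\<dots> \<le> M * \<omega> h" by (rule up) simp
      finally show ?thesis unfolding h_def .
    qed
  qed
  have "\<bar>u x - u y\<bar> \<le> M * \<omega> (norm (x - y))" if "norm x < 1" "norm y < 1" for x y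
    using main[of x y] main[of y x] that
    by (cases "norm x \<le> norm y") (auto simp: abs_minus_commute norm_minus_commute)
  moreover have "M \<ge> 0" using parts by (simp add: M_def)
  ultimately show ?thesis unfolding u_def by blast
qed

text \<open>\<open>A\<close> and \<open>B\<close> stand for the supremum and the Lipschitz constant
  of \<open>f\<close>. That \<open>M\<close> is chosen before \<open>A\<close>, \<open>B\<close> and
  \<open>f\<close> is what a finite operator norm requires.\<close>

lemma poisson_transform_Lipschitz:
  assumes n: "CARD('n::finite) \<ge> 2"
    and C: "\<And>x a :: real ^ 'n. \<lbrakk>norm x < 1; norm a = 1\<rbrakk> \<Longrightarrow>
      poisson_transform \<alpha> (test_fun \<omega> a) x \<le> C * \<omega> (norm (x - a))"
  shows "\<exists>M\<ge>0. \<forall>A\<ge>0. \<forall>B\<ge>0. \<forall>f :: real ^ 'n \<Rightarrow> real.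
    (\<forall>\<zeta>. norm \<zeta> = 1 \<longrightarrow> \<bar>f \<zeta>\<bar> \<le> A) \<longrightarrow>
    (\<forall>\<zeta> \<eta>. norm \<zeta> = 1 \<longrightarrow> norm \<eta> = 1 \<longrightarrow> \<bar>f \<zeta> - f \<eta>\<bar> \<le> B * \<omega> (norm (\<zeta> - \<eta>))) \<longrightarrow>
    (\<forall>x. norm x < 1 \<longrightarrow> \<bar>poisson_transform \<alpha> f x\<bar> \<le> M * (A + B)) \<and>
    (\<forall>x y. norm x < 1 \<longrightarrow> norm y < 1 \<longrightarrow>
       \<bar>poisson_transform \<alpha> f x - poisson_transform \<alpha> f y\<bar> \<le> M * (A + B) * \<omega> (norm (x - y)))"
proof -
  note m = majorantD[OF \<omega>]
  let ?P = "poisson_transform \<alpha> :: (real ^ 'n \<Rightarrow> real) \<Rightarrow> real ^ 'n \<Rightarrow> real"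
  define u where "u = ?P (\<lambda>_. 1)"
  obtain e :: "real ^ 'n" where e: "norm e = 1" using vector_choose_size[of 1] by auto
  obtain c where c: "c > 0" "\<And>t. \<lbrakk>0 < t; t \<le> 2\<rbrakk> \<Longrightarrow> c * (t + t powr (1 + \<alpha>)) \<le> \<omega> t"
    using majorant_lower_bound[OF e C] e by blast
  obtain U where U: "U \<ge> 0" "\<And>x. norm x < 1 \<Longrightarrow> 0 \<le> u x" "\<And>x. norm x < 1 \<Longrightarrow> u x \<le> U"
    using poisson_transform_1_bounded[OF \<alpha> n] unfolding u_def by blast
  obtain L where L: "L \<ge> 0" "\<And>x y. \<lbrakk>norm x < 1; norm y < 1\<rbrakk> \<Longrightarrow> \<bar>u x - u y\<bar> \<le> L * \<omega> (norm (x - y))"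
    using poisson_transform_1_Lipschitz[OF n c] unfolding u_def by blast
  obtain cK where cK: "cK \<ge> 0" "\<And>x y \<zeta> :: real ^ 'n. \<lbrakk>norm x < 1; norm \<zeta> = 1; norm (x - y) \<le> (1 - norm x) / 2\<rbrakk> \<Longrightarrow>
       \<bar>poisson_kernel \<alpha> x \<zeta> - poisson_kernel \<alpha> y \<zeta>\<bar> \<le> cK * (norm (x - y) / (1 - norm x)) * poisson_kernel \<alpha> x \<zeta>"
    using poisson_kernel_Lipschitz[OF \<alpha>, where 'n = 'n] by blast
  define C' where "C' = \<bar>C\<bar>"
  have C': "poisson_transform \<alpha> (test_fun \<omega> a) x \<le> C' * \<omega> (norm (x - a))"
    if "norm x < 1" "norm a = 1" for x a :: "real ^ 'n"
  proof -
    have "C * \<omega> (norm (x - a)) \<le> C' * \<omega> (norm (x - a))"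
      unfolding C'_def by (intro mult_right_mono m(4)) auto
    then show ?thesis using C[OF that] by simp
  qed
  have C'0: "C' \<ge> 0" by (simp add: C'_def)
  \<comment> \<open>\<open>L\<close> belongs to the increments of \<open>u\<close>,
    \<open>cK * C'\<close> to close points, \<open>5 * C' + 6 * U\<close> to distant points, and
    \<open>U + C' * \<omega> 1\<close> to the supremum.\<close>
  define M where "M = L + cK * C' + 5 * C' + 6 * U + U + C' * \<omega> 1"
  have w1: "\<omega> 1 \<ge> 0" by (rule m(4)) simp
  have M: "M \<ge> 0" unfolding M_def using L cK C'0 U w1 by simp
  have main: "\<bar>?P f x\<bar> \<le> M * (A + B) \<and>
      (norm y < 1 \<longrightarrow> \<bar>?P f x - ?P f y\<bar> \<le> M * (A + B) * \<omega> (norm (x - y)))"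
    if A: "A \<ge> 0" and B: "B \<ge> 0" and fA: "\<And>\<zeta>. norm \<zeta> = 1 \<Longrightarrow> \<bar>f \<zeta>\<bar> \<le> A"
      and fB: "\<And>\<zeta> \<eta>. \<lbrakk>norm \<zeta> = 1; norm \<eta> = 1\<rbrakk> \<Longrightarrow> \<bar>f \<zeta> - f \<eta>\<bar> \<le> B * \<omega> (norm (\<zeta> - \<eta>))"
      and x: "norm x < 1" for A B f x y
  proof
    have cf: "continuous_on (sphere 0 1) f"
      using fB by (intro continuous_on_majorant_Lipschitz[OF \<omega>, of _ f B]) auto
    have near: "\<bar>?P f x - f a * u x\<bar> \<le> B * (C' * \<omega> (norm (x - a)))" if "norm x < 1" "norm a = 1" for x a
    proof -
      have "\<bar>?P f x - f a * u x\<bar> \<le> B * ?P (test_fun \<omega> a) x"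
        unfolding u_def using fB that
        by (intro poisson_transform_diff_le[OF \<alpha> that \<omega> cf]) (auto simp: test_fun_def)
      also have "\<dots> \<le> B * (C' * \<omega> (norm (x - a)))"
        using C'[OF that] B by (rule mult_left_mono)
      finally show ?thesis .
    qed
    obtain a where a: "norm a = 1" "norm (x - a) = 1 - norm x"
      using nearest_sphere_point[OF x] by blast
    have "\<bar>?P f x\<bar> \<le> \<bar>f a * u x\<bar> + \<bar>?P f x - f a * u x\<bar>" by linarith
    also have "\<dots> \<le> A * U + B * (C' * \<omega> 1)"
    proof (intro add_mono)
      show "\<bar>f a * u x\<bar> \<le> A * U"
        unfolding abs_mult using fA[OF a(1)] U(2,3)[OF x] A by (intro mult_mono) auto
      have "\<omega> (1 - norm x) \<le> \<omega> 1" using x by (intro m(5)) auto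
      then have "B * (C' * \<omega> (norm (x - a))) \<le> B * (C' * \<omega> 1)"
        unfolding a(2) using B C'0 by (intro mult_left_mono) auto
      then show "\<bar>?P f x - f a * u x\<bar> \<le> B * (C' * \<omega> 1)" using near[OF x a(1)] by linarith
    qed
    also have "\<dots> \<le> A * M + B * M"
      using L cK C'0 U w1 A B by (intro add_mono mult_left_mono) (auto simp: M_def)
    finally show "\<bar>?P f x\<bar> \<le> M * (A + B)" by (simp add: algebra_simps)
    show "norm y < 1 \<longrightarrow> \<bar>?P f x - ?P f y\<bar> \<le> M * (A + B) * \<omega> (norm (x - y))"
    proof
      assume y: "norm y < 1"
      define h where "h = norm (x - y)"
      have h0: "h \<ge> 0" by (simp add: h_def)
      have wh: "\<omega> h \<ge> 0" by (rule m(4)[OF h0])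
      have uu: "\<bar>f a * (u x - u y)\<bar> \<le> A * (L * \<omega> h)"
        unfolding abs_mult h_def using fA[OF a(1)] L(2)[OF x y] A by (intro mult_mono) auto
      have fin: "A * (L * \<omega> h) + B * (q * \<omega> h) \<le> M * (A + B) * \<omega> h" if "0 \<le> q" "q \<le> M" for q
      proof -
        have "A * L + B * q \<le> A * M + B * M"
          using that A B L cK C'0 U w1 by (intro add_mono mult_left_mono) (auto simp: M_def)
        from mult_right_mono[OF this wh] show ?thesis by (simp add: algebra_simps)
      qed
      have "\<bar>?P f x - ?P f y\<bar> \<le> M * (A + B) * \<omega> h"
      proof (cases "h \<le> (1 - norm x) / 2")
        case True
        define q where "q = cK * (h / (1 - norm x))"
        have "\<bar>?P f x - ?P f y - f a * (u x - u y)\<bar> \<le> q * B * ?P (test_fun \<omega> a) x"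
          unfolding u_def
        proof (rule poisson_transform_increment_le[OF \<alpha> x y a(1) \<omega> cf])
          show "\<bar>f \<zeta> - f a\<bar> \<le> B * test_fun \<omega> a \<zeta>" if "norm \<zeta> = 1" for \<zeta>
            using fB[OF that a(1)] by (simp add: test_fun_def)
          show "\<bar>poisson_kernel \<alpha> x \<zeta> - poisson_kernel \<alpha> y \<zeta>\<bar> \<le> q * poisson_kernel \<alpha> x \<zeta>" if "norm \<zeta> = 1" for \<zeta>
            using cK(2)[OF x that, of y] True by (simp add: q_def h_def)
        qed
        also have "\<dots> \<le> q * B * (C' * \<omega> (1 - norm x))"
          using C'[OF x a(1)] cK h0 x B unfolding a(2) q_def by (intro mult_left_mono) auto
        also have "\<dots> = B * (cK * C' * (h / (1 - norm x) * \<omega> (1 - norm x)))"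
          by (simp add: q_def)
        also have "\<dots> \<le> B * (cK * C' * \<omega> h)"
        proof -
          \<comment> \<open>The loss \<open>1 / (1 - norm x)\<close> of the kernel estimate is
            compensated by \<open>\<omega> t / t\<close> being non-increasing, as
            \<open>h \<le> 1 - norm x\<close>.\<close>
          have "h / (1 - norm x) * \<omega> (1 - norm x) \<le> \<omega> h"
          proof (cases "h = 0")
            case True
            then show ?thesis using m(2) by simp
          next
            case False
            then show ?thesis using True h0 x by (intro m(6)) auto
          qed
          then show ?thesis using B cK C'0 by (intro mult_left_mono) auto
        qed
        finally have "\<bar>?P f x - ?P f y\<bar> \<le> A * (L * \<omega> h) + B * (cK * C' * \<omega> h)"
          using uu by linarith
        also have "\<dots> \<le> M * (A + B) * \<omega> h"
          using L cK C'0 U w1 by (intro fin) (auto simp: M_def)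
        finally show ?thesis .
      next
        case False
        obtain b where b: "norm b = 1" "norm (y - b) = 1 - norm y"
          using nearest_sphere_point[OF y] by blast
        have dx: "1 - norm x \<le> 2 * h" using False by simp
        have dy: "1 - norm y \<le> 3 * h"
          using dx norm_triangle_ineq2[of x y] by (simp add: h_def)
        \<comment> \<open>The path from \<open>a\<close> through \<open>x\<close> and
          \<open>y\<close> to \<open>b\<close> has length at most
          \<open>2 * h + h + 3 * h\<close>.\<close>
        have ab: "norm (a - b) \<le> 6 * h"
        proof -
          have eq: "a - b = (a - x) + ((x - y) + (y - b))" by simp
          have "norm (a - b) \<le> norm (a - x) + (norm (x - y) + norm (y - b))"
            unfolding eq using norm_triangle_ineq[of "a - x" "(x - y) + (y - b)"]
              norm_triangle_ineq[of "x - y" "y - b"] by linarith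
          then show ?thesis using a(2) b(2) dx dy by (simp add: norm_minus_commute h_def)
        qed
        have W: "\<omega> s \<le> k * \<omega> h" if "0 \<le> s" "s \<le> k * h" "k \<ge> 1" for s k
          using m(5)[OF that(1,2)] majorant_mult_le[OF \<omega> h0 that(3)] by simp
        have 1: "\<bar>?P f x - f a * u x\<bar> \<le> B * (C' * (2 * \<omega> h))"
          by (rule order_trans[OF near[OF x a(1)]])
            (use W[OF _ dx] x B C'0 in \<open>auto simp: a(2) intro!: mult_left_mono\<close>)
        have 2: "\<bar>?P f y - f b * u y\<bar> \<le> B * (C' * (3 * \<omega> h))"
          by (rule order_trans[OF near[OF y b(1)]])
            (use W[OF _ dy] y B C'0 in \<open>auto simp: b(2) intro!: mult_left_mono\<close>)
        have 3: "\<bar>(f a - f b) * u y\<bar> \<le> B * (6 * \<omega> h) * U"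
        proof -
          have "\<bar>f a - f b\<bar> \<le> B * \<omega> (norm (a - b))" by (rule fB[OF a(1) b(1)])
          also have "\<dots> \<le> B * (6 * \<omega> h)" using W[OF _ ab] B by (intro mult_left_mono) auto
          finally show ?thesis
            unfolding abs_mult using U(2,3)[OF y] B wh by (intro mult_mono) auto
        qed
        \<comment> \<open>Each transform is replaced by its frozen value; the difference of
          \<open>f a * u x\<close> and \<open>f b * u y\<close> is then split into the increment of
          \<open>u\<close> and that of \<open>f\<close>.\<close>
        have "?P f x - ?P f y = (?P f x - f a * u x) - (?P f y - f b * u y) + f a * (u x - u y) + (f a - f b) * u y"
          by (simp add: algebra_simps)
        then have "\<bar>?P f x - ?P f y\<bar> \<le> B * (C' * (2 * \<omega> h)) + B * (C' * (3 * \<omega> h)) + A * (L * \<omega> h) + B * (6 * \<omega> h) * U"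
          using 1 2 3 uu by linarith
        also have "\<dots> = A * (L * \<omega> h) + B * ((5 * C' + 6 * U) * \<omega> h)"
          by (simp add: algebra_simps)
        also have "\<dots> \<le> M * (A + B) * \<omega> h"
          using L cK C'0 U w1 by (intro fin) (auto simp: M_def)
        finally show ?thesis .
      qed
      then show "\<bar>?P f x - ?P f y\<bar> \<le> M * (A + B) * \<omega> (norm (x - y))" by (simp add: h_def)
    qed
  qed
  show ?thesis
  proof (intro exI[of _ M] conjI M allI impI)
    fix A B :: real and f :: "real ^ 'n \<Rightarrow> real" and x :: "real ^ 'n"
    assume *: "A \<ge> 0" "B \<ge> 0" "\<forall>\<zeta>. norm \<zeta> = 1 \<longrightarrow> \<bar>f \<zeta>\<bar> \<le> A"
      "\<forall>\<zeta> \<eta>. norm \<zeta> = 1 \<longrightarrow> norm \<eta> = 1 \<longrightarrow> \<bar>f \<zeta> - f \<eta>\<bar> \<le> B * \<omega> (norm (\<zeta> - \<eta>))" "norm x < 1"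
    show "\<bar>?P f x\<bar> \<le> M * (A + B)"
      using main[of A B f x x] * by blast
    fix y :: "real ^ 'n" assume "norm y < 1"
    then show "\<bar>?P f x - ?P f y\<bar> \<le> M * (A + B) * \<omega> (norm (x - y))"
      using main[of A B f x y] * by blast
  qed
qed

end

section \<open>Boundary behaviour and the operator norm\<close>

text \<open>The approximate identity argument with a kernel whose mass is merely bounded: near
  \<open>a\<close> the test function is small, and away from \<open>a\<close> the kernel is of order
  \<open>(1 - r\<^sup>2) powr (1 + \<alpha>)\<close>.\<close>

lemma poisson_transform_test_fun_radial:
  fixes a :: "real ^ 'n" and \<omega> :: "real \<Rightarrow> real"
  assumes \<alpha>: "\<alpha> > -1" and \<omega>: "majorant \<omega>" and n: "CARD('n) \<ge> 2"
    and a: "norm a = 1" and \<epsilon>: "\<epsilon> > 0"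
  shows "\<exists>\<delta>\<in>{0<..1}. \<exists>c. \<forall>r. 1 - \<delta> < r \<longrightarrow> r < 1 \<longrightarrow>
    \<bar>poisson_transform \<alpha> (test_fun \<omega> a) (r *\<^sub>R a)\<bar> \<le> \<epsilon> + c * (1 - r\<^sup>2) powr (1 + \<alpha>)"
proof -
  note m = majorantD[OF \<omega>]
  let ?n = "real CARD('n)"
  have na: "0 \<le> ?n + \<alpha>" using n \<alpha> by linarith
  define k where "k = poisson_const CARD('n) \<alpha>"
  have k: "k > 0" unfolding k_def by (rule poisson_const_CARD_pos[OF \<alpha>])
  obtain U where U: "U \<ge> 0" "\<And>x :: real ^ 'n. norm x < 1 \<Longrightarrow> poisson_transform \<alpha> (\<lambda>_. 1) x \<le> U"
    using poisson_transform_1_bounded[OF \<alpha> n] by blast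
  \<comment> \<open>Chosen so that the part near \<open>a\<close> contributes at most \<epsilon>;
    the 1 excludes a zero denominator.\<close>
  define \<eta> where "\<eta> = \<epsilon> / (U + 1)"
  have \<eta>: "\<eta> > 0" "\<eta> * U \<le> \<epsilon>" using U(1) \<epsilon> by (auto simp: \<eta>_def field_simps)
  have "(\<omega> \<longlongrightarrow> \<omega> 0) (at 0 within {0..})"
    using m(1) by (simp add: continuous_on_def)
  from tendstoD[OF this \<eta>(1)] obtain d where d: "d > 0" "\<And>t. \<lbrakk>0 \<le> t; t \<noteq> 0; \<bar>t\<bar> < d\<rbrakk> \<Longrightarrow> \<bar>\<omega> t\<bar> < \<eta>"
    unfolding eventually_at using m(2) by (auto simp: dist_real_def)
  define c where "c = k / (d / 2) powr (?n + \<alpha>) * \<omega> 2"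
  \<comment> \<open>Half of \<open>d\<close> keeps \<open>r *\<^sub>R a\<close> at distance at least
    \<open>d / 2\<close> from sphere points that are \<open>d\<close> away from \<open>a\<close>;
    the bound 1 makes \<open>r\<close> positive.\<close>
  define \<delta> where "\<delta> = min 1 (d / 2)"
  have \<delta>: "\<delta> \<in> {0<..1}" "\<delta> \<le> d / 2" using d(1) by (auto simp: \<delta>_def)
  have "\<bar>poisson_transform \<alpha> (test_fun \<omega> a) (r *\<^sub>R a)\<bar> \<le> \<epsilon> + c * (1 - r\<^sup>2) powr (1 + \<alpha>)"
    if r: "1 - \<delta> < r" "r < 1" for r
  proof -
    have r0: "0 < r" using r \<delta> by auto
    define x where "x = r *\<^sub>R a"
    have nx: "norm x = r" using r0 a by (simp add: x_def)
    have x1: "norm x < 1" using nx r by simp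
    have xa: "norm (x - a) = 1 - r"
    proof -
      have "x - a = (r - 1) *\<^sub>R a" by (simp add: x_def algebra_simps)
      then show ?thesis using a r by simp
    qed
    have i1: "integrable sphere_measure (poisson_kernel \<alpha> x)"
      by (rule integrable_sphere_measure_continuous[OF continuous_on_poisson_kernel[OF \<alpha> x1]])
    have i2: "integrable (sphere_measure :: (real ^ 'n) measure) (\<lambda>_. c * (1 - r\<^sup>2) powr (1 + \<alpha>))"
      by (rule integrable_sphere_measure_continuous) auto
    have "\<bar>poisson_transform \<alpha> (test_fun \<omega> a) x\<bar> \<le>
        (\<integral>\<zeta>. \<eta> * poisson_kernel \<alpha> x \<zeta> + c * (1 - r\<^sup>2) powr (1 + \<alpha>) \<partial>sphere_measure)"
      unfolding poisson_transform_def
    proof (rule abs_integral_le)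
      show "integrable sphere_measure (\<lambda>\<zeta>. poisson_kernel \<alpha> x \<zeta> * test_fun \<omega> a \<zeta>)"
        by (rule integrable_poisson_kernel_mult[OF \<alpha> x1 continuous_on_test_fun[OF \<omega>]])
      show "integrable sphere_measure (\<lambda>\<zeta>. \<eta> * poisson_kernel \<alpha> x \<zeta> + c * (1 - r\<^sup>2) powr (1 + \<alpha>))"
        using i1 i2 by auto
      fix \<zeta> :: "real ^ 'n" assume "\<zeta> \<in> space sphere_measure"
      then have \<zeta>: "norm \<zeta> = 1" by (simp add: space_sphere_measure)
      have K0: "poisson_kernel \<alpha> x \<zeta> \<ge> 0" by (rule poisson_kernel_nonneg[OF \<alpha>])
      have t0: "test_fun \<omega> a \<zeta> \<ge> 0" unfolding test_fun_def by (rule m(4)) simp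
      have c0: "0 \<le> c * (1 - r\<^sup>2) powr (1 + \<alpha>)" using k m(4)[of 2] by (simp add: c_def)
      have "poisson_kernel \<alpha> x \<zeta> * test_fun \<omega> a \<zeta> \<le> \<eta> * poisson_kernel \<alpha> x \<zeta> + c * (1 - r\<^sup>2) powr (1 + \<alpha>)"
      proof (cases "norm (\<zeta> - a) < d")
        case True
        have "test_fun \<omega> a \<zeta> \<le> \<eta>"
          using d(2)[of "norm (\<zeta> - a)"] True \<eta> m(2) by (cases "\<zeta> = a") (auto simp: test_fun_def)
        from mult_left_mono[OF this K0] c0 show ?thesis by (simp add: mult.commute)
      next
        case False
        have "norm (\<zeta> - a) \<le> norm (x - \<zeta>) + norm (x - a)"
          using norm_triangle_ineq4[of "x - a" "x - \<zeta>"] by (simp add: add.commute)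
        then have xz: "d / 2 \<le> norm (x - \<zeta>)"
          using False xa r \<delta>(2) by simp
        have "(1 - r\<^sup>2) powr (1 + \<alpha>) / norm (x - \<zeta>) powr (?n + \<alpha>) \<le>
            (1 - r\<^sup>2) powr (1 + \<alpha>) / (d / 2) powr (?n + \<alpha>)"
          using xz d(1) na by (intro divide_left_mono powr_mono2 mult_pos_pos) auto
        from mult_left_mono[OF this less_imp_le[OF k]]
        have "poisson_kernel \<alpha> x \<zeta> \<le> k / (d / 2) powr (?n + \<alpha>) * (1 - r\<^sup>2) powr (1 + \<alpha>)"
          by (simp add: poisson_kernel_def k_def nx)
        moreover have "test_fun \<omega> a \<zeta> \<le> \<omega> 2"
          unfolding test_fun_def using norm_triangle_ineq4[of \<zeta> a] \<zeta> a by (intro m(5)) auto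
        ultimately have "poisson_kernel \<alpha> x \<zeta> * test_fun \<omega> a \<zeta> \<le>
            (k / (d / 2) powr (?n + \<alpha>) * (1 - r\<^sup>2) powr (1 + \<alpha>)) * \<omega> 2"
          using K0 t0 k by (intro mult_mono) auto
        moreover have "0 \<le> \<eta> * poisson_kernel \<alpha> x \<zeta>" using K0 \<eta> by simp
        ultimately show ?thesis by (simp add: c_def mult_ac)
      qed
      then show "\<bar>poisson_kernel \<alpha> x \<zeta> * test_fun \<omega> a \<zeta>\<bar> \<le>
          \<eta> * poisson_kernel \<alpha> x \<zeta> + c * (1 - r\<^sup>2) powr (1 + \<alpha>)"
        using K0 t0 by simp
    qed
    also have "\<dots> = \<eta> * poisson_transform \<alpha> (\<lambda>_. 1) x + c * (1 - r\<^sup>2) powr (1 + \<alpha>)"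
      using i1 i2 by (simp add: poisson_transform_def space_sphere_measure measure_sphere_measure_UNIV)
    also have "\<eta> * poisson_transform \<alpha> (\<lambda>_. 1) x \<le> \<eta> * U"
      using U(2)[OF x1] \<eta> by (intro mult_left_mono) auto
    finally show ?thesis using \<eta>(2) by (simp add: x_def)
  qed
  then show ?thesis using \<delta>(1) by blast
qed

text \<open>The point \<open>a\<close> is not in the ball, so the Lipschitz bound is used between
  \<open>x\<close> and \<open>r *\<^sub>R a\<close> with \<open>r\<close> tending to 1. The
  transform at \<open>r *\<^sub>R a\<close> is at most \<epsilon> plus a vanishing term, and
  \<epsilon> is arbitrary.\<close>

lemma test_fun_bound_of_Lipschitz:
  fixes a :: "real ^ 'n" and \<omega> :: "real \<Rightarrow> real"
  assumes \<alpha>: "\<alpha> > -1" and \<omega>: "majorant \<omega>" and n: "CARD('n) \<ge> 2" and a: "norm a = 1"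
    and L: "\<And>x y. \<lbrakk>norm x < 1; norm y < 1\<rbrakk> \<Longrightarrow>
      \<bar>poisson_transform \<alpha> (test_fun \<omega> a) x - poisson_transform \<alpha> (test_fun \<omega> a) y\<bar> \<le> L * \<omega> (norm (x - y))"
    and x: "norm x < 1"
  shows "poisson_transform \<alpha> (test_fun \<omega> a) x \<le> L * \<omega> (norm (x - a))"
proof (rule field_le_epsilon)
  fix \<epsilon> :: real assume "\<epsilon> > 0"
  from poisson_transform_test_fun_radial[OF \<alpha> \<omega> n a this]
  obtain \<delta> c where \<delta>: "0 < \<delta>" "\<delta> \<le> 1" and c: "\<And>r. \<lbrakk>1 - \<delta> < r; r < 1\<rbrakk> \<Longrightarrow>
      \<bar>poisson_transform \<alpha> (test_fun \<omega> a) (r *\<^sub>R a)\<bar> \<le> \<epsilon> + c * (1 - r\<^sup>2) powr (1 + \<alpha>)"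
    unfolding Bex_def greaterThanAtMost_iff by blast
  define F where "F r = \<epsilon> + c * (1 - r\<^sup>2) powr (1 + \<alpha>) + L * \<omega> (norm (x - r *\<^sub>R a))" for r
  have ev: "\<forall>\<^sub>F r in at_left 1. poisson_transform \<alpha> (test_fun \<omega> a) x \<le> F r"
    unfolding eventually_at_left_field
  proof (intro exI[of _ "1 - \<delta>"] conjI allI impI)
    fix r assume r: "1 - \<delta> < r" "r < 1"
    then have "norm (r *\<^sub>R a) < 1" using \<delta> a by simp
    from L[OF x this] c[OF r] show "poisson_transform \<alpha> (test_fun \<omega> a) x \<le> F r"
      unfolding F_def by linarith
  qed (use \<delta> in auto)
  have "((\<lambda>r. \<omega> (norm (x - r *\<^sub>R a))) \<longlongrightarrow> \<omega> (norm (x - 1 *\<^sub>R a))) (at_left 1)"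
  proof -
    have "continuous_on UNIV (\<lambda>r. \<omega> (norm (x - r *\<^sub>R a)))"
      by (rule continuous_on_compose2[OF majorantD(1)[OF \<omega>], of UNIV "\<lambda>r. norm (x - r *\<^sub>R a)"])
        (auto intro!: continuous_intros)
    then have "((\<lambda>r. \<omega> (norm (x - r *\<^sub>R a))) \<longlongrightarrow> \<omega> (norm (x - 1 *\<^sub>R a))) (at 1)"
      unfolding continuous_on_def by blast
    then show ?thesis by (rule tendsto_within_subset) simp
  qed
  moreover have "((\<lambda>r :: real. (1 - r\<^sup>2) powr (1 + \<alpha>)) \<longlongrightarrow> 0) (at_left 1)"
  proof -
    have "((\<lambda>r :: real. (1 - r\<^sup>2) powr (1 + \<alpha>)) \<longlongrightarrow> (1 - 1\<^sup>2) powr (1 + \<alpha>)) (at_left 1)"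
    proof (rule tendsto_powr')
      have "\<forall>\<^sub>F r :: real in at_left 1. 0 \<le> 1 - r\<^sup>2"
        unfolding eventually_at_left_field by (intro exI[of _ 0]) (auto simp: power_le_one)
      then show "1 - 1\<^sup>2 \<noteq> (0 :: real) \<or> 0 < 1 + \<alpha> \<and> (\<forall>\<^sub>F r :: real in at_left 1. 0 \<le> 1 - r\<^sup>2)"
        using \<alpha> by simp
      show "((\<lambda>r :: real. 1 - r\<^sup>2) \<longlongrightarrow> 1 - 1\<^sup>2) (at_left 1)"
        by (intro tendsto_intros)
    qed (rule tendsto_const)
    then show ?thesis by simp
  qed
  ultimately have "(F \<longlongrightarrow> \<epsilon> + c * 0 + L * \<omega> (norm (x - 1 *\<^sub>R a))) (at_left 1)"
    unfolding F_def[abs_def] by (intro tendsto_intros)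
  from tendsto_lowerbound[OF this ev] show "poisson_transform \<alpha> (test_fun \<omega> a) x \<le> L * \<omega> (norm (x - a)) + \<epsilon>"
    by (simp add: add.commute)
qed

section \<open>The extended-valued norm in terms of real constants\<close>

lemma Lambda_norm_le:
  fixes f :: "real ^ 'n \<Rightarrow> real"
  assumes \<omega>: "majorant \<omega>" and A: "\<And>x. x \<in> S \<Longrightarrow> \<bar>f x\<bar> \<le> A"
    and B: "\<And>x y. \<lbrakk>x \<in> S; y \<in> S\<rbrakk> \<Longrightarrow> \<bar>f x - f y\<bar> \<le> B * \<omega> (norm (x - y))"
  shows "Lambda_norm \<omega> S f \<le> ennreal A + ennreal B"
  unfolding Lambda_norm_def
proof (intro add_mono SUP_least)
  show "ennreal \<bar>f x\<bar> \<le> ennreal A" if "x \<in> S" for x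
    using A[OF that] by (rule ennreal_leI)
  fix z :: "(real ^ 'n) \<times> (real ^ 'n)"
  assume z: "z \<in> {(x, y). x \<in> S \<and> y \<in> S \<and> x \<noteq> y}"
  obtain x y where [simp]: "z = (x, y)" by (cases z)
  have xy: "x \<in> S" "y \<in> S" "x \<noteq> y" using z by auto
  have "\<omega> (norm (x - y)) > 0" using xy by (intro majorantD(3)[OF \<omega>]) auto
  then have "\<bar>f x - f y\<bar> / \<omega> (norm (x - y)) \<le> B"
    using B[OF xy(1,2)] by (simp add: pos_divide_le_eq)
  then show "(case z of (x, y) \<Rightarrow> ennreal (\<bar>f x - f y\<bar> / \<omega> (norm (x - y)))) \<le> ennreal B"
    by (auto intro: ennreal_leI)
qed

text \<open>\<open>A\<close> and \<open>B\<close> are the two suprema themselves. Their sum thus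
  equals the norm, and an estimate by \<open>A + B\<close> is one by the norm.\<close>

lemma Lambda_norm_bounds:
  fixes f :: "real ^ 'n \<Rightarrow> real"
  assumes \<omega>: "majorant \<omega>" and N: "Lambda_norm \<omega> S f \<noteq> \<infinity>"
  obtains A B where "A \<ge> 0" "B \<ge> 0" "Lambda_norm \<omega> S f = ennreal (A + B)"
    "\<And>x. x \<in> S \<Longrightarrow> \<bar>f x\<bar> \<le> A"
    "\<And>x y. \<lbrakk>x \<in> S; y \<in> S\<rbrakk> \<Longrightarrow> \<bar>f x - f y\<bar> \<le> B * \<omega> (norm (x - y))"
proof -
  define A' where "A' = (SUP x\<in>S. ennreal \<bar>f x\<bar>)"
  define B' where "B' = (SUP (x, y)\<in>{(x, y). x \<in> S \<and> y \<in> S \<and> x \<noteq> y}.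
      ennreal (\<bar>f x - f y\<bar> / \<omega> (norm (x - y))))"
  have sum: "Lambda_norm \<omega> S f = A' + B'" by (simp add: Lambda_norm_def A'_def B'_def)
  have fin: "A' < top" "B' < top" using N by (auto simp: sum less_top)
  define A B where "A = enn2real A'" and "B = enn2real B'"
  have AB: "A \<ge> 0" "B \<ge> 0" "A' = ennreal A" "B' = ennreal B"
    using fin by (auto simp: A_def B_def)
  have A: "\<bar>f x\<bar> \<le> A" if "x \<in> S" for x
  proof -
    have "ennreal \<bar>f x\<bar> \<le> A'" unfolding A'_def using that by (rule SUP_upper)
    then show ?thesis using AB by simp
  qed
  have B: "\<bar>f x - f y\<bar> \<le> B * \<omega> (norm (x - y))" if "x \<in> S" "y \<in> S" for x y
  proof (cases "x = y")
    case True
    then show ?thesis using majorantD(2)[OF \<omega>] by simp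
  next
    case False
    have w: "\<omega> (norm (x - y)) > 0" using False by (intro majorantD(3)[OF \<omega>]) auto
    have "(x, y) \<in> {(x, y). x \<in> S \<and> y \<in> S \<and> x \<noteq> y}" using that False by simp
    from SUP_upper[OF this, of "\<lambda>(x, y). ennreal (\<bar>f x - f y\<bar> / \<omega> (norm (x - y)))"]
    have "ennreal (\<bar>f x - f y\<bar> / \<omega> (norm (x - y))) \<le> ennreal B"
      by (simp add: B'_def[symmetric] AB(4))
    then show ?thesis using AB w by (simp add: pos_divide_le_eq)
  qed
  show ?thesis
    by (rule that[OF AB(1,2) _ A B]) (simp_all add: sum AB ennreal_plus)
qed

text \<open>Membership bounds only the Lipschitz part; compactness of the sphere bounds the
  supremum. It rules out infinite denominators in the operator norm, where a quotient in
  \<open>ennreal\<close> would be 0.\<close>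

lemma Lambda_norm_finite:
  fixes f :: "real ^ 'n \<Rightarrow> real"
  assumes \<omega>: "majorant \<omega>" and f: "f \<in> Lambda_space \<omega> (sphere 0 1)"
  shows "Lambda_norm \<omega> (sphere 0 1) f \<noteq> \<infinity>"
proof -
  obtain C where C: "C > 0"
    "\<And>x y. \<lbrakk>x \<in> sphere 0 1; y \<in> sphere 0 1\<rbrakk> \<Longrightarrow> \<bar>f x - f y\<bar> \<le> C * \<omega> (norm (x - y))"
    using f by (auto simp: Lambda_space_def)
  have "continuous_on (sphere 0 1) f"
    using C(2) by (rule continuous_on_majorant_Lipschitz[OF \<omega>])
  then have "compact (f ` sphere 0 1)"
    by (intro compact_continuous_image) auto
  then obtain A where "\<forall>y\<in>f ` sphere 0 1. norm y \<le> A"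
    using compact_imp_bounded bounded_iff by metis
  then have "Lambda_norm \<omega> (sphere 0 1) f \<le> ennreal A + ennreal C"
    using C(2) by (intro Lambda_norm_le[OF \<omega>]) auto
  also have "\<dots> < \<infinity>" by simp
  finally show ?thesis by simp
qed

theorem theorem1p3:
  fixes \<omega> :: "real \<Rightarrow> real" and \<alpha> :: real
  assumes "CARD('n::finite) \<ge> 2"
    and "majorant \<omega>"
    and "\<alpha> > -1"
  shows "Lambda_op_norm \<omega>
           (poisson_transform \<alpha> :: (real ^ 'n \<Rightarrow> real) \<Rightarrow> real ^ 'n \<Rightarrow> real) < \<infinity>
         \<longleftrightarrow>
         (\<exists>C::real. \<forall>x\<in>ball (0 :: real ^ 'n) 1. \<forall>a\<in>sphere 0 1.
            poisson_transform \<alpha> (test_fun \<omega> a) x \<le> C * \<omega> (norm (x - a)))"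
proof
  note n = assms(1) and \<omega> = assms(2) and \<alpha> = assms(3)
  note m = majorantD[OF \<omega>]
  let ?P = "poisson_transform \<alpha> :: (real ^ 'n \<Rightarrow> real) \<Rightarrow> real ^ 'n \<Rightarrow> real"
  let ?S = "sphere (0 :: real ^ 'n) 1" and ?B = "ball (0 :: real ^ 'n) 1"
  {
    assume fin: "Lambda_op_norm \<omega> ?P < \<infinity>"
    define K where "K = enn2real (Lambda_op_norm \<omega> ?P)"
    have K: "Lambda_op_norm \<omega> ?P = ennreal K" "K \<ge> 0"
      using fin by (auto simp: K_def)
    \<comment> \<open>The norm of a test function is at most \<open>\<omega> 2 + 1\<close>: the
      diameter of the sphere is 2 and the Lipschitz constant is 1.\<close>
    define L where "L = K * (\<omega> 2 + 1)"
    have w2: "\<omega> 2 > 0" by (rule m(3)) simp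
    have L: "L \<ge> 0" using K(2) w2 by (simp add: L_def)
    show "\<exists>C::real. \<forall>x\<in>?B. \<forall>a\<in>?S. ?P (test_fun \<omega> a) x \<le> C * \<omega> (norm (x - a))"
    proof (intro exI[of _ L] ballI)
      fix x a :: "real ^ 'n" assume "x \<in> ?B" "a \<in> ?S"
      then have x: "norm x < 1" and a: "norm a = 1" by auto
      have Lip: "\<bar>test_fun \<omega> a \<zeta> - test_fun \<omega> a \<eta>\<bar> \<le> 1 * \<omega> (norm (\<zeta> - \<eta>))" for \<zeta> \<eta>
      proof -
        have "\<bar>test_fun \<omega> a \<zeta> - test_fun \<omega> a \<eta>\<bar> \<le> \<omega> \<bar>norm (\<zeta> - a) - norm (\<eta> - a)\<bar>"
          unfolding test_fun_def by (rule majorant_diff_le[OF \<omega>]) auto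
        also have "\<dots> \<le> \<omega> (norm (\<zeta> - \<eta>))"
          using norm_triangle_ineq3[of "\<zeta> - a" "\<eta> - a"] by (intro m(5)) auto
        finally show ?thesis by simp
      qed
      have mem: "test_fun \<omega> a \<in> Lambda_space \<omega> ?S"
        unfolding Lambda_space_def using Lip by (auto intro!: exI[of _ 1])
      have N1: "Lambda_norm \<omega> ?S (test_fun \<omega> a) \<le> ennreal (\<omega> 2) + ennreal 1"
      proof (rule Lambda_norm_le[OF \<omega>])
        fix \<zeta> assume "\<zeta> \<in> ?S"
        then have "norm (\<zeta> - a) \<le> 2" using norm_triangle_ineq4[of \<zeta> a] a by simp
        then show "\<bar>test_fun \<omega> a \<zeta>\<bar> \<le> \<omega> 2"
          unfolding test_fun_def using m(4)[of "norm (\<zeta> - a)"] m(5)[of "norm (\<zeta> - a)" 2] by simp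
      qed (rule Lip)
      have N0: "Lambda_norm \<omega> ?S (test_fun \<omega> a) \<noteq> 0"
      proof
        assume 0: "Lambda_norm \<omega> ?S (test_fun \<omega> a) = 0"
        then have "(SUP \<zeta>\<in>?S. ennreal \<bar>test_fun \<omega> a \<zeta>\<bar>) = 0" by (simp add: Lambda_norm_def)
        moreover have "ennreal \<bar>test_fun \<omega> a (- a)\<bar> \<le> (SUP \<zeta>\<in>?S. ennreal \<bar>test_fun \<omega> a \<zeta>\<bar>)"
          by (rule SUP_upper) (use a in auto)
        moreover have "norm (- a - a) = 2"
        proof -
          have "- a - a = (- 2) *\<^sub>R a" by (simp add: scaleR_2)
          then show ?thesis using a by simp
        qed
        ultimately show False using w2 by (simp add: test_fun_def)
      qed
      have quot: "Lambda_norm \<omega> ?B (?P (test_fun \<omega> a)) / Lambda_norm \<omega> ?S (test_fun \<omega> a) \<le> ennreal K"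
        unfolding K(1)[symmetric] Lambda_op_norm_def using mem N0 by (intro Sup_upper) blast
      have Nfin: "Lambda_norm \<omega> ?S (test_fun \<omega> a) \<noteq> \<infinity>"
        by (rule Lambda_norm_finite[OF \<omega> mem])
      \<comment> \<open>Clearing the denominator in \<open>ennreal\<close> requires it to be neither
        0 nor infinite.\<close>
      have "Lambda_norm \<omega> ?B (?P (test_fun \<omega> a)) =
          Lambda_norm \<omega> ?B (?P (test_fun \<omega> a)) / Lambda_norm \<omega> ?S (test_fun \<omega> a) * Lambda_norm \<omega> ?S (test_fun \<omega> a)"
        using N0 Nfin by (simp add: ennreal_divide_times ennreal_times_divide mult_divide_eq_ennreal)
      also have "\<dots> \<le> ennreal K * Lambda_norm \<omega> ?S (test_fun \<omega> a)"
        by (rule mult_right_mono[OF quot]) simp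
      also have "\<dots> \<le> ennreal K * (ennreal (\<omega> 2) + ennreal 1)"
        by (rule mult_left_mono[OF N1]) simp
      also have "\<dots> = ennreal L"
        using K(2) w2 by (simp add: L_def ennreal_mult ennreal_plus)
      finally have NL: "Lambda_norm \<omega> ?B (?P (test_fun \<omega> a)) \<le> ennreal L" .
      then have "Lambda_norm \<omega> ?B (?P (test_fun \<omega> a)) \<noteq> \<infinity>"
        using le_less_trans[OF NL ennreal_less_top] by auto
      then obtain A B where AB: "A \<ge> 0" "B \<ge> 0" "Lambda_norm \<omega> ?B (?P (test_fun \<omega> a)) = ennreal (A + B)"
        "\<And>x y. \<lbrakk>x \<in> ?B; y \<in> ?B\<rbrakk> \<Longrightarrow> \<bar>?P (test_fun \<omega> a) x - ?P (test_fun \<omega> a) y\<bar> \<le> B * \<omega> (norm (x - y))"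
        by (rule Lambda_norm_bounds[OF \<omega>]) blast
      have "A + B \<le> L" using NL[unfolded AB(3)] L by (simp only: ennreal_le_iff)
      then have BL: "B \<le> L" using AB(1) by simp
      show "?P (test_fun \<omega> a) x \<le> L * \<omega> (norm (x - a))"
      proof (rule test_fun_bound_of_Lipschitz[OF \<alpha> \<omega> n a _ x])
        fix y z :: "real ^ 'n" assume "norm y < 1" "norm z < 1"
        then have "\<bar>?P (test_fun \<omega> a) y - ?P (test_fun \<omega> a) z\<bar> \<le> B * \<omega> (norm (y - z))"
          using AB(4)[of y z] by simp
        also have "\<dots> \<le> L * \<omega> (norm (y - z))"
          by (rule mult_right_mono[OF BL]) (simp add: m(4))
        finally show "\<bar>?P (test_fun \<omega> a) y - ?P (test_fun \<omega> a) z\<bar> \<le> L * \<omega> (norm (y - z))" .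
      qed
    qed
  next
    assume "\<exists>C::real. \<forall>x\<in>?B. \<forall>a\<in>?S. ?P (test_fun \<omega> a) x \<le> C * \<omega> (norm (x - a))"
    then obtain C where "\<forall>x\<in>?B. \<forall>a\<in>?S. ?P (test_fun \<omega> a) x \<le> C * \<omega> (norm (x - a))" ..
    then have C: "?P (test_fun \<omega> a) x \<le> C * \<omega> (norm (x - a))" if "norm x < 1" "norm a = 1" for x a
      using that by simp
    obtain M where M: "M \<ge> 0 \<and> (\<forall>A\<ge>0. \<forall>B\<ge>0. \<forall>f :: real ^ 'n \<Rightarrow> real.
      (\<forall>\<zeta>. norm \<zeta> = 1 \<longrightarrow> \<bar>f \<zeta>\<bar> \<le> A) \<longrightarrow>
      (\<forall>\<zeta> \<eta>. norm \<zeta> = 1 \<longrightarrow> norm \<eta> = 1 \<longrightarrow> \<bar>f \<zeta> - f \<eta>\<bar> \<le> B * \<omega> (norm (\<zeta> - \<eta>))) \<longrightarrow>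
      (\<forall>x. norm x < 1 \<longrightarrow> \<bar>?P f x\<bar> \<le> M * (A + B)) \<and>
      (\<forall>x y. norm x < 1 \<longrightarrow> norm y < 1 \<longrightarrow> \<bar>?P f x - ?P f y\<bar> \<le> M * (A + B) * \<omega> (norm (x - y))))"
      using poisson_transform_Lipschitz[OF \<alpha> \<omega> n C] ..
    note M0 = M[THEN conjunct1]
    \<comment> \<open>The factor 2 arises because the supremum and the Lipschitz part are each
      bounded by \<open>M\<close> times the norm of \<open>f\<close>.\<close>
    have "Lambda_op_norm \<omega> ?P \<le> ennreal (2 * M)"
      unfolding Lambda_op_norm_def
    proof (rule Sup_least, clarify)
      fix f assume f: "f \<in> Lambda_space \<omega> ?S" and N0: "Lambda_norm \<omega> ?S f \<noteq> 0"
      obtain A B where AB: "A \<ge> 0" "B \<ge> 0" "Lambda_norm \<omega> ?S f = ennreal (A + B)"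
        "\<And>x. x \<in> ?S \<Longrightarrow> \<bar>f x\<bar> \<le> A"
        "\<And>x y. \<lbrakk>x \<in> ?S; y \<in> ?S\<rbrakk> \<Longrightarrow> \<bar>f x - f y\<bar> \<le> B * \<omega> (norm (x - y))"
        by (rule Lambda_norm_bounds[OF \<omega> Lambda_norm_finite[OF \<omega> f]]) blast
      have f1: "\<forall>\<zeta>. norm \<zeta> = 1 \<longrightarrow> \<bar>f \<zeta>\<bar> \<le> A"
        using AB(4) by simp
      have f2: "\<forall>\<zeta> \<eta>. norm \<zeta> = 1 \<longrightarrow> norm \<eta> = 1 \<longrightarrow> \<bar>f \<zeta> - f \<eta>\<bar> \<le> B * \<omega> (norm (\<zeta> - \<eta>))"
        using AB(5) by simp
      note Mf = M[THEN conjunct2, THEN spec, THEN mp, OF AB(1), THEN spec, THEN mp, OF AB(2),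
          THEN spec[of _ f], THEN mp, OF f1, THEN mp, OF f2]
      have "Lambda_norm \<omega> ?B (?P f) \<le> ennreal (M * (A + B)) + ennreal (M * (A + B))"
      proof (rule Lambda_norm_le[OF \<omega>])
        show "\<bar>?P f x\<bar> \<le> M * (A + B)" if "x \<in> ?B" for x
          using Mf[THEN conjunct1, THEN spec[of _ x]] that by simp
        show "\<bar>?P f x - ?P f y\<bar> \<le> M * (A + B) * \<omega> (norm (x - y))" if "x \<in> ?B" "y \<in> ?B" for x y
          using Mf[THEN conjunct2, THEN spec[of _ x], THEN spec[of _ y]] that by simp
      qed
      also have "\<dots> = ennreal (2 * M) * Lambda_norm \<omega> ?S f"
        using AB(1,2) M0 by (simp add: AB(3) ennreal_mult[symmetric] ennreal_plus[symmetric] del: ennreal_plus)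
      finally show "Lambda_norm \<omega> ?B (?P f) / Lambda_norm \<omega> ?S f \<le> ennreal (2 * M)"
        using N0 by (intro divide_le_posI_ennreal) (simp_all add: mult.commute zero_less_iff_neq_zero)
    qed
    also have "\<dots> < \<infinity>" by simp
    finally show "Lambda_op_norm \<omega> ?P < \<infinity>" .
  }
qed

end
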